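(* Let $m\ge1$ and $d\ge 5$. Fix a finite set $B\subset\mathbb{P}^m$ such that $\rho:=\sharp(B)\le d$ and no subset of $B$ with cardinality $\lfloor (d+1)/2\rfloor$ is collinear. Fix $P\in\langle\nu_d(B)\rangle$ such that $P\notin\langle\mathcal{E}\rangle$ for any $\mathcal{E}\subsetneqq\nu_d(B)$. Then $\mathrm{sr}(P)=\mathrm{sbr}(P)=\rho$, and $\nu_d(B)$ is the only $0$-dimensional scheme $\mathcal{Z}\subset X_{m,d}$ such that $\deg(\mathcal{Z})\le\rho$ and $P\in\langle\mathcal{Z}\rangle$.
   Context: $K$ is an algebraically closed field of characteristic $0$; all schemes are over $K$. $\nu_d:\mathbb{P}^m\to\mathbb{P}^N$, $N=\binom{m+d}{d}-1$, is the $d$-uple Veronese embedding and $X_{m,d}=\nu_d(\mathbb{P}^m)$. The linear span $\langle\mathcal{W}\rangle$ of a closed subscheme $\mathcal{W}\subset\mathbb{P}^N$ is the smallest linear subspace containing $\mathcal{W}$ as a scheme. The symmetric rank $\mathrm{sr}(P)$ is the minimal cardinality of a finite set $\mathcal{S}\subset X_{m,d}$ with $P\in\langle\mathcal{S}\rangle$. The symmetric border rank $\mathrm{sbr}(P)$ is the minimal $s$ such that $P\in\sigma_s(X_{m,d})$, where $\sigma_s(X_{m,d})$ is the Zariski closure of the union of all linear spans $\langle P_1,\dots,P_s\rangle$ with $P_1,\dots,P_s\in X_{m,d}$. *)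

theory Defs
  imports
    "HOL-Library.Poly_Mapping"
    "HOL-Library.Function_Algebras"
    "HOL-Computational_Algebra.Polynomial"
begin

section \<open>Projective space with coordinates indexed by a set\<close>

text \<open>
  The projective space with homogeneous coordinates indexed by a finite set \<open>J\<close> is the set of
  classes, modulo nonzero scalars, of nonzero functions that vanish outside \<open>J\<close>.  Thus
  \<open>\<P>\<^sup>m\<close> is the case \<open>J = {..m}\<close>; the target of the Veronese embedding has its coordinates
  indexed by the monomials of degree \<open>d\<close> in \<open>m + 1\<close> variables.
\<close>

definition fscale :: "'k::field \<Rightarrow> ('i \<Rightarrow> 'k) \<Rightarrow> 'i \<Rightarrow> 'k" where
  "fscale c x = (\<lambda>i. c * x i)"

interpretation fvec: vector_space fscale
  by unfold_locales (auto simp: fscale_def fun_eq_iff algebra_simps)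

definition vecs :: "'i set \<Rightarrow> ('i \<Rightarrow> 'k::field) set" where
  "vecs J = {x. \<forall>i. i \<notin> J \<longrightarrow> x i = 0}"

definition proj_rel :: "'i set \<Rightarrow> (('i \<Rightarrow> 'k::field) \<times> ('i \<Rightarrow> 'k)) set" where
  "proj_rel J = {(x, y). x \<in> vecs J - {0} \<and> y \<in> vecs J - {0} \<and> (\<exists>c. c \<noteq> 0 \<and> y = fscale c x)}"

definition proj_space :: "'i set \<Rightarrow> ('i \<Rightarrow> 'k::field) set set" where
  "proj_space J = (vecs J - {0}) // proj_rel J"

lemma equiv_proj_rel: "equiv (vecs J - {0}) (proj_rel J :: (('i \<Rightarrow> 'k::field) \<times> _) set)"
proof (rule equivI)
  show "proj_rel J \<subseteq> (vecs J - {0 :: 'i \<Rightarrow> 'k}) \<times> (vecs J - {0})"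
    by (auto simp: proj_rel_def)
  show "refl_on (vecs J - {0 :: 'i \<Rightarrow> 'k}) (proj_rel J)"
    by (auto simp: refl_on_def proj_rel_def fscale_def intro!: exI[of _ 1])
  show "sym (proj_rel J :: (('i \<Rightarrow> 'k) \<times> _) set)"
  proof (rule symI)
    fix x y :: "'i \<Rightarrow> 'k" assume "(x, y) \<in> proj_rel J"
    then obtain c where c: "x \<in> vecs J - {0}" "y \<in> vecs J - {0}" "c \<noteq> 0" "y = fscale c x"
      by (auto simp: proj_rel_def)
    then have "inverse c \<noteq> 0" "x = fscale (inverse c) y"
      by (auto simp: fscale_def fun_eq_iff)
    with c(1,2) show "(y, x) \<in> proj_rel J" unfolding proj_rel_def by blast
  qed
  show "trans (proj_rel J :: (('i \<Rightarrow> 'k) \<times> _) set)"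
  proof (rule transI)
    fix x y z :: "'i \<Rightarrow> 'k" assume "(x, y) \<in> proj_rel J" "(y, z) \<in> proj_rel J"
    then obtain c e where c: "x \<in> vecs J - {0}" "z \<in> vecs J - {0}" "c \<noteq> 0" "e \<noteq> 0"
      "y = fscale c x" "z = fscale e y"
      by (auto simp: proj_rel_def)
    then have "e * c \<noteq> 0" "z = fscale (e * c) x"
      by (auto simp: fscale_def fun_eq_iff)
    with c(1,2) show "(x, z) \<in> proj_rel J" unfolding proj_rel_def by blast
  qed
qed

text \<open>The projectivisation of a vector subspace \<open>V\<close> of \<open>vecs J\<close>.\<close>

definition proj_of :: "'i set \<Rightarrow> ('i \<Rightarrow> 'k::field) set \<Rightarrow> ('i \<Rightarrow> 'k) set set" where
  "proj_of J V = {p \<in> proj_space J. p \<subseteq> V}"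

definition linear_subspace :: "'i set \<Rightarrow> ('i \<Rightarrow> 'k::field) set set \<Rightarrow> bool" where
  "linear_subspace J L \<longleftrightarrow> (\<exists>V. fvec.subspace V \<and> V \<subseteq> vecs J \<and> L = proj_of J V)"

definition collinear_pts :: "'i set \<Rightarrow> ('i \<Rightarrow> 'k::field) set set \<Rightarrow> bool" where
  "collinear_pts J A \<longleftrightarrow>
    (\<exists>V. fvec.subspace V \<and> V \<subseteq> vecs J \<and> fvec.dim V = 2 \<and> A \<subseteq> proj_of J V)"


section \<open>Homogeneous coordinate rings\<close>

text \<open>
  Polynomials with variables in \<open>'i\<close> are finitely supported maps from exponent vectors
  \<open>'i \<Rightarrow>\<^sub>0 nat\<close> to coefficients, with the convolution product of \<^theory>\<open>HOL-Library.Poly_Mapping\<close>.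
\<close>

type_synonym ('i, 'k) mpol = "('i \<Rightarrow>\<^sub>0 nat) \<Rightarrow>\<^sub>0 'k"

definition mdeg :: "('i \<Rightarrow>\<^sub>0 nat) \<Rightarrow> nat" where
  "mdeg a = (\<Sum>i\<in>Poly_Mapping.keys a. Poly_Mapping.lookup a i)"

definition monoms :: "'i set \<Rightarrow> nat \<Rightarrow> ('i \<Rightarrow>\<^sub>0 nat) set" where
  "monoms J t = {a. Poly_Mapping.keys a \<subseteq> J \<and> mdeg a = t}"

definition mon_eval :: "('i \<Rightarrow>\<^sub>0 nat) \<Rightarrow> ('i \<Rightarrow> 'k::field) \<Rightarrow> 'k" where
  "mon_eval a x = (\<Prod>i\<in>Poly_Mapping.keys a. x i ^ Poly_Mapping.lookup a i)"

definition mp_eval :: "('i, 'k::field) mpol \<Rightarrow> ('i \<Rightarrow> 'k) \<Rightarrow> 'k" where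
  "mp_eval f x = (\<Sum>a\<in>Poly_Mapping.keys f. Poly_Mapping.lookup f a * mon_eval a x)"

definition polys :: "'i set \<Rightarrow> ('i, 'k::field) mpol set" where
  "polys J = {f. \<forall>a\<in>Poly_Mapping.keys f. Poly_Mapping.keys a \<subseteq> J}"

text \<open>The space of forms of degree \<open>t\<close> (including \<open>0\<close>), and the degree \<open>t\<close> part of a polynomial.\<close>

definition forms :: "'i set \<Rightarrow> nat \<Rightarrow> ('i, 'k::field) mpol set" where
  "forms J t = {f. Poly_Mapping.keys f \<subseteq> monoms J t}"

definition hom_part :: "nat \<Rightarrow> ('i, 'k::field) mpol \<Rightarrow> ('i, 'k) mpol" where
  "hom_part t f = (\<Sum>a\<in>{a \<in> Poly_Mapping.keys f. mdeg a = t}.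
     Poly_Mapping.single a (Poly_Mapping.lookup f a))"

definition pscale :: "'k::field \<Rightarrow> ('i, 'k) mpol \<Rightarrow> ('i, 'k) mpol" where
  "pscale c f = Poly_Mapping.single 0 c * f"

interpretation pvec: vector_space "pscale :: 'k::field \<Rightarrow> ('i, 'k) mpol \<Rightarrow> _"
  by unfold_locales
    (auto simp: pscale_def distrib_left distrib_right single_add mult_single mult.assoc[symmetric]
      simp flip: one_poly_mapping.abs_eq)

definition vanishes_at :: "('i, 'k::field) mpol \<Rightarrow> ('i \<Rightarrow> 'k) set \<Rightarrow> bool" where
  "vanishes_at f p \<longleftrightarrow> (\<forall>x\<in>p. mp_eval f x = 0)"

text \<open>
  Over an infinite field, a polynomial that vanishes at all representatives of a point has all
  its homogeneous parts vanishing there, so this is the usual homogeneous ideal of \<open>S\<close>.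
\<close>

definition vanishing_ideal :: "'i set \<Rightarrow> ('i \<Rightarrow> 'k::field) set set \<Rightarrow> ('i, 'k) mpol set" where
  "vanishing_ideal J S = {f \<in> polys J. \<forall>p\<in>S. vanishes_at f p}"

definition zariski_closed :: "'i set \<Rightarrow> ('i \<Rightarrow> 'k::field) set set \<Rightarrow> bool" where
  "zariski_closed J C \<longleftrightarrow>
    (\<exists>F \<subseteq> (\<Union>t. forms J t). C = {p \<in> proj_space J. \<forall>f\<in>F. vanishes_at f p})"

definition zariski_closure :: "'i set \<Rightarrow> ('i \<Rightarrow> 'k::field) set set \<Rightarrow> ('i \<Rightarrow> 'k) set set" where
  "zariski_closure J S = \<Inter>{C. zariski_closed J C \<and> S \<subseteq> C}"


section \<open>Closed subschemes\<close>

text \<open>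
  Closed subschemes of projective space correspond bijectively to saturated homogeneous ideals
  of the homogeneous coordinate ring, the empty scheme to the unit ideal.  A closed subscheme is
  represented by this ideal; inclusion of subschemes is reverse inclusion of ideals, and a closed
  set of points with its reduced structure (in particular a finite set) is represented by its
  \<^const>\<open>vanishing_ideal\<close>.  Saturation says that \<open>f \<in> I\<close> as soon as all products of \<open>f\<close> with
  monomials of some fixed degree are in \<open>I\<close>.
\<close>

definition closed_subscheme :: "'i set \<Rightarrow> ('i, 'k::field) mpol set \<Rightarrow> bool" where
  "closed_subscheme J I \<longleftrightarrow>
     I \<subseteq> polys J \<and> 0 \<in> I \<and> (\<forall>f\<in>I. \<forall>g\<in>I. f + g \<in> I) \<and> (\<forall>f\<in>I. \<forall>g\<in>polys J. g * f \<in> I) \<and>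
     (\<forall>f\<in>I. \<forall>t. hom_part t f \<in> I) \<and>
     (\<forall>f\<in>polys J. (\<exists>k. \<forall>a\<in>monoms J k. Poly_Mapping.single a 1 * f \<in> I) \<longrightarrow> f \<in> I)"

text \<open>
  The Hilbert function \<open>t \<mapsto> dim (S\<^sub>t / I\<^sub>t)\<close>, where \<open>S\<^sub>t\<close> is finite dimensional for finite \<open>J\<close>.
  For large \<open>t\<close> it is the Hilbert polynomial, whose degree is the dimension of the scheme; in
  dimension \<open>0\<close> it is the nonzero constant \<open>dim H\<^sup>0(Z, O\<^sub>Z)\<close>, the degree of \<open>Z\<close>.
\<close>

definition hilbert_fun :: "'i set \<Rightarrow> ('i, 'k::field) mpol set \<Rightarrow> nat \<Rightarrow> nat" where
  "hilbert_fun J I t = pvec.dim (forms J t :: ('i, 'k) mpol set) - pvec.dim (forms J t \<inter> I)"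

definition zero_dimensional :: "'i set \<Rightarrow> ('i, 'k::field) mpol set \<Rightarrow> bool" where
  "zero_dimensional J I \<longleftrightarrow> (\<exists>n>0. \<forall>\<^sub>F t in sequentially. hilbert_fun J I t = n)"

definition scheme_degree :: "'i set \<Rightarrow> ('i, 'k::field) mpol set \<Rightarrow> nat" where
  "scheme_degree J I = (THE n. \<forall>\<^sub>F t in sequentially. hilbert_fun J I t = n)"

text \<open>The intersection of all linear subspaces containing the subscheme scheme-theoretically.\<close>

definition scheme_span :: "'i set \<Rightarrow> ('i, 'k::field) mpol set \<Rightarrow> ('i \<Rightarrow> 'k) set set" where
  "scheme_span J I = \<Inter>{L. linear_subspace J L \<and> vanishing_ideal J L \<subseteq> I}"

abbreviation span_pts :: "'i set \<Rightarrow> ('i \<Rightarrow> 'k::field) set set \<Rightarrow> ('i \<Rightarrow> 'k) set set" where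
  "span_pts J S \<equiv> scheme_span J (vanishing_ideal J S)"


section \<open>Veronese varieties, symmetric rank and symmetric border rank\<close>

abbreviation ver_coords :: "nat \<Rightarrow> nat \<Rightarrow> (nat \<Rightarrow>\<^sub>0 nat) set" where
  "ver_coords m d \<equiv> monoms {..m} d"

definition ver_vec :: "nat \<Rightarrow> nat \<Rightarrow> (nat \<Rightarrow> 'k::field) \<Rightarrow> (nat \<Rightarrow>\<^sub>0 nat) \<Rightarrow> 'k" where
  "ver_vec m d x = (\<lambda>a. if a \<in> ver_coords m d then mon_eval a x else 0)"

definition veronese ::
    "nat \<Rightarrow> nat \<Rightarrow> (nat \<Rightarrow> 'k::field) set \<Rightarrow> ((nat \<Rightarrow>\<^sub>0 nat) \<Rightarrow> 'k) set" where
  "veronese m d p = (\<Union>x\<in>p. proj_rel (ver_coords m d) `` {ver_vec m d x})"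

definition veronese_variety :: "nat \<Rightarrow> nat \<Rightarrow> ((nat \<Rightarrow>\<^sub>0 nat) \<Rightarrow> 'k::field) set set" where
  "veronese_variety m d = veronese m d ` proj_space {..m}"

definition sym_rank :: "nat \<Rightarrow> nat \<Rightarrow> ((nat \<Rightarrow>\<^sub>0 nat) \<Rightarrow> 'k::field) set \<Rightarrow> nat" where
  "sym_rank m d P = (LEAST r. \<exists>S \<subseteq> veronese_variety m d.
     finite S \<and> card S = r \<and> P \<in> span_pts (ver_coords m d) S)"

definition secant_variety :: "nat \<Rightarrow> nat \<Rightarrow> nat \<Rightarrow> ((nat \<Rightarrow>\<^sub>0 nat) \<Rightarrow> 'k::field) set set" where
  "secant_variety m d s = zariski_closure (ver_coords m d)
     (\<Union>Q \<in> {Q :: nat \<Rightarrow> _. Q ` {..<s} \<subseteq> veronese_variety m d}.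
        span_pts (ver_coords m d) (Q ` {..<s}))"

definition sym_border_rank :: "nat \<Rightarrow> nat \<Rightarrow> ((nat \<Rightarrow>\<^sub>0 nat) \<Rightarrow> 'k::field) set \<Rightarrow> nat" where
  "sym_border_rank m d P = (LEAST s. P \<in> secant_variety m d s)"

lemma ver_vec_fscale: "ver_vec m d (fscale c x) = fscale (c ^ d) (ver_vec m d x)"
  by (auto simp: ver_vec_def fscale_def fun_eq_iff mon_eval_def power_mult_distrib prod.distrib
      monoms_def mdeg_def power_sum)

lemma ver_vec_nonzero:
  assumes "x \<in> vecs {..m} - {0}"
  shows "ver_vec m d x \<in> vecs (ver_coords m d) - {0}"
proof -
  obtain i where i: "x i \<noteq> 0" using assms by (auto simp: fun_eq_iff)
  then have "i \<le> m" using assms by (auto simp: vecs_def not_le)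
  let ?a = "Poly_Mapping.single i d"
  have "?a \<in> ver_coords m d" "mon_eval ?a x \<noteq> 0"
    using i \<open>i \<le> m\<close> by (auto simp: monoms_def mdeg_def mon_eval_def)
  then have "ver_vec m d x ?a \<noteq> 0" by (simp add: ver_vec_def)
  then have "ver_vec m d x \<noteq> 0" by (metis zero_fun_apply)
  moreover have "ver_vec m d x \<in> vecs (ver_coords m d)"
    by (auto simp: vecs_def ver_vec_def)
  ultimately show ?thesis by simp
qed

lemma veronese_class:
  assumes "x \<in> vecs {..m} - {0}"
  shows "veronese m d (proj_rel {..m} `` {x}) = proj_rel (ver_coords m d) `` {ver_vec m d x}"
proof -
  have "proj_rel (ver_coords m d) `` {ver_vec m d y} = proj_rel (ver_coords m d) `` {ver_vec m d x}"
    if y: "y \<in> proj_rel {..m} `` {x}" for y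
  proof -
    obtain c where c: "c \<noteq> 0" "y = fscale c x" and "y \<in> vecs {..m} - {0}"
      using y by (auto simp: proj_rel_def)
    then have "(ver_vec m d x, ver_vec m d y) \<in> proj_rel (ver_coords m d)"
      unfolding proj_rel_def
      using ver_vec_nonzero[OF assms, of d] ver_vec_nonzero[of y m d]
      by (auto simp: ver_vec_fscale intro!: exI[of _ "c ^ d"])
    then show ?thesis
      using equiv_class_eq[OF equiv_proj_rel] by metis
  qed
  moreover have "x \<in> proj_rel {..m} `` {x}"
    using equiv_class_self[OF equiv_proj_rel assms] .
  ultimately show ?thesis unfolding veronese_def by blast
qed

end

theory Submission
  imports Defs "Jordan_Normal_Form.Determinant"
begin

text \<open>
  A vector \<open>p\<close> of \<open>P\<close> is a functional on forms of degree \<open>d = t + s\<close>, \<open>t = d div 2\<close>, namely a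
  combination of the evaluations at the points of \<open>B\<close> with nonzero coefficients.  Since no \<open>s\<close>
  points of \<open>B\<close> are collinear and \<open>card B \<le> 2 * t + 1\<close>, the points of \<open>B\<close> can be separated by products
  of \<open>t\<close> linear forms, so the catalecticant pairing of forms of degrees \<open>t\<close> and \<open>s\<close> given by \<open>p\<close>
  has rank \<open>card B\<close>; on the span of \<open>r\<close> points of the Veronese variety it has rank at most \<open>r\<close>.
  This bounds the border rank.

  Let \<open>W\<close> be the homogeneous ideal in \<open>m + 1\<close> variables of a scheme \<open>Z\<close> as in the theorem.  Its part of
  degree \<open>s\<close> lies in the kernel of the pairing, which is the degree \<open>s\<close> part of the
  ideal of \<open>B\<close>.  The Hilbert function of a saturated ideal is nondecreasing, hence bounded by
  \<open>card B\<close>, so the two ideals agree in degree \<open>s\<close>.  As the ideal of \<open>B\<close> is generated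
  in degrees up to \<open>s\<close>, it is contained in \<open>W\<close> in all degrees from \<open>s\<close> on, with equality because the
  codimensions agree.
\<close>

section \<open>Evaluation and substitution of polynomials\<close>

text \<open>That a Hilbert function does not decrease is usually seen by multiplying with a linear
  form that is a nonzerodivisor modulo the ideal, whose existence rests on associated primes. Here
  the generic form \<open>\<Sum>i\<le>m. var i * u ^ i\<close> takes its place: saturation makes it
  a nonzerodivisor, and working with polynomials of large degree in \<open>u\<close> makes up for
  the extra variable. A second obstacle is that the ideal of \<open>Z\<close> lives in the Veronese
  coordinates and so reaches only degrees divisible by \<open>d\<close>, whereas the comparison with
  \<open>B\<close> takes place in degree \<open>s\<close>, which is smaller than \<open>d\<close>.
  The family \<open>W\<close> fills in the other degrees by a colon construction and is again
  saturated. The generation of the ideal of \<open>B\<close> is critical when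
  \<open>card B = d = 2 * s\<close>. Separators of degree \<open>s - 1\<close> then need not exist,
  as for points on a smooth conic, so multiples of separators of degree \<open>s\<close> have to be
  treated by hand.\<close>

lemma poly_mapping_sum_single:
  "f = (\<Sum>a\<in>Poly_Mapping.keys f. Poly_Mapping.single a (Poly_Mapping.lookup f a))"
  by (rule poly_mapping_eqI)
    (auto simp: lookup_sum lookup_single when_def in_keys_iff)

definition mon_prod :: "('i \<Rightarrow> 'r::comm_monoid_mult) \<Rightarrow> ('i \<Rightarrow>\<^sub>0 nat) \<Rightarrow> 'r" where
  "mon_prod \<sigma> a = (\<Prod>i\<in>Poly_Mapping.keys a. \<sigma> i ^ Poly_Mapping.lookup a i)"

lemma mon_prod_superset:
  assumes "finite F" "Poly_Mapping.keys a \<subseteq> F"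
  shows "mon_prod \<sigma> a = (\<Prod>i\<in>F. \<sigma> i ^ Poly_Mapping.lookup a i)"
  unfolding mon_prod_def
  by (rule prod.mono_neutral_left) (use assms in \<open>auto simp: in_keys_iff\<close>)

lemma mon_prod_0 [simp]: "mon_prod \<sigma> 0 = 1"
  by (simp add: mon_prod_def)

lemma mon_prod_add: "mon_prod \<sigma> (a + b) = mon_prod \<sigma> a * mon_prod \<sigma> b"
proof -
  let ?F = "Poly_Mapping.keys a \<union> Poly_Mapping.keys b"
  have "Poly_Mapping.keys (a + b) \<subseteq> ?F" by (rule keys_add)
  then show ?thesis
    by (simp add: mon_prod_superset[of ?F] lookup_add power_add prod.distrib)
qed

lemma mon_prod_single [simp]: "mon_prod \<sigma> (Poly_Mapping.single i n) = \<sigma> i ^ n"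
  by (cases "n = 0") (simp_all add: mon_prod_def)

lemma mon_eval_mon_prod: "mon_eval a x = mon_prod x a"
  by (simp add: mon_eval_def mon_prod_def)

text \<open>Covers evaluation and substitution at once: \<open>h\<close> is the identity for values
  in the field, and the embedding of constants for values in a polynomial ring.\<close>

definition mp_hom :: "('k::field \<Rightarrow> 'r) \<Rightarrow> ('i \<Rightarrow> 'r::comm_ring_1) \<Rightarrow> ('i, 'k) mpol \<Rightarrow> 'r" where
  "mp_hom h \<sigma> f = (\<Sum>a\<in>Poly_Mapping.keys f. h (Poly_Mapping.lookup f a) * mon_prod \<sigma> a)"

locale coeff_hom =
  fixes h :: "'k::field \<Rightarrow> 'r::comm_ring_1"
  assumes h_0: "h 0 = 0" and h_1: "h 1 = 1"
    and h_add: "h (a + b) = h a + h b" and h_mult: "h (a * b) = h a * h b"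
begin

lemma mp_hom_superset:
  assumes "finite F" "Poly_Mapping.keys f \<subseteq> F"
  shows "mp_hom h \<sigma> f = (\<Sum>a\<in>F. h (Poly_Mapping.lookup f a) * mon_prod \<sigma> a)"
  unfolding mp_hom_def
  by (rule sum.mono_neutral_left) (use assms in \<open>auto simp: in_keys_iff h_0\<close>)

lemma mp_hom_zero: "mp_hom h \<sigma> 0 = 0"
  by (simp add: mp_hom_def)

lemma mp_hom_single: "mp_hom h \<sigma> (Poly_Mapping.single a c) = h c * mon_prod \<sigma> a"
  by (cases "c = 0") (simp_all add: mp_hom_def h_0)

lemma mp_hom_one: "mp_hom h \<sigma> 1 = 1"
  using mp_hom_single[of \<sigma> 0 1] by (simp add: h_1)

lemma mp_hom_add: "mp_hom h \<sigma> (f + g) = mp_hom h \<sigma> f + mp_hom h \<sigma> g"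
proof -
  let ?F = "Poly_Mapping.keys f \<union> Poly_Mapping.keys g"
  have "Poly_Mapping.keys (f + g) \<subseteq> ?F" by (rule keys_add)
  then show ?thesis
    by (simp add: mp_hom_superset[of ?F] lookup_add h_add distrib_right sum.distrib)
qed

lemma mp_hom_sum: "mp_hom h \<sigma> (\<Sum>x\<in>A. f x) = (\<Sum>x\<in>A. mp_hom h \<sigma> (f x))"
  by (induction A rule: infinite_finite_induct) (auto simp: mp_hom_zero mp_hom_add)

lemma mp_hom_mult: "mp_hom h \<sigma> (f * g) = mp_hom h \<sigma> f * mp_hom h \<sigma> g"
proof -
  have "mp_hom h \<sigma> (f * g) = mp_hom h \<sigma>
    ((\<Sum>a\<in>Poly_Mapping.keys f. Poly_Mapping.single a (Poly_Mapping.lookup f a)) *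
     (\<Sum>a\<in>Poly_Mapping.keys g. Poly_Mapping.single a (Poly_Mapping.lookup g a)))"
    by (simp flip: poly_mapping_sum_single)
  also have "\<dots> = mp_hom h \<sigma> f * mp_hom h \<sigma> g"
    by (simp add: sum_product mult_single mp_hom_sum mp_hom_single h_mult mon_prod_add
        mp_hom_def[of h \<sigma> f] mp_hom_def[of h \<sigma> g] mult_ac)
  finally show ?thesis .
qed

lemma mp_hom_diff: "mp_hom h \<sigma> (f - g) = mp_hom h \<sigma> f - mp_hom h \<sigma> g"
  using mp_hom_add[of \<sigma> "f - g" g] by (simp add: algebra_simps)

end

interpretation id_hom: coeff_hom "\<lambda>c. c"
  by unfold_locales auto

lemma mp_eval_mp_hom: "mp_eval f x = mp_hom (\<lambda>c. c) x f"
  by (simp add: mp_eval_def mp_hom_def mon_eval_mon_prod)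

lemma mp_eval_zero [simp]: "mp_eval 0 x = 0"
  and mp_eval_one [simp]: "mp_eval 1 x = 1"
  and mp_eval_single: "mp_eval (Poly_Mapping.single a c) x = c * mon_prod x a"
  and mp_eval_add [simp]: "mp_eval (f + g) x = mp_eval f x + mp_eval g x"
  and mp_eval_diff [simp]: "mp_eval (f - g) x = mp_eval f x - mp_eval g x"
  and mp_eval_mult [simp]: "mp_eval (f * g) x = mp_eval f x * mp_eval g x"
  and mp_eval_sum: "mp_eval (\<Sum>y\<in>A. F y) x = (\<Sum>y\<in>A. mp_eval (F y) x)"
  unfolding mp_eval_mp_hom
  by (rule id_hom.mp_hom_zero id_hom.mp_hom_one id_hom.mp_hom_single id_hom.mp_hom_add
      id_hom.mp_hom_diff id_hom.mp_hom_mult id_hom.mp_hom_sum)+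

lemma mp_eval_pscale [simp]: "mp_eval (pscale c f) x = c * mp_eval f x"
  by (simp add: pscale_def mp_eval_single)

interpretation const_hom: coeff_hom "Poly_Mapping.single 0 :: 'k::field \<Rightarrow> ('i, 'k) mpol"
  by unfold_locales (auto simp: single_add mult_single)

definition mp_subst :: "('i \<Rightarrow> ('j, 'k::field) mpol) \<Rightarrow> ('i, 'k) mpol \<Rightarrow> ('j, 'k) mpol" where
  "mp_subst \<sigma> f = mp_hom (Poly_Mapping.single 0) \<sigma> f"

lemma mp_subst_zero [simp]: "mp_subst \<sigma> 0 = 0"
  and mp_subst_single: "mp_subst \<sigma> (Poly_Mapping.single a c) = pscale c (mon_prod \<sigma> a)"
  and mp_subst_add: "mp_subst \<sigma> (f + g) = mp_subst \<sigma> f + mp_subst \<sigma> g"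
  and mp_subst_diff: "mp_subst \<sigma> (f - g) = mp_subst \<sigma> f - mp_subst \<sigma> g"
  and mp_subst_mult: "mp_subst \<sigma> (f * g) = mp_subst \<sigma> f * mp_subst \<sigma> g"
  and mp_subst_sum: "mp_subst \<sigma> (\<Sum>y\<in>A. F y) = (\<Sum>y\<in>A. mp_subst \<sigma> (F y))"
  unfolding mp_subst_def pscale_def
  by (rule const_hom.mp_hom_zero const_hom.mp_hom_single const_hom.mp_hom_add
      const_hom.mp_hom_diff const_hom.mp_hom_mult const_hom.mp_hom_sum)+

lemma pscale_mult_left: "pscale c f * g = pscale c (f * g)"
  and pscale_mult_right: "f * pscale c g = pscale c (f * g)"
  by (simp_all add: pscale_def mult_ac)

lemma mp_subst_pscale: "mp_subst \<sigma> (pscale c f) = pscale c (mp_subst \<sigma> f)"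
  by (simp add: pscale_def[of c f] mp_subst_mult mp_subst_single pscale_mult_left)

lemma mp_eval_power [simp]: "mp_eval (f ^ n) x = mp_eval f x ^ n"
  by (induction n) auto

lemma mp_eval_prod: "mp_eval (\<Prod>i\<in>A. F i) x = (\<Prod>i\<in>A. mp_eval (F i) x)"
  by (induction A rule: infinite_finite_induct) auto

lemma mp_eval_mon_prod: "mp_eval (mon_prod \<sigma> a) x = mon_prod (\<lambda>i. mp_eval (\<sigma> i) x) a"
  by (simp add: mon_prod_def mp_eval_prod)

lemma mp_eval_mp_subst: "mp_eval (mp_subst \<sigma> f) x = mp_eval f (\<lambda>i. mp_eval (\<sigma> i) x)"
  by (simp add: mp_subst_def mp_hom_def mp_eval_sum mp_eval_single mp_eval_mon_prod
      mp_eval_def[of f] mon_eval_mon_prod)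

section \<open>Forms\<close>

lemma lookup_pscale [simp]: "Poly_Mapping.lookup (pscale c f) a = c * Poly_Mapping.lookup f a"
  unfolding pscale_def mult_map_scale_conv_mult[symmetric]
  by (simp add: Poly_Mapping.map.rep_eq when_def)

lemma mdeg_superset:
  assumes "finite F" "Poly_Mapping.keys a \<subseteq> F"
  shows "mdeg a = (\<Sum>i\<in>F. Poly_Mapping.lookup a i)"
  unfolding mdeg_def
  by (rule sum.mono_neutral_left) (use assms in \<open>auto simp: in_keys_iff\<close>)

lemma mdeg_add: "mdeg (a + b) = mdeg a + mdeg b"
proof -
  let ?F = "Poly_Mapping.keys a \<union> Poly_Mapping.keys b"
  have "Poly_Mapping.keys (a + b) \<subseteq> ?F" by (rule keys_add)
  then show ?thesis
    by (simp add: mdeg_superset[of ?F] lookup_add sum.distrib)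
qed

lemma mdeg_single [simp]: "mdeg (Poly_Mapping.single i n) = n"
  by (cases "n = 0") (simp_all add: mdeg_def)

lemma mdeg_0 [simp]: "mdeg 0 = 0"
  by (simp add: mdeg_def)

lemma mdeg_eq_0_iff [simp]: "mdeg a = 0 \<longleftrightarrow> a = 0"
proof
  assume "mdeg a = 0"
  then have "\<forall>i\<in>Poly_Mapping.keys a. Poly_Mapping.lookup a i = 0" by (simp add: mdeg_def)
  then show "a = 0" by (intro poly_mapping_eqI) (auto simp: in_keys_iff)
qed simp

lemma monoms_add: "a \<in> monoms J s \<Longrightarrow> b \<in> monoms J t \<Longrightarrow> a + b \<in> monoms J (s + t)"
  using keys_add[of a b] by (auto simp: monoms_def mdeg_add)

lemma single_in_monoms: "i \<in> J \<Longrightarrow> Poly_Mapping.single i n \<in> monoms J n"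
  by (simp add: monoms_def)

lemma monoms_0 [simp]: "monoms J 0 = {0}"
  by (auto simp: monoms_def)

lemma monoms_SucE:
  assumes "a \<in> monoms J (Suc t)"
  obtains i a' where "i \<in> J" "a' \<in> monoms J t" "a = Poly_Mapping.single i 1 + a'"
proof -
  have "a \<noteq> 0" using assms by (auto simp: monoms_def)
  then obtain i where i: "i \<in> Poly_Mapping.keys a" by fastforce
  define a' where "a' = a - Poly_Mapping.single i 1"
  have a: "a = Poly_Mapping.single i 1 + a'"
    using i by (intro poly_mapping_eqI)
      (auto simp: a'_def lookup_add lookup_minus lookup_single when_def in_keys_iff)
  have "mdeg a = 1 + mdeg a'" unfolding a mdeg_add mdeg_single ..
  moreover have "Poly_Mapping.keys a' \<subseteq> Poly_Mapping.keys a"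
    by (auto simp: a'_def in_keys_iff lookup_minus)
  ultimately show ?thesis using that[of i a'] a i assms by (auto simp: monoms_def)
qed

lemma monoms_split:
  assumes "a \<in> monoms J (s + t)"
  obtains b c where "b \<in> monoms J s" "c \<in> monoms J t" "a = b + c"
  using assms
proof (induction s arbitrary: a thesis)
  case 0
  then show ?case by simp
next
  case (Suc s)
  from Suc.prems(2) obtain i a' where i: "i \<in> J" "a' \<in> monoms J (s + t)"
    "a = Poly_Mapping.single i 1 + a'"
    by (auto elim: monoms_SucE)
  from i(2) obtain b c where "b \<in> monoms J s" "c \<in> monoms J t" "a' = b + c"
    using Suc.IH by blast
  then show ?case
    using Suc.prems(1)[of "Poly_Mapping.single i 1 + b" c] i
      monoms_add[OF single_in_monoms[of i J 1]] by (simp add: add.assoc)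
qed

lemma finite_monoms: "finite J \<Longrightarrow> finite (monoms J t)"
proof (induction t)
  case (Suc t)
  have "monoms J (Suc t) \<subseteq> (\<lambda>(i, a). Poly_Mapping.single i 1 + a) ` (J \<times> monoms J t)"
    by (auto elim!: monoms_SucE)
  then show ?case using Suc by (meson finite_SigmaI finite_imageI finite_subset)
qed simp

lemma formsI: "(\<And>a. Poly_Mapping.lookup f a \<noteq> 0 \<Longrightarrow> a \<in> monoms J t) \<Longrightarrow> f \<in> forms J t"
  by (auto simp: forms_def in_keys_iff)

lemma formsD: "f \<in> forms J t \<Longrightarrow> Poly_Mapping.lookup f a \<noteq> 0 \<Longrightarrow> a \<in> monoms J t"
  by (auto simp: forms_def in_keys_iff)

lemma forms_zero [simp]: "0 \<in> forms J t"
  by (simp add: forms_def)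

lemma forms_add: "f \<in> forms J t \<Longrightarrow> g \<in> forms J t \<Longrightarrow> f + g \<in> forms J t"
  using keys_add[of f g] by (auto simp: forms_def)

lemma forms_pscale: "f \<in> forms J t \<Longrightarrow> pscale c f \<in> forms J t"
  by (auto simp: forms_def in_keys_iff)

lemma subspace_forms: "pvec.subspace (forms J t)"
  by (auto simp: pvec.subspace_def forms_add forms_pscale)

lemma forms_sum: "(\<And>x. x \<in> A \<Longrightarrow> f x \<in> forms J t) \<Longrightarrow> (\<Sum>x\<in>A. f x) \<in> forms J t"
  by (rule pvec.subspace_sum[OF subspace_forms])

lemma forms_diff: "f \<in> forms J t \<Longrightarrow> g \<in> forms J t \<Longrightarrow> f - g \<in> forms J t"
  by (rule pvec.subspace_diff[OF subspace_forms])

lemma forms_mult: "f \<in> forms J s \<Longrightarrow> g \<in> forms J t \<Longrightarrow> f * g \<in> forms J (s + t)"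
  using keys_mult[of f g] monoms_add by (fastforce simp: forms_def)

lemma single_in_forms: "a \<in> monoms J t \<Longrightarrow> Poly_Mapping.single a c \<in> forms J t"
  by (cases "c = 0") (auto simp: forms_def)

lemma forms_subset_polys: "forms J t \<subseteq> polys J"
  by (auto simp: forms_def polys_def monoms_def)

lemma one_in_forms: "1 \<in> forms J 0"
  by (simp add: forms_def)

lemma forms_span: "forms J t \<subseteq> pvec.span ((\<lambda>a. Poly_Mapping.single a 1) ` monoms J t)"
proof
  fix f :: "('a, 'b) mpol" assume f: "f \<in> forms J t"
  have "f = (\<Sum>a\<in>Poly_Mapping.keys f. pscale (Poly_Mapping.lookup f a) (Poly_Mapping.single a 1))"
    by (simp add: pscale_def mult_single flip: poly_mapping_sum_single)
  also have "\<dots> \<in> pvec.span ((\<lambda>a. Poly_Mapping.single a 1) ` monoms J t)"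
    using f by (intro pvec.span_sum pvec.span_scale pvec.span_base) (auto simp: forms_def)
  finally show "f \<in> pvec.span ((\<lambda>a. Poly_Mapping.single a 1) ` monoms J t)" .
qed

lemma forms_subset_subspace:
  assumes "pvec.subspace V" "\<And>a. a \<in> monoms J t \<Longrightarrow> Poly_Mapping.single a 1 \<in> V"
  shows "forms J t \<subseteq> V"
  by (rule order_trans[OF forms_span pvec.span_minimal[OF _ assms(1)]]) (use assms(2) in auto)

lemma polys_add: "f \<in> polys J \<Longrightarrow> g \<in> polys J \<Longrightarrow> f + g \<in> polys J"
  using keys_add[of f g] by (fastforce simp: polys_def)

lemma polys_mult:
  assumes "f \<in> polys J" "g \<in> polys J"
  shows "f * g \<in> polys J"
  unfolding polys_def
proof safe
  fix c i assume "c \<in> Poly_Mapping.keys (f * g)" "i \<in> Poly_Mapping.keys c"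
  then obtain a b where "a \<in> Poly_Mapping.keys f" "b \<in> Poly_Mapping.keys g" "c = a + b"
    using keys_mult[of f g] by blast
  then show "i \<in> J"
    using assms \<open>i \<in> Poly_Mapping.keys c\<close> keys_add[of a b] unfolding polys_def by blast
qed

lemma lookup_hom_part:
  "Poly_Mapping.lookup (hom_part t f) a = (if mdeg a = t then Poly_Mapping.lookup f a else 0)"
  by (auto simp: hom_part_def lookup_sum lookup_single when_def in_keys_iff)

lemma hom_part_in_forms: "f \<in> polys J \<Longrightarrow> hom_part t f \<in> forms J t"
  by (rule formsI) (auto simp: lookup_hom_part polys_def monoms_def in_keys_iff split: if_splits)

lemma sum_hom_part:
  "f = (\<Sum>t\<in>mdeg ` Poly_Mapping.keys f. hom_part t f)"
  by (rule poly_mapping_eqI) (auto simp: lookup_sum lookup_hom_part in_keys_iff)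

lemma mp_eval_fscale_form:
  assumes "f \<in> forms J t"
  shows "mp_eval f (fscale c x) = c ^ t * mp_eval f x"
proof -
  have "mon_prod (fscale c x) a = c ^ t * mon_prod x a" if "a \<in> monoms J t" for a
    using that by (auto simp: mon_prod_def fscale_def power_mult_distrib prod.distrib monoms_def
        mdeg_def power_sum)
  then show ?thesis using assms
    by (auto simp: mp_eval_def mon_eval_mon_prod forms_def sum_distrib_left intro!: sum.cong)
qed

lemma mon_prod_in_forms:
  assumes "a \<in> monoms J t" "\<And>i. i \<in> J \<Longrightarrow> \<sigma> i \<in> forms J' e"
  shows "mon_prod \<sigma> a \<in> forms J' (t * e)"
  using assms(1)
proof (induction t arbitrary: a)
  case 0
  then show ?case by (simp add: one_in_forms)
next
  case (Suc t)
  from Suc.prems obtain i a' where a: "i \<in> J" "a' \<in> monoms J t" "a = Poly_Mapping.single i 1 + a'"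
    by (rule monoms_SucE)
  then show ?case using Suc.IH[of a'] forms_mult[of "\<sigma> i" J' e] assms(2)
    by (simp add: mon_prod_add)
qed

lemma mp_subst_in_forms:
  assumes "f \<in> forms J t" "\<And>i. i \<in> J \<Longrightarrow> \<sigma> i \<in> forms J' e"
  shows "mp_subst \<sigma> f \<in> forms J' (t * e)"
proof -
  have "mp_subst \<sigma> f = (\<Sum>a\<in>Poly_Mapping.keys f.
      pscale (Poly_Mapping.lookup f a) (mon_prod \<sigma> a))"
    by (simp add: mp_subst_def mp_hom_def pscale_def)
  also have "\<dots> \<in> forms J' (t * e)"
    by (intro forms_sum forms_pscale mon_prod_in_forms) (use assms in \<open>auto simp: forms_def\<close>)
  finally show ?thesis .
qed

section \<open>Linear algebra\<close>

text \<open>Gaussian elimination, one equation at a time: an unknown \<open>w\<close> with nonzero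
  coefficient in equation \<open>e\<close> is solved for and eliminated from the others, which
  leaves the coefficients \<open>A'\<close>.\<close>

lemma homogeneous_system_nontrivial:
  fixes A :: "'u \<Rightarrow> 'e \<Rightarrow> 'k::field"
  assumes "finite E" "finite U" "card E < card U"
  shows "\<exists>c. (\<exists>u\<in>U. c u \<noteq> 0) \<and> (\<forall>e\<in>E. (\<Sum>u\<in>U. c u * A u e) = 0)"
  using assms
proof (induction E arbitrary: U A rule: finite_induct)
  case empty
  then have "\<exists>u. u \<in> U" by (metis card.empty equals0I less_irrefl)
  then show ?case by (intro exI[of _ "\<lambda>_. 1"]) auto
next
  case (insert e E)
  show ?case
  proof (cases "\<forall>u\<in>U. A u e = 0")
    case True
    with insert.IH[of U A] insert.prems insert.hyps show ?thesis by auto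
  next
    case False
    then obtain w where w: "w \<in> U" "A w e \<noteq> 0" by blast
    define U' where "U' = U - {w}"
    define A' where "A' u e' = A u e' - A u e / A w e * A w e'" for u e'
    have U: "U = insert w U'" "w \<notin> U'" "finite U'" using w insert.prems by (auto simp: U'_def)
    then have "card E < card U'" using insert.prems insert.hyps by simp
    with insert.IH[of U' A'] U obtain c where
      c: "\<exists>u\<in>U'. c u \<noteq> 0" "\<forall>e'\<in>E. (\<Sum>u\<in>U'. c u * A' u e') = 0" by blast
    define c' where "c' u = (if u = w then - (\<Sum>u\<in>U'. c u * A u e) / A w e else c u)" for u
    have sum': "(\<Sum>u\<in>U. c' u * A u e') = (\<Sum>u\<in>U'. c u * A' u e')" for e'
    proof -
      have "(\<Sum>u\<in>U'. c' u * A u e') = (\<Sum>u\<in>U'. c u * A u e')"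
        using U(2) by (intro sum.cong) (auto simp: c'_def)
      then have "(\<Sum>u\<in>U. c' u * A u e') =
          (\<Sum>u\<in>U'. c u * A u e') - (\<Sum>u\<in>U'. c u * A u e) / A w e * A w e'"
        using U by (simp add: c'_def)
      also have "\<dots> = (\<Sum>u\<in>U'. c u * A' u e')"
        by (simp add: A'_def right_diff_distrib sum_subtractf sum_distrib_right sum_divide_distrib mult.assoc)
      finally show ?thesis .
    qed
    have "(\<Sum>u\<in>U'. c u * A' u e) = 0" using w by (simp add: A'_def)
    with c sum' have "\<forall>e'\<in>insert e E. (\<Sum>u\<in>U. c' u * A u e') = 0" by simp
    moreover from c(1) obtain u where "u \<in> U'" "c u \<noteq> 0" by blast
    then have "u \<in> U" "c' u \<noteq> 0" using U by (auto simp: c'_def)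
    ultimately show ?thesis by blast
  qed
qed

context vector_space
begin

text \<open>Coordinates on the quotient \<open>A / V\<close>, dual to a family \<open>G\<close> of representatives of a basis.\<close>

lemma codim_coords:
  assumes A: "subspace A" and V: "subspace V" "V \<subseteq> A" and T: "A \<subseteq> span T" "finite T"
  obtains G \<xi> where "finite G" "G \<subseteq> A" "card G = dim A - dim V"
    "\<forall>g I c f. (\<forall>i\<in>I. f i \<in> A) \<longrightarrow>
       \<xi> g (\<Sum>i\<in>I. scale (c i) (f i)) = (\<Sum>i\<in>I. c i * \<xi> g (f i))"
    "\<forall>x\<in>A. x \<in> V \<longleftrightarrow> (\<forall>g\<in>G. \<xi> g x = 0)"
    "\<forall>g\<in>G. \<forall>h\<in>G. \<xi> g h = (if g = h then 1 else 0)"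
proof -
  obtain B where B: "B \<subseteq> V" "independent B" "V \<subseteq> span B" "card B = dim V"
    by (rule basis_exists)
  obtain C where C: "B \<subseteq> C" "C \<subseteq> A" "independent C" "A \<subseteq> span C"
    by (rule maximal_independent_subset_extend[OF order_trans[OF B(1) V(2)] B(2)])
  have fin: "finite C" using independent_span_bound[OF T(2) C(3)] C(2) T(1) by auto
  have spans: "span C = A" "span B = V"
    using span_minimal[OF C(2) A] C(4) span_minimal[OF B(1) V(1)] B(3) by simp_all
  have card: "card C = dim A" using basis_card_eq_dim[OF C(2,4,3)] .
  define \<xi> where "\<xi> g x = representation C x g" for g x
  show ?thesis
  proof (rule that[of "C - B" \<xi>])
    show "finite (C - B)" "C - B \<subseteq> A" using fin C by auto
    show "card (C - B) = dim A - dim V"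
      using card B(4) C(1) fin by (simp add: card_Diff_subset finite_subset)
    show "\<forall>g I c f. (\<forall>i\<in>I. f i \<in> A) \<longrightarrow>
       \<xi> g (\<Sum>i\<in>I. scale (c i) (f i)) = (\<Sum>i\<in>I. c i * \<xi> g (f i))"
      using C(3) unfolding \<xi>_def spans(1)[symmetric]
      by (auto simp: representation_sum representation_scale span_scale)
    show "\<forall>g\<in>C - B. \<forall>h\<in>C - B. \<xi> g h = (if g = h then 1 else 0)"
      using C(3) by (auto simp: \<xi>_def representation_basis)
    show "\<forall>x\<in>A. x \<in> V \<longleftrightarrow> (\<forall>g\<in>C - B. \<xi> g x = 0)"
    proof (intro ballI iffI)
      fix x assume x: "x \<in> A"
      {
        fix g assume "x \<in> V" "g \<in> C - B"
        then have "representation C x = representation B x"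
          using representation_extend[OF C(3) _ C(1)] spans by blast
        then show "\<xi> g x = 0"
          using representation_ne_zero[of B x g] \<open>g \<in> C - B\<close> by (auto simp: \<xi>_def)
      }
      assume zero: "\<forall>g\<in>C - B. \<xi> g x = 0"
      have "x = (\<Sum>b\<in>C. scale (representation C x b) b)"
        using sum_representation_eq[OF C(3) _ fin subset_refl, of x] x spans by simp
      also have "\<dots> = (\<Sum>b\<in>B. scale (representation C x b) b)"
        by (rule sum.mono_neutral_right) (use fin C zero in \<open>auto simp: \<xi>_def\<close>)
      also have "\<dots> \<in> V" using B V by (intro subspace_sum subspace_scale) auto
      finally show "x \<in> V" .
    qed
  qed
qed

end

text \<open>Linear independence of the classes in the quotient by \<open>V\<close>, for families, so
  that a repeated entry counts as a dependence.\<close>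

definition indep_mod :: "('i, 'k::field) mpol set \<Rightarrow> 'x set \<Rightarrow> ('x \<Rightarrow> ('i, 'k) mpol) \<Rightarrow> bool" where
  "indep_mod V I f \<longleftrightarrow> (\<forall>c. (\<Sum>i\<in>I. pscale (c i) (f i)) \<in> V \<longrightarrow> (\<forall>i\<in>I. c i = 0))"

lemma forms_codim_coords:
  fixes V :: "('i, 'k::field) mpol set"
  assumes "finite J" "pvec.subspace V" "V \<subseteq> forms J t"
  obtains G :: "('i, 'k) mpol set" and \<xi> where "finite G" "G \<subseteq> forms J t"
    "card G = pvec.dim (forms J t :: ('i, 'k) mpol set) - pvec.dim V"
    "\<forall>g I c f. (\<forall>i\<in>I. f i \<in> forms J t) \<longrightarrow>
       \<xi> g (\<Sum>i\<in>I. pscale (c i) (f i)) = (\<Sum>i\<in>I. c i * \<xi> g (f i))"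
    "\<forall>f\<in>forms J t. f \<in> V \<longleftrightarrow> (\<forall>g\<in>G. \<xi> g f = 0)"
    "\<forall>g\<in>G. \<forall>h\<in>G. \<xi> g h = (if g = h then 1 else 0)"
  by (rule pvec.codim_coords[OF subspace_forms assms(2,3) forms_span
        finite_imageI[OF finite_monoms[OF assms(1)]]])

lemma indep_mod_card_le:
  fixes V :: "('i, 'k::field) mpol set" and I :: "'x set"
  assumes "finite J" "pvec.subspace V" "V \<subseteq> forms J t"
    and "finite I" "\<And>i. i \<in> I \<Longrightarrow> f i \<in> forms J t" "indep_mod V I f"
  shows "card I \<le> pvec.dim (forms J t :: ('i, 'k) mpol set) - pvec.dim V"
proof (rule ccontr)
  obtain G :: "('i, 'k) mpol set" and \<xi> where G: "finite G"
    "card G = pvec.dim (forms J t :: ('i, 'k) mpol set) - pvec.dim V"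
    "\<forall>g (I::'x set) c f. (\<forall>i\<in>I. f i \<in> forms J t) \<longrightarrow>
       \<xi> g (\<Sum>i\<in>I. pscale (c i) (f i)) = (\<Sum>i\<in>I. c i * \<xi> g (f i))"
    "\<forall>f\<in>forms J t. f \<in> V \<longleftrightarrow> (\<forall>g\<in>G. \<xi> g f = 0)"
    by (rule forms_codim_coords[OF assms(1-3)])
  assume "\<not> ?thesis"
  then have "card G < card I" using G by simp
  from homogeneous_system_nontrivial[OF G(1) assms(4) this, of "\<lambda>i g. \<xi> g (f i)"]
  obtain c where c: "\<exists>i\<in>I. c i \<noteq> 0" "\<forall>g\<in>G. (\<Sum>i\<in>I. c i * \<xi> g (f i)) = 0" by blast
  have "(\<Sum>i\<in>I. pscale (c i) (f i)) \<in> V"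
    using c(2) G(3,4) assms(5) by (simp add: forms_sum forms_pscale)
  with assms(6) c(1) show False by (auto simp: indep_mod_def)
qed

text \<open>Evaluation at the points \<open>p i\<close> embeds the quotient by \<open>V\<close> into
  a space of dimension \<open>card I\<close>; the forms \<open>e i\<close>, dual to the points, make
  this map onto.\<close>

lemma codim_vanishing:
  fixes p :: "'x \<Rightarrow> 'i \<Rightarrow> 'k::field"
  assumes "finite J" "finite I"
    and V: "V = {f \<in> forms J t. \<forall>i\<in>I. mp_eval f (p i) = 0}"
    and e: "\<And>i. i \<in> I \<Longrightarrow> e i \<in> forms J t"
      "\<And>i j. i \<in> I \<Longrightarrow> j \<in> I \<Longrightarrow> mp_eval (e i) (p j) = (if i = j then 1 else 0)"
  shows "pvec.dim (forms J t :: ('i, 'k) mpol set) - pvec.dim V = card I"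
proof (rule antisym)
  have V': "pvec.subspace V" "V \<subseteq> forms J t"
    by (auto simp: V pvec.subspace_def forms_add forms_pscale)
  have "c i = 0" if "(\<Sum>i\<in>I. pscale (c i) (e i)) \<in> V" "i \<in> I" for c i
  proof -
    have "0 = mp_eval (\<Sum>i\<in>I. pscale (c i) (e i)) (p i)" using that by (simp add: V)
    also have "\<dots> = (\<Sum>j\<in>I. if j = i then c j else 0)"
      unfolding mp_eval_sum by (rule sum.cong) (use e that in auto)
    also have "\<dots> = c i" using assms(2) that by simp
    finally show ?thesis by simp
  qed
  then show "card I \<le> pvec.dim (forms J t :: ('i, 'k) mpol set) - pvec.dim V"
    by (intro indep_mod_card_le[OF assms(1) V' assms(2) e(1)]) (auto simp: indep_mod_def)
  obtain G :: "('i, 'k) mpol set" and \<xi> where G: "finite G" "G \<subseteq> forms J t"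
    "card G = pvec.dim (forms J t :: ('i, 'k) mpol set) - pvec.dim V"
    "\<forall>g (I::('i, 'k) mpol set) c f. (\<forall>i\<in>I. f i \<in> forms J t) \<longrightarrow>
       \<xi> g (\<Sum>i\<in>I. pscale (c i) (f i)) = (\<Sum>i\<in>I. c i * \<xi> g (f i))"
    "\<forall>f\<in>forms J t. f \<in> V \<longleftrightarrow> (\<forall>g\<in>G. \<xi> g f = 0)"
    "\<forall>g\<in>G. \<forall>h\<in>G. \<xi> g h = (if g = h then 1 else 0)"
    by (rule forms_codim_coords[OF assms(1) V'])
  show "pvec.dim (forms J t :: ('i, 'k) mpol set) - pvec.dim V \<le> card I"
  proof (rule ccontr)
    assume "\<not> ?thesis"
    then have "card I < card G" using G by simp
    from homogeneous_system_nontrivial[OF assms(2) G(1) this, of "\<lambda>g i. mp_eval g (p i)"]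
    obtain c where c: "\<exists>g\<in>G. c g \<noteq> 0" "\<forall>i\<in>I. (\<Sum>g\<in>G. c g * mp_eval g (p i)) = 0" by blast
    have "(\<Sum>g\<in>G. pscale (c g) g) \<in> V"
      using c(2) G(2) unfolding V
      by (auto simp: mp_eval_sum intro!: forms_sum forms_pscale)
    then have "\<forall>g\<in>G. \<xi> g (\<Sum>h\<in>G. pscale (c h) h) = 0"
      using G(5) V'(2) by blast
    moreover have "\<forall>g. \<xi> g (\<Sum>h\<in>G. pscale (c h) h) = (\<Sum>h\<in>G. c h * \<xi> g h)"
      using G(2) G(4)[rule_format, of G "\<lambda>h. h" _ c] by blast
    ultimately have "\<forall>g\<in>G. (\<Sum>h\<in>G. c h * \<xi> g h) = 0" by simp
    moreover have "(\<Sum>h\<in>G. c h * \<xi> g h) = c g" if "g \<in> G" for g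
    proof -
      have "(\<Sum>h\<in>G. c h * \<xi> g h) = (\<Sum>h\<in>G. if g = h then c h else 0)"
        by (rule sum.cong) (use G(6) that in auto)
      then show ?thesis using G(1) that by simp
    qed
    ultimately show False using c(1) by auto
  qed
qed

text \<open>Dedekind's argument: subtracting \<open>\<chi> b y\<close> times the relation at
  \<open>x\<close> from the relation at \<open>m x y\<close> kills the term of \<open>b\<close>. The
  operation \<open>m\<close> is a parameter because \<open>X\<close> will be both a set of vectors
  under the coordinatewise product and the set of nonzero scalars.\<close>

lemma characters_independent:
  fixes \<chi> :: "'a \<Rightarrow> 'x \<Rightarrow> 'k::field"
  assumes "finite A"
    and mult: "\<And>x y. x \<in> X \<Longrightarrow> y \<in> X \<Longrightarrow> m x y \<in> X"
      "\<And>a x y. a \<in> A \<Longrightarrow> x \<in> X \<Longrightarrow> y \<in> X \<Longrightarrow> \<chi> a (m x y) = \<chi> a x * \<chi> a y"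
    and nonzero: "\<And>a. a \<in> A \<Longrightarrow> \<exists>x\<in>X. \<chi> a x \<noteq> 0"
    and dist: "\<And>a b. a \<in> A \<Longrightarrow> b \<in> A \<Longrightarrow> a \<noteq> b \<Longrightarrow> \<exists>x\<in>X. \<chi> a x \<noteq> \<chi> b x"
    and zero: "\<And>x. x \<in> X \<Longrightarrow> (\<Sum>a\<in>A. c a * \<chi> a x) = 0"
  shows "\<forall>a\<in>A. c a = 0"
  using assms(1) mult(2) nonzero dist zero
proof (induction A arbitrary: c rule: finite_induct)
  case (insert b A)
  have A: "c a = 0" if a: "a \<in> A" for a
  proof -
    obtain y where y: "y \<in> X" "\<chi> a y \<noteq> \<chi> b y"
      using insert.prems(3)[of a b] insert.hyps a by auto
    have "\<forall>a\<in>A. c a * (\<chi> a y - \<chi> b y) = 0"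
    proof (rule insert.IH)
      fix x assume x: "x \<in> X"
      have "0 = (\<Sum>a\<in>insert b A. c a * \<chi> a (m x y)) - \<chi> b y * (\<Sum>a\<in>insert b A. c a * \<chi> a x)"
        using insert.prems(4) x y mult(1) by simp
      also have "\<dots> = (\<Sum>a\<in>insert b A. c a * (\<chi> a y - \<chi> b y) * \<chi> a x)"
        using insert.prems(1) x y
        by (simp add: sum_distrib_left sum_subtractf[symmetric] algebra_simps)
      finally show "(\<Sum>a\<in>A. c a * (\<chi> a y - \<chi> b y) * \<chi> a x) = 0"
        using insert.hyps by simp
    qed (use insert.prems in auto)
    with a y show ?thesis by auto
  qed
  then have "c b * \<chi> b x = 0" if "x \<in> X" for x
    using insert.prems(4)[OF that] insert.hyps by simp
  with insert.prems(2)[of b] A show ?case by auto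
qed simp

text \<open>In characteristic 0 the element \<open>2\<close> is not a root of unity, so its powers
  tell exponents apart. This provides the distinct characters in the next two lemmas.\<close>

lemma two_power_eq_iff: "(2::'k::field_char_0) ^ p = 2 ^ q \<longleftrightarrow> p = q"
proof -
  have "(2::'k) ^ p = 2 ^ q \<longleftrightarrow> (of_nat (2 ^ p) :: 'k) = of_nat (2 ^ q)" by simp
  also have "\<dots> \<longleftrightarrow> (2::nat) ^ p = 2 ^ q" by (rule of_nat_eq_iff)
  finally show ?thesis by simp
qed

text \<open>Monomials are multiplicative on \<open>vecs J\<close> with the coordinatewise product
  and distinct as functions, so the coefficients vanish by independence of characters.\<close>

lemma poly_eq_0_if_vanishes:
  fixes f :: "('i, 'k::field_char_0) mpol"
  assumes f: "f \<in> polys J" and zero: "\<And>x. x \<in> vecs J \<Longrightarrow> mp_eval f x = 0"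
  shows "f = 0"
proof -
  have keys: "Poly_Mapping.keys a \<subseteq> J" if "a \<in> Poly_Mapping.keys f" for a
    using f that by (auto simp: polys_def)
  \<comment> \<open>A test vector that reads off the exponent of the variable \<open>i\<close> as a
    power of \<open>2\<close>.\<close>
  define x where "x i = (\<lambda>j. if j = i then 2 else if j \<in> J then 1 else 0 :: 'k)" for i
  have x: "mon_prod (x i) a = 2 ^ Poly_Mapping.lookup a i" if "Poly_Mapping.keys a \<subseteq> J" for a i
  proof -
    have "mon_prod (x i) a =
        (\<Prod>j\<in>Poly_Mapping.keys a. if j = i then 2 ^ Poly_Mapping.lookup a j else 1)"
      unfolding mon_prod_def by (rule prod.cong) (use that in \<open>auto simp: x_def\<close>)
    then show ?thesis by (simp add: in_keys_iff)
  qed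
  have "\<forall>a\<in>Poly_Mapping.keys f. Poly_Mapping.lookup f a = 0"
  proof (rule characters_independent[where X = "vecs J" and m = "\<lambda>x y i. x i * y i"
        and \<chi> = "\<lambda>a x. mon_prod x a"])
    show "mon_prod (\<lambda>i. x i * y i) a = mon_prod x a * mon_prod y a" for a and x y :: "'i \<Rightarrow> 'k"
      by (simp add: mon_prod_def power_mult_distrib prod.distrib)
    show "\<exists>y\<in>vecs J. mon_prod y a \<noteq> (0::'k)" if "a \<in> Poly_Mapping.keys f" for a
      using keys[OF that] by (intro bexI[of _ "\<lambda>j. if j \<in> J then 1 else 0"])
        (auto simp: mon_prod_def vecs_def)
    show "\<exists>y\<in>vecs J. mon_prod y a \<noteq> (mon_prod y b :: 'k)"
      if ab: "a \<in> Poly_Mapping.keys f" "b \<in> Poly_Mapping.keys f" "a \<noteq> b" for a b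
    proof -
      obtain i where i: "Poly_Mapping.lookup a i \<noteq> Poly_Mapping.lookup b i"
        using ab(3) by (meson poly_mapping_eqI)
      then have "i \<in> Poly_Mapping.keys a \<or> i \<in> Poly_Mapping.keys b" by (auto simp: in_keys_iff)
      then have "i \<in> J" using ab keys by auto
      then have "x i \<in> vecs J" by (auto simp: x_def vecs_def)
      moreover have "mon_prod (x i) a \<noteq> mon_prod (x i) b"
        using i ab keys by (simp add: x two_power_eq_iff)
      ultimately show ?thesis by blast
    qed
    show "(\<Sum>a\<in>Poly_Mapping.keys f. Poly_Mapping.lookup f a * mon_prod x a) = 0"
      if "x \<in> vecs J" for x
      using zero[OF that] by (simp add: mp_eval_def mon_eval_mon_prod)
  qed (auto simp: vecs_def)
  then show ?thesis by (intro poly_mapping_eqI) (auto simp: in_keys_iff)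
qed

text \<open>As a function of \<open>c\<close>, the value at \<open>fscale c x\<close> is a
  combination of the characters \<open>c ^ t\<close> whose coefficients are the values of the
  homogeneous parts at \<open>x\<close>.\<close>

lemma hom_part_vanishes:
  fixes f :: "('i, 'k::field_char_0) mpol"
  assumes f: "f \<in> polys J" and zero: "\<And>c. c \<noteq> 0 \<Longrightarrow> mp_eval f (fscale c x) = 0"
  shows "mp_eval (hom_part t f) x = 0"
proof -
  have "\<forall>t\<in>mdeg ` Poly_Mapping.keys f. mp_eval (hom_part t f) x = 0"
  proof (rule characters_independent[where X = "{c. c \<noteq> 0}" and m = "(*)"
        and \<chi> = "\<lambda>t c. c ^ t"])
    show "(\<Sum>t\<in>mdeg ` Poly_Mapping.keys f. mp_eval (hom_part t f) x * c ^ t) = 0"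
      if "c \<in> {c. c \<noteq> 0}" for c
    proof -
      have "mp_eval (\<Sum>t\<in>mdeg ` Poly_Mapping.keys f. hom_part t f) (fscale c x) = 0"
        using zero that by (simp flip: sum_hom_part)
      then show ?thesis
        by (simp add: mp_eval_sum mp_eval_fscale_form[OF hom_part_in_forms[OF f]] mult_ac)
    qed
    show "\<exists>c\<in>{c. c \<noteq> 0}. (c::'k) ^ s \<noteq> c ^ t" if "s \<noteq> t" for s t
      using that by (intro bexI[of _ 2]) (auto simp: two_power_eq_iff)
  qed (auto simp: power_mult_distrib)
  moreover have "hom_part t f = 0" if "t \<notin> mdeg ` Poly_Mapping.keys f"
    using that by (intro poly_mapping_eqI) (auto simp: lookup_hom_part in_keys_iff)
  ultimately show ?thesis by (cases "t \<in> mdeg ` Poly_Mapping.keys f") auto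
qed

section \<open>Saturated families and the growth of the Hilbert function\<close>

definition var :: "'i \<Rightarrow> ('i, 'k::field) mpol" where
  "var i = Poly_Mapping.single (Poly_Mapping.single i 1) 1"

lemma var_in_forms: "i \<in> J \<Longrightarrow> var i \<in> forms J 1"
  by (simp add: var_def single_in_forms single_in_monoms)

lemma mp_eval_var [simp]: "mp_eval (var i) x = x i"
  by (simp add: var_def mp_eval_single)

lemma subspace_mult_preimage: "pvec.subspace V \<Longrightarrow> pvec.subspace {f. f * g \<in> V}"
  by (auto simp: pvec.subspace_def distrib_right pscale_mult_left)

lemma forms_add_subset:
  assumes V: "pvec.subspace V"
    and mult: "\<And>f g. f \<in> forms J s \<Longrightarrow> g \<in> forms J t \<Longrightarrow> f * g \<in> V"
  shows "forms J (s + t) \<subseteq> V"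
proof (rule forms_subset_subspace[OF V])
  fix a assume "a \<in> monoms J (s + t)"
  then obtain b c where "b \<in> monoms J s" "c \<in> monoms J t" "a = b + c" by (rule monoms_split)
  then show "Poly_Mapping.single a 1 \<in> V"
    using mult[of "Poly_Mapping.single b 1" "Poly_Mapping.single c 1"]
    by (simp add: single_in_forms mult_single)
qed

lemma forms_mult_subset:
  assumes V: "pvec.subspace V" and mult: "\<And>i. i \<in> J \<Longrightarrow> var i * g \<in> V" and l: "l \<in> forms J 1"
  shows "l * g \<in> V"
proof -
  have "forms J 1 \<subseteq> {f. f * g \<in> V}"
  proof (rule forms_subset_subspace[OF subspace_mult_preimage[OF V]])
    fix a assume "a \<in> monoms J 1"
    then have "a \<in> monoms J (Suc 0)" by simp
    then obtain i a' where "i \<in> J" "a' \<in> monoms J 0" "a = Poly_Mapping.single i 1 + a'"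
      by (rule monoms_SucE)
    then show "Poly_Mapping.single a 1 \<in> {f. f * g \<in> V}" using mult[of i] by (simp add: var_def)
  qed
  with l show ?thesis by blast
qed

text \<open>A bookkeeping device: the linearity statement obtained from
  \<open>forms_codim_coords\<close> is fixed to one type of index, and a sum over single indices has
  to be read as one over pairs.\<close>

lemma sum_Times_singleton: "(\<Sum>u\<in>A \<times> {z}. F (fst u)) = (\<Sum>i\<in>A. F i)"
  by (rule sum.reindex_bij_witness[of _ "\<lambda>i. (i, z)" fst]) auto

text \<open>The graded parts of a saturated homogeneous ideal, reduced to multiplication by single
  variables and saturation in one step.\<close>

locale saturated_family =
  fixes m :: nat and W :: "nat \<Rightarrow> (nat, 'k::field) mpol set"
  assumes subspace: "pvec.subspace (W j)"
    and subset_forms: "W j \<subseteq> forms {..m} j"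
    and var_mult: "f \<in> W j \<Longrightarrow> i \<le> m \<Longrightarrow> var i * f \<in> W (Suc j)"
    and saturated: "f \<in> forms {..m} j \<Longrightarrow> (\<And>i. i \<le> m \<Longrightarrow> var i * f \<in> W (Suc j)) \<Longrightarrow> f \<in> W j"
begin

text \<open>
  McCoy's theorem for the polynomial \<open>\<Sum>i\<le>m. var i * u ^ i\<close> acting on the polynomials in \<open>u\<close>
  with coefficients in the quotients by \<open>W j\<close>.
\<close>

lemma mccoy:
  assumes "\<And>e. q e \<in> forms {..m} j" and "\<And>e. e \<ge> D \<Longrightarrow> q e \<in> W j"
    and "\<And>e. (\<Sum>i\<le>m. if i \<le> e then var i * q (e - i) else 0) \<in> W (Suc j)"
  shows "q e \<in> W j"
  using assms
\<comment> \<open>\<open>D\<close> bounds the degree in \<open>u\<close>. The induction hypothesis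
  is applied to the products \<open>var i * q e\<close> one degree higher, hence \<open>j\<close>
  and \<open>q\<close> vary.\<close>
proof (induction D arbitrary: j q e)
  case 0
  then show ?case by simp
next
  case (Suc D)
  have all: "\<forall>e. var i * q e \<in> W (Suc j)" if "i \<le> m" for i
    using that
  proof (induction "m - i" arbitrary: i rule: less_induct)
    case less
    have above: "\<forall>e. var l * q e \<in> W (Suc j)" if "l \<le> m" "i < l" for l
      using less that by simp
    \<comment> \<open>The coefficient of \<open>u ^ (D + i)\<close> contains
      \<open>var i * q D\<close>. Its terms with \<open>l < i\<close> involve a coefficient of
      \<open>q\<close> beyond \<open>D\<close>, and those with \<open>l > i\<close> are settled by
      the downward induction on the variable.\<close>
    have top: "var i * q D \<in> W (Suc j)"
    proof -
      let ?t = "\<lambda>l. if l \<le> D + i then var l * q (D + i - l) else 0"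
      have "?t l \<in> W (Suc j)" if "l \<in> {..m} - {i}" for l
      proof (cases "l < i")
        case True
        then have "q (D + i - l) \<in> W j" by (intro Suc.prems(2)) simp
        with that show ?thesis by (auto intro: var_mult pvec.subspace_0[OF subspace])
      next
        case False
        with that show ?thesis using above[of l] pvec.subspace_0[OF subspace] by auto
      qed
      then have "(\<Sum>l\<in>{..m} - {i}. ?t l) \<in> W (Suc j)" by (intro pvec.subspace_sum[OF subspace])
      moreover have "(\<Sum>l\<le>m. ?t l) = var i * q D + (\<Sum>l\<in>{..m} - {i}. ?t l)"
        using less.prems by (subst sum.remove[of _ i]) auto
      ultimately have "(\<Sum>l\<le>m. ?t l) - (\<Sum>l\<in>{..m} - {i}. ?t l) \<in> W (Suc j)"
        using Suc.prems(3)[of "D + i"] by (intro pvec.subspace_diff[OF subspace])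
      with \<open>(\<Sum>l\<le>m. ?t l) = _\<close> show ?thesis by simp
    qed
    show ?case
    proof
      fix e
      show "var i * q e \<in> W (Suc j)"
      \<comment> \<open>By \<open>top\<close>, multiplication by \<open>var i\<close> has lowered
        the bound on the degree in \<open>u\<close> from \<open>Suc D\<close> to
        \<open>D\<close>.\<close>
      proof (rule Suc.IH[of "\<lambda>e. var i * q e"])
        show "var i * q e \<in> forms {..m} (Suc j)" for e
          using forms_mult[OF var_in_forms[of i "{..m}"] Suc.prems(1)] less.prems by simp
        show "var i * q e \<in> W (Suc j)" if "D \<le> e" for e
        proof (cases "e = D")
          case False
          with that show ?thesis using Suc.prems(2)[of e] less.prems by (auto intro: var_mult)
        qed (use top in simp)
        show "(\<Sum>l\<le>m. if l \<le> e then var l * (var i * q (e - l)) else 0) \<in> W (Suc (Suc j))" for e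
        proof -
          have "(\<Sum>l\<le>m. if l \<le> e then var l * (var i * q (e - l)) else 0) =
              var i * (\<Sum>l\<le>m. if l \<le> e then var l * q (e - l) else 0)"
            unfolding sum_distrib_left by (rule sum.cong) (auto simp: mult_ac)
          then show ?thesis using var_mult[OF Suc.prems(3)] less.prems by simp
        qed
      qed
    qed
  qed
  show ?case by (rule saturated[OF Suc.prems(1)]) (use all in auto)
qed

text \<open>A lower bound for the codimension of \<open>W j\<close>, with a witnessing family that
  can later be lifted along \<open>ver_pull\<close>.\<close>

definition has_codim_ge :: "nat \<Rightarrow> nat \<Rightarrow> bool" where
  "has_codim_ge N j \<longleftrightarrow> (\<exists>f. (\<forall>i<N. f i \<in> forms {..m} j) \<and> indep_mod (W j) {..<N} f)"

text \<open>
  If the codimension dropped from degree \<open>j\<close> to \<open>j + 1\<close>, multiplication by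
  \<open>\<Sum>i\<le>m. var i * u ^ i\<close> would have, for dimension reasons, a nontrivial kernel on polynomials in
  \<open>u\<close> of large degree \<open>D\<close>.
\<close>

lemma has_codim_ge_Suc:
  assumes "has_codim_ge N j"
  shows "has_codim_ge N (Suc j)"
proof -
  obtain f where f: "\<And>i. i < N \<Longrightarrow> f i \<in> forms {..m} j" and ind: "indep_mod (W j) {..<N} f"
    using assms by (auto simp: has_codim_ge_def)
  obtain G :: "(nat, 'k) mpol set" and \<xi> where G: "finite G" "G \<subseteq> forms {..m} (Suc j)"
    "card G = pvec.dim (forms {..m} (Suc j) :: (nat, 'k) mpol set) - pvec.dim (W (Suc j))"
    "\<forall>g (I::(nat \<times> nat) set) c f. (\<forall>i\<in>I. f i \<in> forms {..m} (Suc j)) \<longrightarrow>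
       \<xi> g (\<Sum>i\<in>I. pscale (c i) (f i)) = (\<Sum>i\<in>I. c i * \<xi> g (f i))"
    "\<forall>f\<in>forms {..m} (Suc j). f \<in> W (Suc j) \<longleftrightarrow> (\<forall>g\<in>G. \<xi> g f = 0)"
    "\<forall>g\<in>G. \<forall>h\<in>G. \<xi> g h = (if g = h then 1 else 0)"
    by (rule forms_codim_coords[OF finite_atMost subspace subset_forms])
  have "N \<le> card G"
  proof (rule ccontr)
    assume "\<not> N \<le> card G"
    then have N: "Suc (card G) \<le> N" by simp
    \<comment> \<open>There are \<open>N * D\<close> unknown coefficients. The product with a
      polynomial of degree \<open>m\<close> in \<open>u\<close> has \<open>D + m\<close>
      coefficients, each with \<open>card G\<close> coordinates, and \<open>N > card G\<close> makes
      the unknowns outnumber the equations once \<open>D > card G * m\<close>.\<close>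
    define D where "D = Suc (card G * m)"
    \<comment> \<open>The matrix of the multiplication: the term of degree \<open>e\<close> in
      \<open>u\<close> contributes to degree \<open>e'\<close> through the variable with index
      \<open>e' - e\<close>.\<close>
    define A where "A = (\<lambda>(i, e) (g, e'). if e \<le> e' \<and> e' - e \<le> m
      then \<xi> g (var (e' - e) * f i) else 0)"
    have "card G * (D + m) < Suc (card G) * D" by (simp add: D_def algebra_simps)
    also have "\<dots> \<le> N * D" using N by (rule mult_right_mono) simp
    finally have "card (G \<times> {..<D + m}) < card ({..<N} \<times> {..<D})"
      by (simp add: card_cartesian_product)
    from homogeneous_system_nontrivial[OF _ _ this, of A] G(1) obtain c where
      c: "\<exists>u\<in>{..<N} \<times> {..<D}. c u \<noteq> 0"
        "\<forall>e\<in>G \<times> {..<D + m}. (\<Sum>u\<in>{..<N} \<times> {..<D}. c u * A u e) = 0"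
      by auto
    define q where "q e = (if e < D then \<Sum>i<N. pscale (c (i, e)) (f i) else 0)" for e
    have q: "q e \<in> W j" for e
    proof (rule mccoy[where D = D])
      show "q e \<in> forms {..m} j" for e
        using f by (auto simp: q_def intro!: forms_sum forms_pscale)
      show "q e \<in> W j" if "D \<le> e" for e
        using that pvec.subspace_0[OF subspace] by (simp add: q_def)
      show "(\<Sum>l\<le>m. if l \<le> e then var l * q (e - l) else 0) \<in> W (Suc j)" for e
      proof (cases "e < D + m")
        case False
        then have "(\<Sum>l\<le>m. if l \<le> e then var l * q (e - l) else 0) = 0"
          by (intro sum.neutral) (auto simp: q_def)
        then show ?thesis using pvec.subspace_0[OF subspace] by simp
      next
        case True
        define c' where "c' = (\<lambda>(i, l). if l \<le> e \<and> e - l < D then c (i, e - l) else 0)"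
        let ?F = "\<lambda>(i, l). var l * f i"
        have F: "\<forall>u\<in>{..<N} \<times> {..m}. ?F u \<in> forms {..m} (Suc j)"
          using forms_mult[OF var_in_forms f] by fastforce
        have eq: "(\<Sum>l\<le>m. if l \<le> e then var l * q (e - l) else 0) =
            (\<Sum>u\<in>{..<N} \<times> {..m}. pscale (c' u) (?F u))"
        proof -
          have "(if l \<le> e then var l * q (e - l) else 0) =
              (\<Sum>i<N. pscale (c' (i, l)) (var l * f i))" for l
            by (simp add: c'_def q_def sum_distrib_left pscale_mult_right)
          then have "(\<Sum>l\<le>m. if l \<le> e then var l * q (e - l) else 0) =
              (\<Sum>l\<le>m. \<Sum>i<N. pscale (c' (i, l)) (var l * f i))" by simp
          also have "\<dots> = (\<Sum>i<N. \<Sum>l\<le>m. pscale (c' (i, l)) (var l * f i))" by (rule sum.swap)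
          also have "\<dots> = (\<Sum>u\<in>{..<N} \<times> {..m}. pscale (c' u) (?F u))"
            by (subst sum.cartesian_product) (rule sum.cong, auto)
          finally show ?thesis .
        qed
        have "\<xi> g (\<Sum>u\<in>{..<N} \<times> {..m}. pscale (c' u) (?F u)) = 0" if g: "g \<in> G" for g
        proof -
          have "\<xi> g (\<Sum>u\<in>{..<N} \<times> {..m}. pscale (c' u) (?F u)) =
              (\<Sum>u\<in>{..<N} \<times> {..m}. c' u * \<xi> g (?F u))"
            using G(4) F by blast
          also have "\<dots> = (\<Sum>(i, l)\<in>{u \<in> {..<N} \<times> {..m}. snd u \<le> e \<and> e - snd u < D}.
              c (i, e - l) * \<xi> g (var l * f i))"
            by (rule sum.mono_neutral_cong_right) (auto simp: c'_def split: if_splits)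
          also have "\<dots> = (\<Sum>(i, e')\<in>{u \<in> {..<N} \<times> {..<D}. snd u \<le> e \<and> e - snd u \<le> m}.
              c (i, e') * \<xi> g (var (e - e') * f i))"
            by (rule sum.reindex_bij_witness[where i = "\<lambda>(i, e'). (i, e - e')"
                  and j = "\<lambda>(i, l). (i, e - l)"]) auto
          also have "\<dots> = (\<Sum>u\<in>{..<N} \<times> {..<D}. c u * A u (g, e))"
            by (rule sum.mono_neutral_cong_left) (auto simp: A_def split: if_splits)
          also have "\<dots> = 0" using c(2) g True by auto
          finally show ?thesis .
        qed
        moreover have "(\<Sum>u\<in>{..<N} \<times> {..m}. pscale (c' u) (?F u)) \<in> forms {..m} (Suc j)"
          using F by (intro forms_sum forms_pscale) blast
        ultimately show ?thesis unfolding eq using G(5) by blast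
      qed
    qed
    have "c (i, e) = 0" if "i < N" "e < D" for i e
    proof -
      have "(\<Sum>i\<in>{..<N}. pscale (c (i, e)) (f i)) \<in> W j" using q[of e] that by (simp add: q_def)
      then show ?thesis using ind that by (auto simp: indep_mod_def)
    qed
    with c(1) show False by auto
  qed
  \<comment> \<open>By duality with \<open>\<xi>\<close>, the elements of \<open>G\<close> are
    independent modulo \<open>W (Suc j)\<close>, so any \<open>N\<close> of them are
    witnesses.\<close>
  then obtain H where H: "H \<subseteq> G" "card H = N" by (meson obtain_subset_with_card_n)
  obtain h where h: "bij_betw h {..<N} H"
    using ex_bij_betw_nat_finite[of H] H G(1) finite_subset by (metis atLeast0LessThan)
  have hG: "h i \<in> G" if "i < N" for i
    using h H that by (meson bij_betwE lessThan_iff subsetD)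
  have "c i = 0" if sum: "(\<Sum>i<N. pscale (c i) (h i)) \<in> W (Suc j)" and i: "i < N" for c i
  proof -
    have "(\<Sum>i<N. pscale (c i) (h i)) =
        (\<Sum>u\<in>{..<N} \<times> {0::nat}. pscale ((c \<circ> fst) u) ((h \<circ> fst) u))"
      using sum_Times_singleton[of "\<lambda>i. pscale (c i) (h i)" "{..<N}" "0::nat"] by simp
    moreover have "\<xi> (h i) (\<Sum>u\<in>{..<N} \<times> {0::nat}. pscale ((c \<circ> fst) u) ((h \<circ> fst) u)) =
        (\<Sum>u\<in>{..<N} \<times> {0::nat}. (c \<circ> fst) u * \<xi> (h i) ((h \<circ> fst) u))"
      by (rule G(4)[rule_format]) (use hG G(2) in auto)
    moreover have "\<dots> = (\<Sum>k<N. c k * \<xi> (h i) (h k))"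
      using sum_Times_singleton[of "\<lambda>k. c k * \<xi> (h i) (h k)" "{..<N}" "0::nat"] by simp
    moreover have "\<dots> = (\<Sum>k<N. if k = i then c k else 0)"
    proof (rule sum.cong)
      fix k assume "k \<in> {..<N}"
      then have "h i = h k \<longleftrightarrow> i = k" using h i by (auto simp: bij_betw_def inj_on_def)
      then show "c k * \<xi> (h i) (h k) = (if k = i then c k else 0)"
        using G(6) hG i \<open>k \<in> {..<N}\<close> by auto
    qed simp
    moreover have "\<dots> = c i" using i by simp
    moreover have "\<xi> (h i) (\<Sum>i<N. pscale (c i) (h i)) = 0"
      using sum G(5) subset_forms hG[OF i] by blast
    ultimately show ?thesis by simp
  qed
  then show ?thesis
    unfolding has_codim_ge_def indep_mod_def using hG G(2) by (intro exI[of _ h]) auto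
qed

lemma has_codim_ge_mono: "j \<le> k \<Longrightarrow> has_codim_ge N j \<Longrightarrow> has_codim_ge N k"
  by (induction k rule: dec_induct) (auto intro: has_codim_ge_Suc)

end

section \<open>Finite sets of points\<close>

lemma subspace_vecs: "fvec.subspace (vecs J)"
  by (auto simp: fvec.subspace_def vecs_def fscale_def)

lemma sum_apply: "(\<Sum>i\<in>I. F i) j = (\<Sum>i\<in>I. F i j)"
  by (induction I rule: infinite_finite_induct) auto

text \<open>The form is a coordinate on the quotient of \<open>vecs J\<close> by \<open>V\<close>
  that is nonzero at \<open>v\<close>, written out through its values on the standard basis
  \<open>u\<close>.\<close>

lemma linear_form_separating:
  fixes v :: "'i \<Rightarrow> 'k::field"
  assumes J: "finite J" and V: "fvec.subspace V" "V \<subseteq> vecs J" and v: "v \<in> vecs J" "v \<notin> V"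
  obtains l where "l \<in> forms J 1" "\<forall>x\<in>V. mp_eval l x = 0" "mp_eval l v \<noteq> 0"
proof -
  define u :: "'i \<Rightarrow> 'i \<Rightarrow> 'k" where "u i = (\<lambda>j. if j = i then 1 else 0)" for i
  have u: "u i \<in> vecs J" if "i \<in> J" for i using that by (auto simp: u_def vecs_def)
  have expand: "x = (\<Sum>i\<in>J. fscale (x i) (u i))" if "x \<in> vecs J" for x
  proof
    fix j
    have "(\<Sum>i\<in>J. fscale (x i) (u i)) j = (\<Sum>i\<in>J. if i = j then x j else 0)"
      unfolding sum_apply by (rule sum.cong) (auto simp: fscale_def u_def)
    then show "x j = (\<Sum>i\<in>J. fscale (x i) (u i)) j"
      using that J by (auto simp: vecs_def)
  qed
  have "vecs J \<subseteq> fvec.span (u ` J)"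
  proof
    fix x :: "'i \<Rightarrow> 'k" assume x: "x \<in> vecs J"
    have "(\<Sum>i\<in>J. fscale (x i) (u i)) \<in> fvec.span (u ` J)"
      by (intro fvec.span_sum fvec.span_scale) (rule fvec.span_base, rule imageI)
    then show "x \<in> fvec.span (u ` J)" using expand[OF x] by simp
  qed
  from fvec.codim_coords[OF subspace_vecs V this finite_imageI[OF J]]
  obtain G and \<xi> where G: "finite G" "G \<subseteq> vecs J"
    "card G = fvec.dim (vecs J :: ('i \<Rightarrow> 'k) set) - fvec.dim V"
    "\<forall>g (I::'i set) c f. (\<forall>i\<in>I. f i \<in> vecs J) \<longrightarrow>
       \<xi> g (\<Sum>i\<in>I. fscale (c i) (f i)) = (\<Sum>i\<in>I. c i * \<xi> g (f i))"
    "\<forall>x\<in>vecs J. x \<in> V \<longleftrightarrow> (\<forall>g\<in>G. \<xi> g x = 0)"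
    "\<forall>g\<in>G. \<forall>h\<in>G. \<xi> g h = (if g = h then 1 else 0)" .
  obtain g where g: "g \<in> G" "\<xi> g v \<noteq> 0" using G(5) v by blast
  define l where "l = (\<Sum>i\<in>J. pscale (\<xi> g (u i)) (var i))"
  have l: "mp_eval l x = \<xi> g x" if "x \<in> vecs J" for x
  proof -
    have "\<xi> g x = \<xi> g (\<Sum>i\<in>J. fscale (x i) (u i))" using expand[OF that] by simp
    also have "\<dots> = (\<Sum>i\<in>J. x i * \<xi> g (u i))" using G(4) u by blast
    finally show ?thesis by (simp add: l_def mp_eval_sum mult.commute)
  qed
  show ?thesis
  proof
    show "l \<in> forms J 1" unfolding l_def by (intro forms_sum forms_pscale var_in_forms)
    show "\<forall>x\<in>V. mp_eval l x = 0" using V(2) G(5) g(1) l by (metis subsetD)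
    show "mp_eval l v \<noteq> 0" using g(2) l v(1) by simp
  qed
qed

lemma linear_form_separating_span:
  fixes v :: "'i \<Rightarrow> 'k::field"
  assumes "finite J" "C \<subseteq> vecs J" "v \<in> vecs J" "v \<notin> fvec.span C"
  obtains l where "l \<in> forms J 1" "\<forall>x\<in>C. mp_eval l x = 0" "mp_eval l v \<noteq> 0"
proof -
  obtain l where "l \<in> forms J 1" "\<forall>x\<in>fvec.span C. mp_eval l x = 0" "mp_eval l v \<noteq> 0"
    by (rule linear_form_separating[OF assms(1) fvec.subspace_span
          fvec.span_minimal[OF assms(2) subspace_vecs] assms(3,4)])
  then show ?thesis using that fvec.span_base by blast
qed

text \<open>Greedy choice: one element from each of the two largest classes of
  \<open>\<kappa>\<close>. A third class with \<open>Suc k\<close> elements would give three such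
  classes, too many for \<open>2 * Suc k\<close> elements. If there is only one class, the pair
  degenerates to \<open>c = c'\<close>.\<close>

lemma remove_pair:
  assumes C: "finite C" "C \<noteq> {}" "card C \<le> 2 * Suc k"
    and cl: "\<And>v. card {c \<in> C. \<kappa> c = v} \<le> Suc k"
  obtains c c' where "c \<in> C" "c' \<in> C" "c = c' \<or> \<kappa> c \<noteq> \<kappa> c'"
    "card (C - {c, c'}) \<le> 2 * k" "\<forall>v. card {x \<in> C - {c, c'}. \<kappa> x = v} \<le> k"
proof -
  define N where "N v = card {c \<in> C. \<kappa> c = v}" for v
  have max: "\<exists>c\<in>D. \<forall>x\<in>D. N (\<kappa> x) \<le> N (\<kappa> c)" if "D \<subseteq> C" "D \<noteq> {}" for D
  proof -
    let ?f = "\<lambda>x. N (\<kappa> x)"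
    have fin: "finite (?f ` D)" using that C(1) finite_subset by blast
    then have "Max (?f ` D) \<in> ?f ` D" using that by (intro Max_in) auto
    then obtain c where c: "c \<in> D" "Max (?f ` D) = ?f c" by auto
    have "?f x \<le> ?f c" if "x \<in> D" for x using Max_ge[OF fin, of "?f x"] that c by auto
    with c(1) show ?thesis by blast
  qed
  obtain c where c: "c \<in> C" "\<And>x. x \<in> C \<Longrightarrow> N (\<kappa> x) \<le> N (\<kappa> c)" using max[of C] C(2) by auto
  have less: "card {x \<in> C - {c, c'}. \<kappa> x = v} \<le> k" if "w \<in> C" "\<kappa> w = v" "w \<in> {c, c'}" for c' v w
  proof -
    have "{x \<in> C - {c, c'}. \<kappa> x = v} \<subseteq> {x \<in> C. \<kappa> x = v} - {w}" using that by auto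
    then have "card {x \<in> C - {c, c'}. \<kappa> x = v} \<le> card ({x \<in> C. \<kappa> x = v} - {w})"
      using C(1) by (intro card_mono) auto
    also have "\<dots> \<le> k" using cl[of v] that C(1) by (subst card_Diff_singleton) auto
    finally show ?thesis .
  qed
  show ?thesis
  proof (cases "\<forall>x\<in>C. \<kappa> x = \<kappa> c")
    case True
    then have "{x \<in> C. \<kappa> x = \<kappa> c} = C" by auto
    then have "card C \<le> Suc k" using cl[of "\<kappa> c"] by simp
    then have "card (C - {c, c}) \<le> 2 * k" using C(1) c(1) by simp
    moreover have "card {x \<in> C - {c, c}. \<kappa> x = v} \<le> k" for v
    proof (cases "v = \<kappa> c")
      case v: True
      then show ?thesis using less[of c v c] c(1) by blast
    next
      case False
      then have empty: "{x \<in> C - {c, c}. \<kappa> x = v} = {}" using True by auto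
      show ?thesis unfolding empty by simp
    qed
    ultimately show ?thesis using that c(1) by blast
  next
    case False
    define D where "D = {x \<in> C. \<kappa> x \<noteq> \<kappa> c}"
    obtain c' where c': "c' \<in> D" "\<And>x. x \<in> D \<Longrightarrow> N (\<kappa> x) \<le> N (\<kappa> c')"
      using max[of D] False by (auto simp: D_def)
    then have ne: "c' \<in> C" "\<kappa> c \<noteq> \<kappa> c'" "c \<noteq> c'" by (auto simp: D_def)
    have "card (C - {c, c'}) = card C - 2"
      using ne c(1) by (subst card_Diff_subset) auto
    then have "card (C - {c, c'}) \<le> 2 * k" using C(3) by simp
    moreover have "card {x \<in> C - {c, c'}. \<kappa> x = v} \<le> k" for v
    proof (cases "v = \<kappa> c \<or> v = \<kappa> c'")
      case True
      then show ?thesis using less[of c v c'] less[of c' v c'] c(1) ne(1) by blast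
    next
      case v: False
      show ?thesis
      proof (rule ccontr)
        assume "\<not> ?thesis"
        moreover have "{x \<in> C - {c, c'}. \<kappa> x = v} = {x \<in> C. \<kappa> x = v}" using v by auto
        ultimately have Nv: "Suc k \<le> N v" by (simp add: N_def)
        then have "{x \<in> C. \<kappa> x = v} \<noteq> {}" unfolding N_def by force
        then obtain x where "x \<in> C" "\<kappa> x = v" by blast
        then have "Suc k \<le> N (\<kappa> c')" "Suc k \<le> N (\<kappa> c)"
          using Nv c(2)[of x] c'(2)[of x] v by (auto simp: D_def)
        moreover have "N (\<kappa> c) + N (\<kappa> c') + N v =
            card ({x \<in> C. \<kappa> x = \<kappa> c} \<union> {x \<in> C. \<kappa> x = \<kappa> c'} \<union> {x \<in> C. \<kappa> x = v})"
          unfolding N_def using C(1) v ne(2)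
          by (subst card_Un_disjoint, simp, simp, blast, subst card_Un_disjoint) auto
        moreover have "\<dots> \<le> card C" by (rule card_mono) (use C(1) in auto)
        ultimately show False using Nv C(3) by simp
      qed
    qed
    ultimately show ?thesis using that[of c c'] c(1) ne by blast
  qed
qed

text \<open>
  The span of \<open>b\<close> and \<open>c\<close> labels the line joining two points; points with different labels
  are not collinear with \<open>b\<close>.
\<close>

lemma not_in_span_pair:
  assumes b: "b \<notin> fvec.span {c}" "b \<notin> fvec.span {c'}"
    and ne: "fvec.span {b, c} \<noteq> fvec.span {b, c'}"
  shows "b \<notin> fvec.span {c, c'}"
proof
  assume "b \<in> fvec.span {c, c'}"
  then have c: "c \<in> fvec.span {b, c'}"
    using fvec.in_span_insert[of b c "{c'}"] b(2) by blast
  from \<open>b \<in> _\<close> have "b \<in> fvec.span {c', c}" by (simp add: insert_commute)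
  then have c': "c' \<in> fvec.span {b, c}"
    using fvec.in_span_insert[of b c' "{c}"] b(1) by blast
  have "fvec.span {b, c} = fvec.span {b, c'}"
  proof (rule subset_antisym; rule fvec.span_minimal[OF _ fvec.subspace_span])
    show "{b, c} \<subseteq> fvec.span {b, c'}" using c by (auto intro: fvec.span_base)
    show "{b, c'} \<subseteq> fvec.span {b, c}" using c' by (auto intro: fvec.span_base)
  qed
  with ne show False by contradiction
qed

text \<open>The form is a product of linear forms, each vanishing at one or two points.\<close>

lemma form_vanishing_except:
  fixes b :: "'i \<Rightarrow> 'k::field"
  assumes J: "finite J" and b: "b \<in> vecs J" "b \<noteq> 0"
    and "finite C" "C \<subseteq> vecs J" "card C \<le> 2 * k" "\<And>c. c \<in> C \<Longrightarrow> b \<notin> fvec.span {c}"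
    and "\<And>V. card {c \<in> C. fvec.span {b, c} = V} \<le> k"
  obtains f where "f \<in> forms J k" "mp_eval f b \<noteq> 0" "\<forall>c\<in>C. mp_eval f c = 0"
proof -
  have "\<exists>f\<in>forms J k. mp_eval f b \<noteq> 0 \<and> (\<forall>c\<in>C. mp_eval f c = 0)"
    using assms(4-8)
  proof (induction k arbitrary: C)
    case 0
    then show ?case by (intro bexI[of _ 1]) (auto simp: one_in_forms)
  next
    case (Suc k)
    show ?case
    proof (cases "C = {}")
      case True
      then obtain f where f: "f \<in> forms J k" "mp_eval f b \<noteq> 0" using Suc.IH[of "{}"] by auto
      \<comment> \<open>No point is left to be killed, and the degree is filled up with a variable
        that does not vanish at \<open>b\<close>.\<close>
      obtain i where "b i \<noteq> 0" using b(2) by (auto simp: fun_eq_iff)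
      then have "i \<in> J" using b(1) by (auto simp: vecs_def)
      with \<open>b i \<noteq> 0\<close> f True show ?thesis
        using forms_mult[OF var_in_forms f(1)] by (intro bexI[of _ "var i * f"]) auto
    next
      case False
      from Suc.prems(1) False Suc.prems(3,5) obtain c c' where c: "c \<in> C" "c' \<in> C"
        "c = c' \<or> fvec.span {b, c} \<noteq> fvec.span {b, c'}" "card (C - {c, c'}) \<le> 2 * k"
        "\<forall>V. card {x \<in> C - {c, c'}. fvec.span {b, x} = V} \<le> k"
        by (rule remove_pair[where \<kappa> = "\<lambda>c. fvec.span {b, c}"])
      obtain f where f: "f \<in> forms J k" "mp_eval f b \<noteq> 0"
          "\<forall>x\<in>C - {c, c'}. mp_eval f x = 0"
        using Suc.IH[OF _ _ c(4) _ c(5)[rule_format]] Suc.prems by (meson DiffD1 Diff_subset finite_Diff order_trans)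
      \<comment> \<open>The removed points lie on different lines through \<open>b\<close> or
        coincide, so one linear form can vanish at both of them but not at \<open>b\<close>.\<close>
      have "b \<notin> fvec.span {c, c'}"
        using c(1-3) Suc.prems(4) not_in_span_pair by (metis insert_absorb2)
      moreover have "{c, c'} \<subseteq> vecs J" using c(1,2) Suc.prems(2) by blast
      ultimately obtain l where
        l: "l \<in> forms J 1" "\<forall>x\<in>{c, c'}. mp_eval l x = 0" "mp_eval l b \<noteq> 0"
        using linear_form_separating_span[OF J _ b(1)] by blast
      have "l * f \<in> forms J (Suc k)" using forms_mult[OF l(1) f(1)] by simp
      then show ?thesis
        using l f by (intro bexI[of _ "l * f"]) auto
    qed
  qed
  then show ?thesis using that by blast
qed

text \<open>\<open>R\<close> consists of representatives of distinct points. By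
  \<open>R_lines\<close> a line through \<open>b\<close> has at most \<open>s - 2\<close> further
  points in \<open>R\<close>, that is, at most \<open>s - 1\<close> in all. Written as a sum, the
  bound also gives \<open>2 \<le> s\<close> once \<open>R\<close> is nonempty.\<close>

locale scattered_points =
  fixes m s :: nat and R :: "(nat \<Rightarrow> 'k::field) set"
  assumes finite_R: "finite R" and R_vecs: "R \<subseteq> vecs {..m}" and R_nonzero: "0 \<notin> R"
    and R_distinct: "b \<in> R \<Longrightarrow> c \<in> R \<Longrightarrow> b \<noteq> c \<Longrightarrow> b \<notin> fvec.span {c}"
    and R_lines: "b \<in> R \<Longrightarrow> card {c \<in> R - {b}. fvec.span {b, c} = V} + 2 \<le> s"
    and card_R: "card R \<le> 2 * s"
begin

lemma form_vanishing_on_subset: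
  assumes "b \<in> R" "C \<subseteq> R - {b}" "card C \<le> 2 * k" "s \<le> k + 2"
  obtains f where "f \<in> forms {..m} k" "mp_eval f b \<noteq> 0" "\<forall>c\<in>C. mp_eval f c = 0"
proof (rule form_vanishing_except[of "{..m}" b C k])
  show "card {c \<in> C. fvec.span {b, c} = V} \<le> k" for V
  proof -
    have "card {c \<in> C. fvec.span {b, c} = V} \<le> card {c \<in> R - {b}. fvec.span {b, c} = V}"
      using finite_R assms(2) by (intro card_mono) auto
    then show ?thesis using R_lines[OF assms(1), of V] assms(4) by simp
  qed
  show "b \<noteq> 0" using assms(1) R_nonzero by blast
  show "finite C" using assms(2) finite_R finite_subset by blast
  show "b \<notin> fvec.span {c}" if "c \<in> C" for c
    using that assms R_distinct by blast
qed (use assms R_vecs that in auto)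

lemma separating_form:
  assumes "b \<in> R" "card R \<le> 2 * k + 1" "s \<le> k + 2"
  obtains f where "f \<in> forms {..m} k" "\<forall>c\<in>R. mp_eval f c = (if c = b then 1 else 0)"
proof -
  have "card (R - {b}) \<le> 2 * k" using assms finite_R by simp
  then obtain f where f: "f \<in> forms {..m} k" "mp_eval f b \<noteq> 0"
      "\<forall>c\<in>R - {b}. mp_eval f c = 0"
    using form_vanishing_on_subset[OF assms(1) subset_refl _ assms(3)] by blast
  then show ?thesis
    using that[of "pscale (inverse (mp_eval f b)) f"] by (simp add: forms_pscale)
qed

definition ideal_part :: "nat \<Rightarrow> (nat, 'k) mpol set" where
  "ideal_part k = {f \<in> forms {..m} k. \<forall>c\<in>R. mp_eval f c = 0}"

lemma subspace_ideal_part: "pvec.subspace (ideal_part k)"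
  by (auto simp: ideal_part_def pvec.subspace_def forms_add forms_pscale)

context
  fixes W :: "(nat, 'k) mpol set" and k :: nat
  assumes W: "pvec.subspace W" and sk: "s \<le> k"
    and W_mult: "\<And>l f. l \<in> forms {..m} 1 \<Longrightarrow> f \<in> ideal_part k \<Longrightarrow> l * f \<in> W"
begin

text \<open>\<open>e\<close> may be replaced by the separator \<open>l * h\<close>, up to a scalar,
  because the difference vanishes on \<open>R\<close>. For \<open>l * h\<close> the factors are
  regrouped: \<open>n * h\<close> vanishes on all of \<open>R\<close>, at \<open>D\<close> through
  \<open>h\<close> and elsewhere through \<open>n\<close>, so \<open>l * (n * h)\<close> is in
  \<open>W\<close>.\<close>

lemma separator_mult_aux:
  assumes b: "b \<in> R" and e: "e \<in> forms {..m} k" "\<And>c. c \<in> R \<Longrightarrow> mp_eval e c = (if c = b then 1 else 0)"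
    and D: "D \<subseteq> R - {b}" "card D \<le> 2 * (k - 1)"
    and l: "l \<in> forms {..m} 1" "mp_eval l b \<noteq> 0" "\<And>c. c \<in> R - {b} - D \<Longrightarrow> mp_eval l c = 0"
    and n: "n \<in> forms {..m} 1" "\<And>c. c \<in> R - D \<Longrightarrow> mp_eval n c = 0"
  shows "n * e \<in> W"
proof -
  have "2 \<le> s" using R_lines[OF b, of "{}"] by simp
  then have k: "Suc (k - 1) = k" "s \<le> (k - 1) + 2" using sk by simp_all
  obtain h where h: "h \<in> forms {..m} (k - 1)" "mp_eval h b \<noteq> 0" "\<forall>c\<in>D. mp_eval h c = 0"
    by (rule form_vanishing_on_subset[OF b D k(2)])
  define g where "g = mp_eval l b * mp_eval h b"
  have lh: "l * h \<in> forms {..m} k" and nh: "n * h \<in> forms {..m} k"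
    using forms_mult[OF l(1) h(1)] forms_mult[OF n(1) h(1)] k(1) by simp_all
  have "mp_eval l c * mp_eval h c = 0" if "c \<in> R" "c \<noteq> b" for c
    using that l(3)[of c] h(3) by (cases "c \<in> D") auto
  then have "e - pscale (inverse g) (l * h) \<in> ideal_part k"
    using e lh l(2) h(2) b
    by (auto simp: ideal_part_def g_def forms_diff forms_pscale field_simps)
  then have 1: "n * (e - pscale (inverse g) (l * h)) \<in> W" using W_mult n(1) by blast
  have "mp_eval n c * mp_eval h c = 0" if "c \<in> R" for c
    using that n(2)[of c] h(3) by (cases "c \<in> D") auto
  then have "n * h \<in> ideal_part k" using nh by (auto simp: ideal_part_def)
  then have 2: "l * (n * h) \<in> W" using W_mult l(1) by blast
  have "n * e = n * (e - pscale (inverse g) (l * h)) + pscale (inverse g) (l * (n * h))"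
    by (simp add: right_diff_distrib pscale_mult_right mult_ac)
  then show ?thesis
    using 1 2 pvec.subspace_add[OF W] pvec.subspace_scale[OF W] by metis
qed

text \<open>
  If \<open>card R = 2 * k\<close>, one of the \<open>k\<close> linear factors of a separator of \<open>b\<close> has to pass through a
  single further point \<open>c\<close> only, and linear forms vanishing at \<open>b\<close> and \<open>c\<close> are dealt with by the previous
  lemma.  For two such points on different lines through \<open>b\<close> these forms span all linear
  forms vanishing at \<open>b\<close>.
\<close>

lemma separator_mult:
  assumes b: "b \<in> R" and e: "e \<in> forms {..m} k" "\<And>c. c \<in> R \<Longrightarrow> mp_eval e c = (if c = b then 1 else 0)"
    and n: "n \<in> forms {..m} 1" "mp_eval n b = 0"
  shows "n * e \<in> W"
proof (cases "card R = 2 * k")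
  case False
  \<comment> \<open>With fewer than \<open>2 * k\<close> points, \<open>D\<close> can be all of
    \<open>R - {b}\<close>, and a variable that is nonzero at \<open>b\<close> serves as
    \<open>l\<close>.\<close>
  have "card R < 2 * k" using card_R sk False by simp
  then have card: "card (R - {b}) \<le> 2 * (k - 1)" using b finite_R by simp
  have bv: "b \<in> vecs {..m}" "b \<noteq> 0" using b R_vecs R_nonzero by auto
  then obtain i where "b i \<noteq> 0" by (auto simp: fun_eq_iff)
  then have "i \<in> {..m}" using bv by (auto simp: vecs_def)
  then show ?thesis
    using separator_mult_aux[OF b e subset_refl card var_in_forms _ _ n(1)] \<open>b i \<noteq> 0\<close> n(2)
    by auto
next
  case True
  let ?\<kappa> = "\<lambda>c. fvec.span {b, c}"
  have s: "2 \<le> s" using R_lines[OF b, of "{}"] by simp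
  have card: "card (R - {b}) = 2 * k - 1" using True b finite_R by simp
  then have "R - {b} \<noteq> {}" using s sk by force
  then obtain c where c: "c \<in> R" "c \<noteq> b" by blast
  \<comment> \<open>Otherwise one line through \<open>b\<close> would contain all
    \<open>2 * k - 1\<close> other points, more than the \<open>s - 2\<close> allowed.\<close>
  have "\<exists>c'\<in>R - {b}. ?\<kappa> c' \<noteq> ?\<kappa> c"
  proof (rule ccontr)
    assume "\<not> ?thesis"
    then have "{c' \<in> R - {b}. ?\<kappa> c' = ?\<kappa> c} = R - {b}" by blast
    then show False using R_lines[OF b, of "?\<kappa> c"] card s sk by simp
  qed
  then obtain c' where c': "c' \<in> R" "c' \<noteq> b" "?\<kappa> c' \<noteq> ?\<kappa> c" by blast
  have ne: "c \<noteq> c'" using c' by auto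
  have vanish: "n' * e \<in> W" if d: "d \<in> R" "d \<noteq> b" and n': "n' \<in> forms {..m} 1"
      "mp_eval n' b = 0" "mp_eval n' d = 0" for d n'
  proof -
    have "b \<notin> fvec.span {d}" using R_distinct b d by auto
    then obtain l where l: "l \<in> forms {..m} 1" "\<forall>x\<in>{d}. mp_eval l x = 0" "mp_eval l b \<noteq> 0"
      by (rule linear_form_separating_span[where J = "{..m}", rotated 3]) (use b d R_vecs in auto)
    show ?thesis
    proof (rule separator_mult_aux[OF b e, of "R - {b, d}" l n'])
      show "card (R - {b, d}) \<le> 2 * (k - 1)"
        using True b d finite_R by (subst card_Diff_subset) auto
    qed (use l n' in auto)
  qed
  have "c \<notin> fvec.span {b, c'}"
  proof
    assume "c \<in> fvec.span {b, c'}"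
    moreover have "c \<notin> fvec.span {b}" "c \<notin> fvec.span {c'}" using R_distinct c c' b ne by auto
    ultimately have "fvec.span {c, b} = fvec.span {c, c'}" using not_in_span_pair by blast
    have "{b, c} \<subseteq> fvec.span {b, c'}" using \<open>c \<in> fvec.span {b, c'}\<close> by (auto intro: fvec.span_base)
    moreover have "c' \<in> fvec.span {b, c}"
      using \<open>fvec.span {c, b} = fvec.span {c, c'}\<close> fvec.span_base[of c' "{c, c'}"]
      by (simp add: insert_commute)
    then have "{b, c'} \<subseteq> fvec.span {b, c}" by (auto intro: fvec.span_base)
    ultimately have "?\<kappa> c = ?\<kappa> c'"
      by (meson fvec.span_minimal fvec.subspace_span subset_antisym)
    with c'(3) show False by simp
  qed
  then obtain p where p: "p \<in> forms {..m} 1" "\<forall>x\<in>{b, c'}. mp_eval p x = 0" "mp_eval p c \<noteq> 0"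
    by (rule linear_form_separating_span[where J = "{..m}", rotated 3]) (use b c c' R_vecs in auto)
  \<comment> \<open>Splits \<open>n\<close> into a form vanishing at \<open>b\<close> and
    \<open>c\<close> and the multiple \<open>pscale g p\<close>, which vanishes at \<open>b\<close>
    and \<open>c'\<close>. Each part falls under \<open>vanish\<close>.\<close>
  define g where "g = mp_eval n c / mp_eval p c"
  have "(n - pscale g p) * e \<in> W"
    by (rule vanish[OF c]) (use n p in \<open>auto simp: g_def forms_diff forms_pscale\<close>)
  moreover have "pscale g p * e \<in> W"
    by (rule vanish[OF c'(1,2)]) (use p in \<open>auto simp: forms_pscale\<close>)
  ultimately have "(n - pscale g p) * e + pscale g p * e \<in> W" by (rule pvec.subspace_add[OF W])
  then show ?thesis by (simp add: distrib_right[symmetric])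
qed

end

text \<open>The ideal of \<open>R\<close> is generated in degree at most \<open>s\<close>.\<close>

lemma ideal_part_Suc_subset:
  assumes W: "pvec.subspace W" and sk: "s \<le> k"
    and mult: "\<And>l f. l \<in> forms {..m} 1 \<Longrightarrow> f \<in> ideal_part k \<Longrightarrow> l * f \<in> W"
  shows "ideal_part (Suc k) \<subseteq> W"
proof -
  \<comment> \<open>The intersection keeps the error terms below inside the forms vanishing on
    \<open>R\<close>, so that they disappear under evaluation.\<close>
  define W' where "W' = W \<inter> ideal_part (Suc k)"
  have W': "pvec.subspace W'"
    unfolding W'_def by (intro pvec.subspace_inter W subspace_ideal_part)
  have mult': "l * f \<in> W'" if "l \<in> forms {..m} 1" "f \<in> ideal_part k" for l f
    using that mult forms_mult[OF that(1), of f k] by (auto simp: W'_def ideal_part_def)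
  have "\<forall>b\<in>R. \<exists>e\<in>forms {..m} k. \<forall>c\<in>R. mp_eval e c = (if c = b then 1 else 0)"
  proof
    fix b assume b: "b \<in> R"
    have "card R \<le> 2 * k + 1" "s \<le> k + 2" using card_R sk by simp_all
    then obtain e where "e \<in> forms {..m} k" "\<forall>c\<in>R. mp_eval e c = (if c = b then 1 else 0)"
      by (rule separating_form[OF b])
    then show "\<exists>e\<in>forms {..m} k. \<forall>c\<in>R. mp_eval e c = (if c = b then 1 else 0)" by blast
  qed
  then obtain e where e: "\<And>b. b \<in> R \<Longrightarrow> e b \<in> forms {..m} k"
      "\<And>b c. b \<in> R \<Longrightarrow> c \<in> R \<Longrightarrow> mp_eval (e b) c = (if c = b then 1 else 0)"
    by metis
  have eval_sum: "mp_eval (\<Sum>b\<in>R. n b * e b) c = mp_eval (n c) c" if "c \<in> R" for n c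
  proof -
    have "mp_eval (\<Sum>b\<in>R. n b * e b) c = (\<Sum>b\<in>R. if b = c then mp_eval (n b) c else 0)"
      unfolding mp_eval_sum by (rule sum.cong) (use e that in auto)
    then show ?thesis using finite_R that by simp
  qed
  \<comment> \<open>Modulo \<open>W'\<close> every form of degree \<open>Suc k\<close> will be a
    combination of the separators \<open>e b\<close> with linear coefficients \<open>n b\<close>. If
    the form vanishes on \<open>R\<close>, evaluation at \<open>b\<close> forces \<open>n b\<close>
    to vanish at \<open>b\<close>, and \<open>separator_mult\<close> applies to each
    summand.\<close>
  define V where "V = {f. \<exists>n. (\<forall>b\<in>R. n b \<in> forms {..m} 1) \<and> f - (\<Sum>b\<in>R. n b * e b) \<in> W'}"
  have V: "pvec.subspace V"
    unfolding pvec.subspace_def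
  proof (intro conjI ballI allI)
    show "0 \<in> V" unfolding V_def using pvec.subspace_0[OF W'] by (auto intro!: exI[of _ "\<lambda>_. 0"])
  next
    fix f g assume "f \<in> V" "g \<in> V"
    then obtain n n' where n: "\<forall>b\<in>R. n b \<in> forms {..m} 1" "f - (\<Sum>b\<in>R. n b * e b) \<in> W'"
      "\<forall>b\<in>R. n' b \<in> forms {..m} 1" "g - (\<Sum>b\<in>R. n' b * e b) \<in> W'" by (auto simp: V_def)
    have "f + g - (\<Sum>b\<in>R. (n b + n' b) * e b) =
        (f - (\<Sum>b\<in>R. n b * e b)) + (g - (\<Sum>b\<in>R. n' b * e b))"
      by (simp add: distrib_right sum.distrib)
    then have "f + g - (\<Sum>b\<in>R. (n b + n' b) * e b) \<in> W'"
      using pvec.subspace_add[OF W' n(2,4)] by (simp only:)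
    then show "f + g \<in> V" unfolding V_def using n(1,3)
      by (auto intro!: exI[of _ "\<lambda>b. n b + n' b"] forms_add)
  next
    fix a f assume "f \<in> V"
    then obtain n where n: "\<forall>b\<in>R. n b \<in> forms {..m} 1" "f - (\<Sum>b\<in>R. n b * e b) \<in> W'"
      by (auto simp: V_def)
    have "pscale a f - (\<Sum>b\<in>R. pscale a (n b) * e b) = pscale a (f - (\<Sum>b\<in>R. n b * e b))"
      by (simp add: pvec.scale_right_diff_distrib pvec.scale_sum_right pscale_mult_left)
    then have "pscale a f - (\<Sum>b\<in>R. pscale a (n b) * e b) \<in> W'"
      using pvec.subspace_scale[OF W' n(2)] by (simp only:)
    then show "pscale a f \<in> V" unfolding V_def using n(1)
      by (auto intro!: exI[of _ "\<lambda>b. pscale a (n b)"] forms_pscale)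
  qed
  have "forms {..m} (1 + k) \<subseteq> V"
  proof (rule forms_add_subset[OF V])
    fix l g :: "(nat, 'k) mpol" assume l: "l \<in> forms {..m} 1" and g: "g \<in> forms {..m} k"
    have "g - (\<Sum>b\<in>R. pscale (mp_eval g b) (e b)) \<in> ideal_part k"
    proof -
      have "mp_eval (\<Sum>b\<in>R. pscale (mp_eval g b) (e b)) c = mp_eval g c" if "c \<in> R" for c
        using eval_sum[OF that, of "\<lambda>b. Poly_Mapping.single 0 (mp_eval g b)"]
        by (simp add: pscale_def mp_eval_single)
      then show ?thesis
        using g e(1) by (auto simp: ideal_part_def intro!: forms_diff forms_sum forms_pscale)
    qed
    then have "l * (g - (\<Sum>b\<in>R. pscale (mp_eval g b) (e b))) \<in> W'" by (rule mult'[OF l])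
    moreover have "l * (g - (\<Sum>b\<in>R. pscale (mp_eval g b) (e b))) =
        l * g - (\<Sum>b\<in>R. pscale (mp_eval g b) l * e b)"
      by (simp add: right_diff_distrib sum_distrib_left pscale_mult_left pscale_mult_right)
    ultimately show "l * g \<in> V" unfolding V_def using l
      by (auto intro!: exI[of _ "\<lambda>b. pscale (mp_eval g b) l"] forms_pscale)
  qed
  moreover have "f \<in> W" if f: "f \<in> ideal_part (Suc k)" "f \<in> V" for f
  proof -
    obtain n where n: "\<forall>b\<in>R. n b \<in> forms {..m} 1" "f - (\<Sum>b\<in>R. n b * e b) \<in> W'"
      using f(2) by (auto simp: V_def)
    have "n b * e b \<in> W" if b: "b \<in> R" for b
    proof (rule separator_mult[OF W sk mult b])
      have "mp_eval (f - (\<Sum>b\<in>R. n b * e b)) b = 0" "mp_eval f b = 0"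
        using n(2) f(1) b by (auto simp: W'_def ideal_part_def)
      then show "mp_eval (n b) b = 0" using eval_sum[OF b] by simp
    qed (use n b e in auto)
    then have "(f - (\<Sum>b\<in>R. n b * e b)) + (\<Sum>b\<in>R. n b * e b) \<in> W"
      using n(2) by (intro pvec.subspace_add[OF W] pvec.subspace_sum[OF W]) (auto simp: W'_def)
    then show ?thesis by simp
  qed
  ultimately show ?thesis by (auto simp: ideal_part_def)
qed

end

section \<open>Points, spans and closed subschemes\<close>

lemma proj_spaceE:
  assumes "p \<in> proj_space J" "x \<in> p"
  shows "x \<in> vecs J" "x \<noteq> 0" "p = {fscale c x | c. c \<noteq> 0}"
proof -
  obtain z where z: "z \<in> vecs J - {0}" "p = proj_rel J `` {z}"
    using assms(1) by (auto simp: proj_space_def elim: quotientE)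
  have "(z, x) \<in> proj_rel J" using z(2) assms(2) by simp
  then have p: "p = proj_rel J `` {x}"
    using equiv_class_eq[OF equiv_proj_rel] z(2) by metis
  show x: "x \<in> vecs J" "x \<noteq> 0" using \<open>(z, x) \<in> proj_rel J\<close> by (auto simp: proj_rel_def)
  have "fscale c x \<in> vecs J - {0}" if "c \<noteq> 0" for c
    using x that by (auto simp: vecs_def fscale_def fun_eq_iff)
  then show "p = {fscale c x | c. c \<noteq> 0}"
    unfolding p using x by (auto simp: proj_rel_def)
qed

lemma proj_space_nonempty:
  assumes "p \<in> proj_space J"
  obtains x where "x \<in> p"
proof -
  obtain z where z: "z \<in> vecs J - {0}" "p = proj_rel J `` {z}"
    using assms by (auto simp: proj_space_def elim: quotientE)
  then have "z \<in> p" using equiv_class_self[OF equiv_proj_rel] by metis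
  then show ?thesis using that by blast
qed

lemma point_class:
  assumes "x \<in> vecs J" "x \<noteq> 0"
  shows "proj_rel J `` {x} \<in> proj_space J" "x \<in> proj_rel J `` {x}"
  using assms equiv_class_self[OF equiv_proj_rel, of x J]
  by (auto simp: proj_space_def intro!: quotientI)

lemma point_subset_iff:
  assumes "p \<in> proj_space J" "x \<in> p" "fvec.subspace V"
  shows "p \<subseteq> V \<longleftrightarrow> x \<in> V"
  using proj_spaceE(3)[OF assms(1,2)] assms(2) fvec.subspace_scale[OF assms(3), of x] by auto

lemma vanishes_at_form_iff:
  assumes "p \<in> proj_space J" "x \<in> p" "f \<in> forms J t"
  shows "vanishes_at f p \<longleftrightarrow> mp_eval f x = 0"
  using proj_spaceE(3)[OF assms(1,2)] assms(2)
  by (auto simp: vanishes_at_def mp_eval_fscale_form[OF assms(3)])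

lemma mp_eval_linear:
  assumes l: "l \<in> forms J 1"
  shows "mp_eval l (x + y) = mp_eval l x + mp_eval l y" "mp_eval l (fscale c x) = c * mp_eval l x"
proof -
  have "pvec.subspace {l. mp_eval l (x + y) = mp_eval l x + mp_eval l y}"
    by (auto simp: pvec.subspace_def algebra_simps)
  moreover have "Poly_Mapping.single a 1 \<in> {l. mp_eval l (x + y) = mp_eval l x + mp_eval l y}"
    if "a \<in> monoms J 1" for a
  proof -
    from that have "a \<in> monoms J (Suc 0)" by simp
    then show ?thesis by (rule monoms_SucE) (auto simp: mp_eval_single)
  qed
  ultimately show "mp_eval l (x + y) = mp_eval l x + mp_eval l y"
    using forms_subset_subspace l by blast
  show "mp_eval l (fscale c x) = c * mp_eval l x" using mp_eval_fscale_form[OF l] by simp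
qed

lemma linear_subspace_proj_of:
  "fvec.subspace V \<Longrightarrow> V \<subseteq> vecs J \<Longrightarrow> linear_subspace J (proj_of J V)"
  by (auto simp: linear_subspace_def)

text \<open>The projectivised span of the representatives is one of the linear subspaces whose
  intersection is \<open>span_pts\<close>.\<close>

lemma in_span_ptsD:
  assumes S: "S \<subseteq> proj_space J" "\<And>q. q \<in> S \<Longrightarrow> r q \<in> q" and P: "P \<in> span_pts J S" and p: "p \<in> P"
  shows "p \<in> fvec.span (r ` S)"
proof -
  let ?V = "fvec.span (r ` S)"
  have "r ` S \<subseteq> vecs J" using S proj_spaceE(1) by blast
  then have V: "?V \<subseteq> vecs J" by (rule fvec.span_minimal[OF _ subspace_vecs])
  have "S \<subseteq> proj_of J ?V"
  proof
    fix q assume q: "q \<in> S"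
    then have "q \<subseteq> ?V"
      using point_subset_iff[OF _ S(2)[OF q] fvec.subspace_span] S(1) by (auto intro: fvec.span_base)
    with q S(1) show "q \<in> proj_of J ?V" by (auto simp: proj_of_def)
  qed
  then have "vanishing_ideal J (proj_of J ?V) \<subseteq> vanishing_ideal J S"
    by (auto simp: vanishing_ideal_def)
  then have "P \<in> proj_of J ?V"
    using P linear_subspace_proj_of[OF fvec.subspace_span V] by (auto simp: scheme_span_def)
  with p show ?thesis by (auto simp: proj_of_def)
qed

text \<open>A linear subspace whose ideal is contained in the ideal of \<open>S\<close> passes
  through every point of \<open>S\<close>, because a point outside it would be separated from it by
  a linear form.\<close>

lemma in_span_ptsI:
  fixes r :: "('i \<Rightarrow> 'k::field) set \<Rightarrow> 'i \<Rightarrow> 'k"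
  assumes J: "finite J" and S: "S \<subseteq> proj_space J" "\<And>q. q \<in> S \<Longrightarrow> r q \<in> q"
    and P: "P \<in> proj_space J" "p \<in> P" and p: "p \<in> fvec.span (r ` S)"
  shows "P \<in> span_pts J S"
  unfolding scheme_span_def
proof (clarsimp simp: linear_subspace_def)
  fix V :: "('i \<Rightarrow> 'k) set"
  assume V: "fvec.subspace V" "V \<subseteq> vecs J" "vanishing_ideal J (proj_of J V) \<subseteq> vanishing_ideal J S"
  have "r q \<in> V" if q: "q \<in> S" for q
  proof (rule ccontr)
    assume "r q \<notin> V"
    have q': "q \<in> proj_space J" "r q \<in> q" using q S by auto
    obtain l where l: "l \<in> forms J 1" "\<forall>x\<in>V. mp_eval l x = 0" "mp_eval l (r q) \<noteq> 0"
      by (rule linear_form_separating[OF J V(1,2) proj_spaceE(1)[OF q'] \<open>r q \<notin> V\<close>])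
    then have "l \<in> vanishing_ideal J (proj_of J V)"
      using forms_subset_polys by (auto simp: vanishing_ideal_def proj_of_def vanishes_at_def)
    then have "vanishes_at l q" using V(3) q by (auto simp: vanishing_ideal_def)
    then show False using l(3) q'(2) by (auto simp: vanishes_at_def)
  qed
  then have "fvec.span (r ` S) \<subseteq> V" by (intro fvec.span_minimal V) auto
  then show "P \<in> proj_of J V"
    using p P point_subset_iff[OF P V(1)] by (auto simp: proj_of_def)
qed

lemma vanishing_ideal_eval:
  assumes "f \<in> vanishing_ideal J (proj_of J V)" "fvec.subspace V" "V \<subseteq> vecs J" "x \<in> V" "x \<noteq> 0"
  shows "mp_eval f x = 0"
proof -
  have x: "x \<in> vecs J" using assms by blast
  have "proj_rel J `` {x} \<in> proj_of J V"
    using point_class[OF x assms(5)] point_subset_iff[OF point_class[OF x assms(5)] assms(2)] assms(4)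
    by (auto simp: proj_of_def)
  then show ?thesis
    using assms(1) point_class(2)[OF x assms(5)] by (auto simp: vanishing_ideal_def vanishes_at_def)
qed

section \<open>Linear forms in the ideal of a scheme and its linear span\<close>

locale subscheme =
  fixes J :: "'i set" and Z :: "('i, 'k::field_char_0) mpol set"
  assumes finite_J: "finite J" and closed: "closed_subscheme J Z"
begin

lemma Z_polys: "f \<in> Z \<Longrightarrow> f \<in> polys J"
  and Z_zero: "0 \<in> Z"
  and Z_add: "f \<in> Z \<Longrightarrow> g \<in> Z \<Longrightarrow> f + g \<in> Z"
  and Z_mult: "f \<in> Z \<Longrightarrow> g \<in> polys J \<Longrightarrow> g * f \<in> Z"
  and Z_hom_part: "f \<in> Z \<Longrightarrow> hom_part t f \<in> Z"
  and Z_saturated: "f \<in> polys J \<Longrightarrow> (\<And>a. a \<in> monoms J k \<Longrightarrow> Poly_Mapping.single a 1 * f \<in> Z) \<Longrightarrow> f \<in> Z"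
  using closed unfolding closed_subscheme_def by blast+

lemma Z_pscale: "f \<in> Z \<Longrightarrow> pscale c f \<in> Z"
  unfolding pscale_def by (rule Z_mult) (auto simp: polys_def)

lemma subspace_Z: "pvec.subspace Z"
  by (auto simp: pvec.subspace_def Z_zero Z_add Z_pscale)

lemma Z_sum: "(\<And>x. x \<in> A \<Longrightarrow> f x \<in> Z) \<Longrightarrow> (\<Sum>x\<in>A. f x) \<in> Z"
  by (rule pvec.subspace_sum[OF subspace_Z])

lemma Z_eqI:
  assumes Y: "subscheme J Y" and eq: "\<And>t f. f \<in> forms J t \<Longrightarrow> f \<in> Z \<longleftrightarrow> f \<in> Y"
  shows "Z = Y"
proof -
  interpret Y: subscheme J Y by (rule Y)
  have "f \<in> Y" if "f \<in> Z" for f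
    using Y.Z_sum[of "mdeg ` Poly_Mapping.keys f" "\<lambda>t. hom_part t f"]
      Z_hom_part[OF that] eq[OF hom_part_in_forms[OF Z_polys[OF that]]]
    by (simp flip: sum_hom_part)
  moreover have "f \<in> Z" if "f \<in> Y" for f
    using Z_sum[of "mdeg ` Poly_Mapping.keys f" "\<lambda>t. hom_part t f"]
      Y.Z_hom_part[OF that] eq[OF hom_part_in_forms[OF Y.Z_polys[OF that]]]
    by (simp flip: sum_hom_part)
  ultimately show ?thesis by blast
qed

text \<open>
  The linear forms in \<open>Z\<close> define a linear space \<open>V\<close>, and modulo \<open>Z\<close> every polynomial is equal to
  its pullback \<open>mp_subst \<sigma> f\<close> along a linear projection onto \<open>V\<close>.
\<close>

lemma linear_form_vanishes_on_span:
  assumes P: "P \<in> scheme_span J Z" "p \<in> P" and l: "l \<in> forms J 1" "l \<in> Z"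
  shows "mp_eval l p = 0"
proof -
  let ?S = "forms J 1 \<inter> Z"
  define V where "V = {x \<in> vecs J. \<forall>l\<in>?S. mp_eval l x = 0}"
  have V: "fvec.subspace V" "V \<subseteq> vecs J"
    using fvec.subspace_add[OF subspace_vecs] fvec.subspace_scale[OF subspace_vecs]
      fvec.subspace_0[OF subspace_vecs] mp_eval_linear(2)[of _ J 0 0]
    by (auto simp: V_def fvec.subspace_def mp_eval_linear)
  obtain G :: "('i, 'k) mpol set" and \<xi> where G: "finite G" "G \<subseteq> forms J 1"
    "card G = pvec.dim (forms J 1 :: ('i, 'k) mpol set) - pvec.dim ?S"
    "\<forall>g (I::('i, 'k) mpol set) c f. (\<forall>i\<in>I. f i \<in> forms J 1) \<longrightarrow>
       \<xi> g (\<Sum>i\<in>I. pscale (c i) (f i)) = (\<Sum>i\<in>I. c i * \<xi> g (f i))"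
    "\<forall>f\<in>forms J 1. f \<in> ?S \<longleftrightarrow> (\<forall>g\<in>G. \<xi> g f = 0)"
    "\<forall>g\<in>G. \<forall>h\<in>G. \<xi> g h = (if g = h then 1 else 0)"
    by (rule forms_codim_coords[OF finite_J pvec.subspace_inter[OF subspace_forms subspace_Z]
          Int_lower1])
  \<comment> \<open>Linearity is available only for sums indexed by a set of polynomials. For
    \<open>f = h\<close> the set \<open>{f, h}\<close> has one element, so this case is treated
    through the scalar \<open>2\<close>.\<close>
  have \<xi>_add: "\<xi> g (f + h) = \<xi> g f + \<xi> g h" if "f \<in> forms J 1" "h \<in> forms J 1" for g f h
  proof (cases "f = h")
    case True
    have "\<xi> g (\<Sum>i\<in>{f}. pscale 2 i) = (\<Sum>i\<in>{f}. 2 * \<xi> g i)"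
      using G(4)[rule_format, of "{f}" "\<lambda>i. i" g "\<lambda>_. 2"] that by simp
    moreover have "pscale 2 f = f + f"
      using pvec.scale_left_distrib[of 1 1 f] by simp
    ultimately show ?thesis using True by simp
  next
    case False
    then show ?thesis using G(4)[rule_format, of "{f, h}" "\<lambda>i. i" g "\<lambda>_. 1"] that by auto
  qed
  have \<xi>_scale: "\<xi> g (pscale c f) = c * \<xi> g f" if "f \<in> forms J 1" for g c f
    using G(4)[rule_format, of "{f}" "\<lambda>i. i" g "\<lambda>_. c"] that by simp
  \<comment> \<open>The normal form of the variable \<open>i\<close> modulo the linear forms in
    \<open>Z\<close>, in terms of the basis \<open>G\<close> of the quotient.\<close>
  define \<sigma> where "\<sigma> i = (if i \<in> J then \<Sum>g\<in>G. pscale (\<xi> g (var i)) g else 0)" for i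
  have \<sigma>_forms: "\<sigma> i \<in> forms J 1" for i
    using G(2) by (auto simp: \<sigma>_def intro!: forms_sum forms_pscale)
  have \<sigma>_Z: "var i - \<sigma> i \<in> ?S" if i: "i \<in> J" for i
  proof -
    have "\<xi> g (var i - \<sigma> i) = 0" if g: "g \<in> G" for g
    proof -
      have "\<xi> g (\<sigma> i) = (\<Sum>h\<in>G. \<xi> h (var i) * \<xi> g h)"
        using G(2) i G(4)[rule_format, of G "\<lambda>h. h" g "\<lambda>h. \<xi> h (var i)"]
        by (auto simp: \<sigma>_def)
      also have "\<dots> = (\<Sum>h\<in>G. if h = g then \<xi> h (var i) else 0)"
        by (rule sum.cong) (use G(6) g in auto)
      also have "\<dots> = \<xi> g (var i)" using G(1) g by simp
      finally have "\<xi> g (\<sigma> i) = \<xi> g (var i)" .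
      then show ?thesis
        using \<xi>_add[of "var i - \<sigma> i" "\<sigma> i" g] \<sigma>_forms[of i] forms_diff[OF var_in_forms[OF i] \<sigma>_forms[of i]]
        by simp
    qed
    then show ?thesis using G(5) forms_diff[OF var_in_forms[OF i] \<sigma>_forms] by blast
  qed
  define \<pi> where "\<pi> x = (\<lambda>i. mp_eval (\<sigma> i) x)" for x :: "'i \<Rightarrow> 'k"
  \<comment> \<open>Composition of a linear form \<open>l\<close> with \<open>\<pi>\<close> has
    coordinates \<open>\<xi> g l\<close> in \<open>G\<close>, and these are zero for
    \<open>l\<close> in \<open>Z\<close>.\<close>
  have \<pi>_V: "\<pi> x \<in> V" for x
  proof -
    have "mp_eval l (\<pi> x) = (\<Sum>g\<in>G. \<xi> g l * mp_eval g x)" if "l \<in> forms J 1" for l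
    proof -
      let ?U = "{l \<in> forms J 1. mp_eval l (\<pi> x) = (\<Sum>g\<in>G. \<xi> g l * mp_eval g x)}"
      have zero: "\<xi> g 0 = 0" for g using \<xi>_scale[of 0 g 0] by simp
      have "pvec.subspace ?U"
        unfolding pvec.subspace_def
        by (auto simp: zero \<xi>_add \<xi>_scale forms_add forms_pscale distrib_right sum.distrib
            sum_distrib_left mult.assoc)
      moreover have "Poly_Mapping.single a 1 \<in> ?U" if "a \<in> monoms J 1" for a
      proof -
        from that have "a \<in> monoms J (Suc 0)" by simp
        then obtain i where i: "i \<in> J" "a = Poly_Mapping.single i 1" by (rule monoms_SucE) simp
        then have var: "Poly_Mapping.single a 1 = (var i :: ('i, 'k) mpol)" by (simp add: var_def)
        show ?thesis unfolding var using i(1) var_in_forms[OF i(1)]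
          by (simp add: \<pi>_def \<sigma>_def mp_eval_sum)
      qed
      ultimately show ?thesis using forms_subset_subspace that by blast
    qed
    moreover have "\<pi> x \<in> vecs J" by (auto simp: vecs_def \<pi>_def \<sigma>_def)
    ultimately show ?thesis using G(5) by (auto simp: V_def)
  qed
  have \<pi>_id: "\<pi> x = x" if "x \<in> V" for x
  proof
    fix i
    show "\<pi> x i = x i"
    proof (cases "i \<in> J")
      case True
      then have "mp_eval (var i - \<sigma> i) x = 0" using \<sigma>_Z[OF True] that unfolding V_def by blast
      then show ?thesis by (simp add: \<pi>_def)
    next
      case False
      then show ?thesis using that by (auto simp: \<pi>_def \<sigma>_def V_def vecs_def)
    qed
  qed
  have mon: "Poly_Mapping.single a 1 - mon_prod \<sigma> a \<in> Z" if "a \<in> monoms J t" for a t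
    using that
  proof (induction t arbitrary: a)
    case 0
    then show ?case using Z_zero by simp
  next
    case (Suc t)
    from Suc.prems obtain i b where a: "i \<in> J" "b \<in> monoms J t" "a = Poly_Mapping.single i 1 + b"
      by (rule monoms_SucE)
    have "mon_prod \<sigma> b \<in> polys J"
      by (rule subsetD[OF forms_subset_polys mon_prod_in_forms[OF a(2) \<sigma>_forms]])
    moreover have "(var i :: ('i, 'k) mpol) \<in> polys J"
      by (rule subsetD[OF forms_subset_polys var_in_forms[OF a(1)]])
    ultimately have "var i * (Poly_Mapping.single b 1 - mon_prod \<sigma> b) +
        mon_prod \<sigma> b * (var i - \<sigma> i) \<in> Z"
      using \<sigma>_Z[OF a(1)] by (intro Z_add Z_mult Suc.IH a(2)) auto
    moreover have "Poly_Mapping.single a 1 = (var i * Poly_Mapping.single b 1 :: ('i, 'k) mpol)"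
      by (simp add: a(3) var_def mult_single)
    ultimately show ?case by (simp add: a(3) mon_prod_add algebra_simps)
  qed
  have subst: "f - mp_subst \<sigma> f \<in> Z" if f: "f \<in> polys J" for f
  proof -
    have "(\<Sum>a\<in>Poly_Mapping.keys f. pscale (Poly_Mapping.lookup f a)
        (Poly_Mapping.single a 1 - mon_prod \<sigma> a)) \<in> Z"
    proof (intro Z_sum Z_pscale)
      fix a assume "a \<in> Poly_Mapping.keys f"
      then have "a \<in> monoms J (mdeg a)" using f by (auto simp: polys_def monoms_def)
      then show "Poly_Mapping.single a 1 - mon_prod \<sigma> a \<in> Z" by (rule mon)
    qed
    moreover have "mp_subst \<sigma> f =
        (\<Sum>a\<in>Poly_Mapping.keys f. pscale (Poly_Mapping.lookup f a) (mon_prod \<sigma> a))"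
      by (simp add: mp_subst_def mp_hom_def pscale_def)
    moreover have "f = (\<Sum>a\<in>Poly_Mapping.keys f.
        pscale (Poly_Mapping.lookup f a) (Poly_Mapping.single a 1))"
      by (simp add: pscale_def mult_single flip: poly_mapping_sum_single)
    ultimately show ?thesis
      by (simp only: pvec.scale_right_diff_distrib sum_subtractf)
  qed
  have "vanishing_ideal J (proj_of J V) \<subseteq> Z"
  proof
    fix f assume f: "f \<in> vanishing_ideal J (proj_of J V)"
    then have fJ: "f \<in> polys J" by (simp add: vanishing_ideal_def)
    show "f \<in> Z"
    proof (cases "1 \<in> Z")
      case True
      then show ?thesis using Z_mult[OF _ fJ] by fastforce
    next
      case False
      \<comment> \<open>If \<open>V\<close> were zero, all variables would lie in \<open>Z\<close>,
        and saturation would make \<open>Z\<close> the unit ideal.\<close>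
      have "\<exists>x0. \<pi> x0 \<noteq> 0"
      proof (rule ccontr)
        assume "\<not> ?thesis"
        then have "mp_eval (\<sigma> i) x = 0" for i x by (auto simp: \<pi>_def fun_eq_iff)
        then have "\<sigma> i = 0" for i
          by (intro poly_eq_0_if_vanishes[of "\<sigma> i" J] subsetD[OF forms_subset_polys \<sigma>_forms])
        then have var_Z: "var i \<in> Z" if "i \<in> J" for i using \<sigma>_Z[OF that] by simp
        have "1 \<in> Z"
        proof (rule Z_saturated[where k = "Suc 0"])
          show "1 \<in> polys J" by (simp add: polys_def)
          fix a assume "a \<in> monoms J (Suc 0)"
          then obtain i where "i \<in> J" "a = Poly_Mapping.single i 1" by (rule monoms_SucE) simp
          then show "Poly_Mapping.single a 1 * 1 \<in> Z" using var_Z by (simp add: var_def)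
        qed
        with False show False by contradiction
      qed
      then obtain x0 where x0: "\<pi> x0 \<noteq> 0" by blast
      have line: "mp_eval f (fscale c (\<pi> x0)) = 0" if "c \<noteq> 0" for c
        using vanishing_ideal_eval[OF f V fvec.subspace_scale[OF V(1) \<pi>_V]] x0 that
        by (auto simp: fscale_def fun_eq_iff)
      \<comment> \<open>Vanishing on \<open>proj_of J V\<close> says nothing directly about the zero
        vector. The value there is the constant term, a homogeneous part, which vanishes because
        \<open>f\<close> vanishes along the line through the nonzero vector
        \<open>\<pi> x0\<close>.\<close>
      have "mp_eval f (fscale 0 (\<pi> x0)) = 0"
      proof -
        have "mp_eval (hom_part t f) (fscale 0 (\<pi> x0)) = 0" for t
          unfolding mp_eval_fscale_form[OF hom_part_in_forms[OF fJ]]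
          using hom_part_vanishes[OF fJ line] by simp
        then have "mp_eval (\<Sum>t\<in>mdeg ` Poly_Mapping.keys f. hom_part t f) (fscale 0 (\<pi> x0)) = 0"
          unfolding mp_eval_sum by (intro sum.neutral) blast
        then show ?thesis by (simp flip: sum_hom_part)
      qed
      then have at_0: "mp_eval f 0 = 0" by simp
      have "mp_subst \<sigma> f = 0"
      proof (rule poly_eq_0_if_vanishes)
        have "mp_subst \<sigma> f = f - (f - mp_subst \<sigma> f)" by simp
        moreover have "f - (f - mp_subst \<sigma> f) \<in> polys J"
          using polys_add[OF fJ Z_polys[OF Z_pscale[OF subst[OF fJ], of "-1"]]] by simp
        ultimately show "mp_subst \<sigma> f \<in> polys J" by simp
        show "mp_eval (mp_subst \<sigma> f) x = 0" for x
          using vanishing_ideal_eval[OF f V \<pi>_V[of x]] at_0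
          by (cases "\<pi> x = 0") (auto simp: mp_eval_mp_subst \<pi>_def)
      qed
      then show ?thesis using subst[OF fJ] by simp
    qed
  qed
  then have "P \<in> proj_of J V"
    using P(1) linear_subspace_proj_of[OF V] by (auto simp: scheme_span_def)
  then show ?thesis using P(2) l by (auto simp: proj_of_def V_def)
qed

end

section \<open>Subschemes of Veronese varieties\<close>

lemma mp_eval_cong:
  assumes "f \<in> polys J" "\<And>i. i \<in> J \<Longrightarrow> x i = y i"
  shows "mp_eval f x = mp_eval f y"
proof -
  have "mon_prod x a = mon_prod y a" if "a \<in> Poly_Mapping.keys f" for a
    using assms that by (auto simp: mon_prod_def polys_def subset_iff intro!: prod.cong)
  then show ?thesis by (simp add: mp_eval_def mon_eval_mon_prod)
qed

text \<open>The ring homomorphism behind the Veronese embedding: the coordinate indexed by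
  \<open>a\<close> goes to the monomial with exponent vector \<open>a\<close>.\<close>

definition ver_pull :: "(nat \<Rightarrow>\<^sub>0 nat, 'k::field) mpol \<Rightarrow> (nat, 'k) mpol" where
  "ver_pull = mp_subst (\<lambda>a. Poly_Mapping.single a 1)"

lemma ver_pull_add: "ver_pull (f + g) = ver_pull f + ver_pull g"
  and ver_pull_diff: "ver_pull (f - g) = ver_pull f - ver_pull g"
  and ver_pull_mult: "ver_pull (f * g) = ver_pull f * ver_pull g"
  and ver_pull_pscale: "ver_pull (pscale c f) = pscale c (ver_pull f)"
  and ver_pull_sum: "ver_pull (\<Sum>x\<in>A. F x) = (\<Sum>x\<in>A. ver_pull (F x))"
  and ver_pull_zero [simp]: "ver_pull 0 = 0"
  by (simp_all add: ver_pull_def mp_subst_add mp_subst_diff mp_subst_mult mp_subst_pscale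
      mp_subst_sum)

lemma ver_pull_var: "ver_pull (var a) = Poly_Mapping.single a 1"
  by (simp add: ver_pull_def var_def mp_subst_single)

lemma ver_pull_forms: "f \<in> forms (ver_coords m d) t \<Longrightarrow> ver_pull f \<in> forms {..m} (t * d)"
  unfolding ver_pull_def by (rule mp_subst_in_forms) (auto intro: single_in_forms)

lemma mp_eval_ver_pull:
  assumes "f \<in> polys (ver_coords m d)"
  shows "mp_eval (ver_pull f) x = mp_eval f (ver_vec m d x)"
  unfolding ver_pull_def mp_eval_mp_subst
  by (rule mp_eval_cong[OF assms]) (simp add: mp_eval_single ver_vec_def mon_eval_mon_prod)

text \<open>A monomial of degree \<open>t * d\<close> is a product of \<open>t\<close> monomials of
  degree \<open>d\<close>, each the image of a coordinate.\<close>

lemma ver_pull_surj: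
  fixes g :: "(nat, 'k::field) mpol"
  assumes "g \<in> forms {..m} (t * d)"
  obtains f where "f \<in> forms (ver_coords m d) t" "ver_pull f = g"
proof -
  let ?V = "\<lambda>t. ver_pull ` (forms (ver_coords m d) t :: (nat \<Rightarrow>\<^sub>0 nat, 'k) mpol set)"
  have V: "pvec.subspace (?V t)" for t
    unfolding pvec.subspace_def
  proof (intro conjI ballI allI)
    show "0 \<in> ?V t" by (rule image_eqI[of _ _ 0]) auto
    show "f + g \<in> ?V t" if "f \<in> ?V t" "g \<in> ?V t" for f g
      using that by (auto simp: ver_pull_add[symmetric] intro!: imageI forms_add)
    show "pscale c f \<in> ?V t" if "f \<in> ?V t" for c f
      using that by (auto simp: ver_pull_pscale[symmetric] intro!: imageI forms_pscale)
  qed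
  have "Poly_Mapping.single a 1 \<in> ?V t" if "a \<in> monoms {..m} (t * d)" for a t
    using that
  proof (induction t arbitrary: a)
    case 0
    then show ?case using one_in_forms
      by (intro image_eqI[of _ _ 1]) (simp_all add: ver_pull_def mp_subst_def const_hom.mp_hom_one)
  next
    case (Suc t)
    then have "a \<in> monoms {..m} (d + t * d)" by simp
    then obtain b c where a: "b \<in> monoms {..m} d" "c \<in> monoms {..m} (t * d)" "a = b + c"
      by (rule monoms_split)
    obtain f where f: "f \<in> forms (ver_coords m d) t" "ver_pull f = (Poly_Mapping.single c 1 :: (nat, 'k) mpol)"
      using Suc.IH[OF a(2)] by (metis (mono_tags, lifting) imageE)
    have "var b * f \<in> forms (ver_coords m d) (Suc t)"
      using forms_mult[OF var_in_forms[OF a(1)] f(1)] by simp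
    moreover have "ver_pull (var b * f) = Poly_Mapping.single a 1"
      by (simp add: ver_pull_mult ver_pull_var f(2) mult_single a(3))
    ultimately show ?case by (metis image_eqI)
  qed
  then have "forms {..m} (t * d) \<subseteq> ?V t" by (intro forms_subset_subspace[OF V])
  then show ?thesis using assms that by blast
qed

section \<open>Passing from a subscheme of the Veronese variety to an ideal in \<open>m + 1\<close>
  variables\<close>

locale veronese_subscheme = subscheme "ver_coords m d" Z
  for m d :: nat and Z :: "(nat \<Rightarrow>\<^sub>0 nat, 'k::field_char_0) mpol set" +
  assumes d_pos: "d > 0" and on_veronese: "vanishing_ideal (ver_coords m d) (veronese_variety m d) \<subseteq> Z"
begin

definition V :: "nat \<Rightarrow> (nat, 'k) mpol set" where
  "V k = ver_pull ` (forms (ver_coords m d) k \<inter> Z)"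

text \<open>
  The homogeneous ideal of the subscheme of \<open>\<P>\<^sup>m\<close> whose image under the Veronese embedding is
  defined by \<open>Z\<close>; \<open>V k\<close> is its part of degree \<open>k * d\<close>.
\<close>

definition W :: "nat \<Rightarrow> (nat, 'k) mpol set" where
  "W j = {f \<in> forms {..m} j. \<forall>k. j \<le> k * d \<longrightarrow> (\<forall>g\<in>forms {..m} (k * d - j). g * f \<in> V k)}"

text \<open>Such a form vanishes at every point of the Veronese variety, whose ideal lies in
  \<open>Z\<close>. Hence no information on \<open>Z\<close> is lost under
  \<open>ver_pull\<close>.\<close>

lemma kernel_subset:
  assumes f: "f \<in> forms (ver_coords m d) k" and zero: "ver_pull f = 0"
  shows "f \<in> Z"
proof -
  have "vanishes_at f q" if q: "q \<in> veronese_variety m d" for q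
  proof -
    obtain p where p: "p \<in> proj_space {..m}" "q = veronese m d p"
      using q by (auto simp: veronese_variety_def)
    then obtain x where "x \<in> vecs {..m} - {0}" "p = proj_rel {..m} `` {x}"
      by (auto simp: proj_space_def elim: quotientE)
    then have x: "x \<in> vecs {..m} - {0}" "q = proj_rel (ver_coords m d) `` {ver_vec m d x}"
      using p veronese_class by metis+
    have v: "ver_vec m d x \<in> vecs (ver_coords m d)" "ver_vec m d x \<noteq> 0"
      using ver_vec_nonzero[OF x(1), of d] by auto
    have "mp_eval f (ver_vec m d x) = 0"
      using mp_eval_ver_pull[OF subsetD[OF forms_subset_polys f], of x] zero by simp
    then show ?thesis
      using vanishes_at_form_iff[OF _ _ f] point_class[OF v] x(2) by metis
  qed
  then have "f \<in> vanishing_ideal (ver_coords m d) (veronese_variety m d)"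
    using subsetD[OF forms_subset_polys f] by (simp add: vanishing_ideal_def)
  then show ?thesis using on_veronese by blast
qed

lemma ver_pull_in_V_iff:
  assumes f: "f \<in> forms (ver_coords m d) k"
  shows "ver_pull f \<in> V k \<longleftrightarrow> f \<in> Z"
proof
  assume "ver_pull f \<in> V k"
  then obtain g where g: "g \<in> forms (ver_coords m d) k" "g \<in> Z" "ver_pull f = ver_pull g"
    by (auto simp: V_def)
  then have "f - g \<in> Z" using f by (intro kernel_subset[of _ k]) (auto simp: ver_pull_diff forms_diff)
  then show "f \<in> Z" using Z_add[OF _ g(2), of "f - g"] by simp
qed (use f in \<open>auto simp: V_def\<close>)

lemma V_forms: "V k \<subseteq> forms {..m} (k * d)"
  using ver_pull_forms by (auto simp: V_def)

lemma subspace_V: "pvec.subspace (V k)"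
  unfolding pvec.subspace_def
proof (intro conjI ballI allI)
  show "0 \<in> V k" unfolding V_def by (rule image_eqI[of _ _ 0]) (auto simp: Z_zero)
  show "f + g \<in> V k" if "f \<in> V k" "g \<in> V k" for f g
    using that unfolding V_def
    by (auto simp: ver_pull_add[symmetric] intro!: imageI forms_add Z_add)
  show "pscale c f \<in> V k" if "f \<in> V k" for c f
    using that unfolding V_def
    by (auto simp: ver_pull_pscale[symmetric] intro!: imageI forms_pscale Z_pscale)
qed

lemma V_mult:
  assumes f: "f \<in> V k" and g: "g \<in> forms {..m} (l * d)"
  shows "g * f \<in> V (l + k)"
proof -
  obtain F where F: "F \<in> forms (ver_coords m d) k" "F \<in> Z" "f = ver_pull F"
    using f by (auto simp: V_def)
  obtain G where G: "G \<in> forms (ver_coords m d) l" "ver_pull G = g" by (rule ver_pull_surj[OF g])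
  have "G * F \<in> Z" by (rule Z_mult[OF F(2) subsetD[OF forms_subset_polys G(1)]])
  then show ?thesis
    using forms_mult[OF G(1) F(1)] F(3) G(2) unfolding V_def
    by (intro image_eqI[of _ _ "G * F"]) (simp_all add: ver_pull_mult)
qed

lemma V_saturated:
  assumes f: "f \<in> forms {..m} (k * d)" and mult: "\<And>g. g \<in> forms {..m} d \<Longrightarrow> g * f \<in> V (Suc k)"
  shows "f \<in> V k"
proof -
  obtain F where F: "F \<in> forms (ver_coords m d) k" "ver_pull F = f" by (rule ver_pull_surj[OF f])
  have "F \<in> Z"
  proof (rule Z_saturated[of F 1, OF subsetD[OF forms_subset_polys F(1)]])
    fix a assume a: "a \<in> monoms (ver_coords m d) 1"
    let ?y = "Poly_Mapping.single a 1 :: (nat \<Rightarrow>\<^sub>0 nat, 'k) mpol"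
    have y: "?y \<in> forms (ver_coords m d) 1" by (rule single_in_forms[OF a])
    have "ver_pull ?y \<in> forms {..m} d" using ver_pull_forms[OF y] by simp
    then have "ver_pull (?y * F) \<in> V (Suc k)" using mult F(2) by (simp add: ver_pull_mult)
    moreover have "?y * F \<in> forms (ver_coords m d) (Suc k)" using forms_mult[OF y F(1)] by simp
    ultimately show "?y * F \<in> Z" using ver_pull_in_V_iff by blast
  qed
  then show ?thesis using F by (auto simp: V_def)
qed

text \<open>Membership can be tested at a single \<open>k\<close>: larger values follow by
  multiplying with forms of degree \<open>d\<close>, smaller ones by saturation of
  \<open>V\<close>.\<close>

lemma W_I:
  assumes f: "f \<in> forms {..m} j" and jk: "j \<le> k * d"
    and mult: "\<And>g. g \<in> forms {..m} (k * d - j) \<Longrightarrow> g * f \<in> V k"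
  shows "f \<in> W j"
proof -
  have up: "\<forall>g\<in>forms {..m} (Suc i * d - j). g * f \<in> V (Suc i)"
    if i: "j \<le> i * d" "\<forall>g\<in>forms {..m} (i * d - j). g * f \<in> V i" for i
  proof -
    have eq: "Suc i * d - j = d + (i * d - j)" using i(1) by simp
    have "forms {..m} (d + (i * d - j)) \<subseteq> {g. g * f \<in> V (Suc i)}"
    proof (rule forms_add_subset[OF subspace_mult_preimage[OF subspace_V]])
      fix g h :: "(nat, 'k) mpol"
      assume "g \<in> forms {..m} d" "h \<in> forms {..m} (i * d - j)"
      then show "g * h \<in> {g. g * f \<in> V (Suc i)}"
        using V_mult[of "h * f" i g 1] i(2) by (simp add: mult.assoc)
    qed
    then show ?thesis unfolding eq by blast
  qed
  have down: "\<forall>g\<in>forms {..m} (i * d - j). g * f \<in> V i"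
    if i: "j \<le> i * d" "\<forall>g\<in>forms {..m} (Suc i * d - j). g * f \<in> V (Suc i)" for i
  proof
    fix g :: "(nat, 'k) mpol" assume g: "g \<in> forms {..m} (i * d - j)"
    show "g * f \<in> V i"
    proof (rule V_saturated)
      show "g * f \<in> forms {..m} (i * d)" using forms_mult[OF g f] i(1) by simp
      fix h :: "(nat, 'k) mpol" assume h: "h \<in> forms {..m} d"
      have eq: "d + (i * d - j) = Suc i * d - j" using i(1) by simp
      have "h * g \<in> forms {..m} (Suc i * d - j)" using forms_mult[OF h g] unfolding eq .
      then show "h * (g * f) \<in> V (Suc i)" using i(2) by (simp add: mult.assoc[symmetric])
    qed
  qed
  let ?Q = "\<lambda>i. \<forall>g\<in>forms {..m} (i * d - j). g * f \<in> V i"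
  have Qk: "?Q k" using mult by blast
  have "?Q i" if i: "j \<le> i * d" for i
  proof (cases "k \<le> i")
    case True
    then show ?thesis
    proof (induction i rule: dec_induct)
      case (step n)
      then have "j \<le> n * d" using jk by (meson le_trans mult_le_mono1)
      with step up show ?case by blast
    qed (rule Qk)
  next
    case False
    then have "i \<le> k" by simp
    then show ?thesis
    proof (induction i rule: inc_induct)
      case (step n)
      then have "j \<le> n * d" using i by (meson le_trans mult_le_mono1)
      with step down show ?case by blast
    qed (rule Qk)
  qed
  with f show ?thesis by (simp add: W_def)
qed

lemma W_D: "f \<in> W j \<Longrightarrow> j \<le> k * d \<Longrightarrow> g \<in> forms {..m} (k * d - j) \<Longrightarrow> g * f \<in> V k"
  by (simp add: W_def)

lemma W_mult_d: "W (k * d) = V k"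
proof (rule subset_antisym; rule subsetI)
  fix f assume "f \<in> W (k * d)"
  then have "1 * f \<in> V k" unfolding W_def using one_in_forms by (metis (mono_tags, lifting)
        diff_self_eq_0 le_refl mem_Collect_eq)
  then show "f \<in> V k" by simp
next
  fix f assume f: "f \<in> V k"
  show "f \<in> W (k * d)"
    by (rule W_I[of _ _ k]) (use f V_forms V_mult[OF f, of _ 0] in auto)
qed

sublocale saturated_family m W
proof
  fix j
  \<comment> \<open>\<open>Suc j\<close> is the value of \<open>k\<close> at which membership in
    \<open>W j\<close> and \<open>W (Suc j)\<close> is tested.\<close>
  have le: "Suc j \<le> Suc j * d" using mult_le_mono2[of 1 d "Suc j"] d_pos by simp
  show "pvec.subspace (W j)"
    unfolding pvec.subspace_def W_def
    by (auto simp: pvec.subspace_0[OF subspace_V] pvec.subspace_add[OF subspace_V]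
        pvec.subspace_scale[OF subspace_V] forms_add forms_pscale distrib_left pscale_mult_right)
  show "W j \<subseteq> forms {..m} j" by (auto simp: W_def)
  show "var i * f \<in> W (Suc j)" if f: "f \<in> W j" and i: "i \<le> m" for f i
  proof (rule W_I[OF _ le])
    have i': "(var i :: (nat, 'k) mpol) \<in> forms {..m} 1" using i by (intro var_in_forms) simp
    show "var i * f \<in> forms {..m} (Suc j)" using forms_mult[OF i', of f j] f by (simp add: W_def)
    fix g :: "(nat, 'k) mpol" assume "g \<in> forms {..m} (Suc j * d - Suc j)"
    then have "g * var i \<in> forms {..m} (Suc j * d - Suc j + 1)" by (rule forms_mult[OF _ i'])
    also have "Suc j * d - Suc j + 1 = Suc j * d - j" using le by linarith
    finally have "g * var i * f \<in> V (Suc j)" by (rule W_D[OF f, rotated]) (use le in linarith)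
    then show "g * (var i * f) \<in> V (Suc j)" by (simp add: mult.assoc)
  qed
  show "f \<in> W j" if f: "f \<in> forms {..m} j" and mult: "\<And>i. i \<le> m \<Longrightarrow> var i * f \<in> W (Suc j)" for f
  proof (rule W_I[OF f])
    show "j \<le> Suc j * d" using le by linarith
    have eq: "Suc j * d - j = 1 + (Suc j * d - Suc j)" using le by linarith
    have "forms {..m} (1 + (Suc j * d - Suc j)) \<subseteq> {g. g * f \<in> V (Suc j)}"
    proof (rule forms_add_subset[OF subspace_mult_preimage[OF subspace_V]])
      fix l h :: "(nat, 'k) mpol"
      assume l: "l \<in> forms {..m} 1" and h: "h \<in> forms {..m} (Suc j * d - Suc j)"
      have "l * (h * f) \<in> V (Suc j)"
      proof (rule forms_mult_subset[OF subspace_V _ l])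
        fix i assume "i \<in> {..m}"
        then have "h * (var i * f) \<in> V (Suc j)" using W_D[OF mult le h] by simp
        then show "var i * (h * f) \<in> V (Suc j)" by (simp add: mult_ac)
      qed
      then show "l * h \<in> {g. g * f \<in> V (Suc j)}" by (simp add: mult.assoc)
    qed
    then show "g * f \<in> V (Suc j)" if "g \<in> forms {..m} (Suc j * d - j)" for g
      using that unfolding eq by blast
  qed
qed

text \<open>In degrees divisible by \<open>d\<close> the family \<open>W\<close> is the image of
  \<open>Z\<close>, so preimages of the witnesses under \<open>ver_pull\<close> are independent
  modulo \<open>Z\<close>.\<close>

lemma has_codim_ge_le_hilbert_fun:
  assumes "has_codim_ge N (k * d)"
  shows "N \<le> hilbert_fun (ver_coords m d) Z k"
proof -
  obtain f where f: "\<And>i. i < N \<Longrightarrow> f i \<in> forms {..m} (k * d)" "indep_mod (V k) {..<N} f"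
    using assms by (auto simp: has_codim_ge_def W_mult_d)
  have "\<forall>i. \<exists>F. i < N \<longrightarrow> F \<in> forms (ver_coords m d) k \<and> ver_pull F = f i"
    using f(1) ver_pull_surj by metis
  then obtain F where F: "\<And>i. i < N \<Longrightarrow> F i \<in> forms (ver_coords m d) k \<and> ver_pull (F i) = f i"
    by metis
  have "indep_mod (forms (ver_coords m d) k \<inter> Z) {..<N} F"
    unfolding indep_mod_def
  proof (intro allI impI)
    fix c assume "(\<Sum>i<N. pscale (c i) (F i)) \<in> forms (ver_coords m d) k \<inter> Z"
    then have "ver_pull (\<Sum>i<N. pscale (c i) (F i)) \<in> V k" by (auto simp: V_def)
    then have "(\<Sum>i<N. pscale (c i) (f i)) \<in> V k" using F by (simp add: ver_pull_sum ver_pull_pscale)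
    then show "\<forall>i\<in>{..<N}. c i = 0" using f(2) by (simp add: indep_mod_def)
  qed
  then show ?thesis
    using indep_mod_card_le[OF finite_J pvec.subspace_inter[OF subspace_forms subspace_Z]
        Int_lower1 finite_lessThan, of N F] F by (simp add: hilbert_fun_def)
qed

end

lemma scheme_degree_eq:
  assumes "\<forall>\<^sub>F t in sequentially. hilbert_fun J Z t = n"
  shows "scheme_degree J Z = n"
  unfolding scheme_degree_def
proof (rule the_equality[where P = "\<lambda>n. \<forall>\<^sub>F t in sequentially. hilbert_fun J Z t = n", OF assms])
  fix n' assume "\<forall>\<^sub>F t in sequentially. hilbert_fun J Z t = n'"
  with assms have "\<forall>\<^sub>F t in sequentially. n' = n" by eventually_elim simp
  then show "n' = n" by simp
qed

text \<open>Monotonicity carries the bound from degree \<open>j\<close> to a multiple of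
  \<open>d\<close> at which the Hilbert function of \<open>Z\<close> is already constant.\<close>

lemma (in veronese_subscheme) has_codim_ge_le_degree:
  assumes "zero_dimensional (ver_coords m d) Z" "has_codim_ge N j"
  shows "N \<le> scheme_degree (ver_coords m d) Z"
proof -
  obtain n where n: "\<forall>\<^sub>F t in sequentially. hilbert_fun (ver_coords m d) Z t = n"
    using assms(1) by (auto simp: zero_dimensional_def)
  then obtain k0 where k0: "\<And>t. t \<ge> k0 \<Longrightarrow> hilbert_fun (ver_coords m d) Z t = n"
    by (auto simp: eventually_sequentially)
  have "j \<le> j * d" using d_pos by simp
  also have "\<dots> \<le> max j k0 * d" by simp
  finally have "N \<le> hilbert_fun (ver_coords m d) Z (max j k0)"
    by (intro has_codim_ge_le_hilbert_fun has_codim_ge_mono[OF _ assms(2)])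
  then show ?thesis using k0[of "max j k0"] scheme_degree_eq[OF n] by simp
qed

section \<open>Finite sets of points on Veronese varieties\<close>

lemma closed_subscheme_vanishing_ideal:
  fixes S :: "('i \<Rightarrow> 'k::field_char_0) set set"
  assumes S: "S \<subseteq> proj_space J"
  shows "closed_subscheme J (vanishing_ideal J S)"
  unfolding closed_subscheme_def
proof (intro conjI ballI allI impI)
  show "vanishing_ideal J S \<subseteq> polys J" by (auto simp: vanishing_ideal_def)
  show "0 \<in> vanishing_ideal J S" by (simp add: vanishing_ideal_def vanishes_at_def polys_def)
next
  fix f g :: "('i, 'k) mpol" assume "f \<in> vanishing_ideal J S" "g \<in> vanishing_ideal J S"
  then show "f + g \<in> vanishing_ideal J S"
    by (simp add: vanishing_ideal_def vanishes_at_def polys_add)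
next
  fix f g :: "('i, 'k) mpol" assume "f \<in> vanishing_ideal J S" "g \<in> polys J"
  then show "g * f \<in> vanishing_ideal J S"
    by (simp add: vanishing_ideal_def vanishes_at_def polys_mult)
next
  fix f :: "('i, 'k) mpol" and t assume f: "f \<in> vanishing_ideal J S"
  then have fJ: "f \<in> polys J" by (simp add: vanishing_ideal_def)
  have "mp_eval (hom_part t f) x = 0" if x: "p \<in> S" "x \<in> p" for p x
  proof (rule hom_part_vanishes[OF fJ])
    fix c :: 'k assume "c \<noteq> 0"
    then have "fscale c x \<in> p" using proj_spaceE(3)[of p J x] x S by auto
    then show "mp_eval f (fscale c x) = 0"
      using f x(1) by (auto simp: vanishing_ideal_def vanishes_at_def)
  qed
  then show "hom_part t f \<in> vanishing_ideal J S"
    using subsetD[OF forms_subset_polys hom_part_in_forms[OF fJ]]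
    by (simp add: vanishing_ideal_def vanishes_at_def)
next
  fix f :: "('i, 'k) mpol"
  assume fJ: "f \<in> polys J" and "\<exists>k. \<forall>a\<in>monoms J k. Poly_Mapping.single a 1 * f \<in> vanishing_ideal J S"
  then obtain k where k: "\<And>a. a \<in> monoms J k \<Longrightarrow> Poly_Mapping.single a 1 * f \<in> vanishing_ideal J S"
    by blast
  have "mp_eval f x = 0" if x: "p \<in> S" "x \<in> p" for p x
  proof -
    have "x \<in> vecs J" "x \<noteq> 0" using proj_spaceE[of p J x] x S by auto
    then obtain i where i: "x i \<noteq> 0" "i \<in> J" by (auto simp: fun_eq_iff vecs_def)
    have "mp_eval (Poly_Mapping.single (Poly_Mapping.single i k) 1 * f) x = 0"
      using k[OF single_in_monoms[OF i(2)]] x by (auto simp: vanishing_ideal_def vanishes_at_def)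
    then show ?thesis using i(1) by (simp add: mp_eval_single)
  qed
  then show "f \<in> vanishing_ideal J S"
    using fJ by (simp add: vanishing_ideal_def vanishes_at_def)
qed

lemma proj_space_class:
  assumes "p \<in> proj_space J" "x \<in> p"
  shows "p = proj_rel J `` {x}"
proof -
  obtain z where z: "p = proj_rel J `` {z}"
    using assms(1) by (auto simp: proj_space_def elim: quotientE)
  then have "(z, x) \<in> proj_rel J" using assms(2) by simp
  then show ?thesis using equiv_class_eq[OF equiv_proj_rel] z by metis
qed

lemma span_pts_subset:
  assumes "S \<subseteq> proj_space J"
  shows "span_pts J S \<subseteq> proj_space J"
proof -
  have "S \<subseteq> proj_of J (vecs J)"
    using assms proj_spaceE(1) by (fastforce simp: proj_of_def)
  then have "vanishing_ideal J (proj_of J (vecs J)) \<subseteq> vanishing_ideal J S"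
    by (auto simp: vanishing_ideal_def)
  then have "span_pts J S \<subseteq> proj_of J (vecs J)"
    using linear_subspace_proj_of[OF subspace_vecs subset_refl] by (auto simp: scheme_span_def)
  then show ?thesis by (auto simp: proj_of_def)
qed

lemma veronese_point:
  assumes "p \<in> proj_space {..m}" "x \<in> p"
  shows "veronese m d p \<in> proj_space (ver_coords m d)" "ver_vec m d x \<in> veronese m d p"
proof -
  have x: "x \<in> vecs {..m} - {0}" using proj_spaceE[OF assms] by auto
  have "veronese m d p = proj_rel (ver_coords m d) `` {ver_vec m d x}"
    using veronese_class[OF x] proj_space_class[OF assms] by simp
  then show "veronese m d p \<in> proj_space (ver_coords m d)" "ver_vec m d x \<in> veronese m d p"
    using point_class ver_vec_nonzero[OF x, of d] by auto
qed

lemma veronese_variety_subset: "veronese_variety m d \<subseteq> proj_space (ver_coords m d)"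
proof
  fix q :: "((nat \<Rightarrow>\<^sub>0 nat) \<Rightarrow> 'k::field) set" assume "q \<in> veronese_variety m d"
  then obtain p where p: "p \<in> proj_space {..m}" "q = veronese m d p"
    by (auto simp: veronese_variety_def)
  obtain x where "x \<in> p" using proj_space_nonempty[OF p(1)] .
  then show "q \<in> proj_space (ver_coords m d)" using veronese_point(1)[OF p(1)] p(2) by simp
qed

text \<open>Indexed by \<open>K\<close> and not by the image, so that points may repeat, as they may
  in the definition of secant varieties.\<close>

lemma span_image_finite:
  fixes f :: "'x \<Rightarrow> 'i \<Rightarrow> 'k::field"
  assumes "finite K" "x \<in> fvec.span (f ` K)"
  obtains a where "x = (\<Sum>k\<in>K. fscale (a k) (f k))"
proof -
  let ?V = "{x. \<exists>a. x = (\<Sum>k\<in>K. fscale (a k) (f k))}"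
  have "fvec.subspace ?V"
    unfolding fvec.subspace_def
  proof (intro conjI ballI allI)
    show "0 \<in> ?V" by (auto intro!: exI[of _ "\<lambda>_. 0"])
  next
    fix x y assume "x \<in> ?V" "y \<in> ?V"
    then obtain a b where "x = (\<Sum>k\<in>K. fscale (a k) (f k))" "y = (\<Sum>k\<in>K. fscale (b k) (f k))"
      by blast
    then have "x + y = (\<Sum>k\<in>K. fscale (a k + b k) (f k))"
      by (simp add: fvec.scale_left_distrib sum.distrib)
    then show "x + y \<in> ?V" by auto
  next
    fix c x assume "x \<in> ?V"
    then obtain a where "x = (\<Sum>k\<in>K. fscale (a k) (f k))" by blast
    then have "fscale c x = (\<Sum>k\<in>K. fscale (c * a k) (f k))"
      by (simp add: fvec.scale_sum_right)
    then show "fscale c x \<in> ?V" by (auto intro!: exI[of _ "\<lambda>k. c * a k"])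
  qed
  moreover have "f ` K \<subseteq> ?V"
  proof safe
    fix k assume k: "k \<in> K"
    have "f k = (\<Sum>j\<in>K. fscale (if j = k then 1 else 0) (f j))"
    proof -
      have "(\<Sum>j\<in>K. fscale (if j = k then 1 else 0) (f j)) = (\<Sum>j\<in>K. if j = k then f j else 0)"
        by (rule sum.cong) auto
      then show ?thesis using k assms(1) by simp
    qed
    then show "\<exists>a. f k = (\<Sum>j\<in>K. fscale (a j) (f j))"
      by (rule exI[of _ "\<lambda>j. if j = k then 1 else 0"])
  qed
  ultimately have "fvec.span (f ` K) \<subseteq> ?V" by (intro fvec.span_minimal)
  then show ?thesis using assms(2) that by blast
qed

lemma mp_eval_linear_sum:
  assumes l: "l \<in> forms J 1"
  shows "mp_eval l (\<Sum>k\<in>K. fscale (a k) (f k)) = (\<Sum>k\<in>K. a k * mp_eval l (f k))"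
proof -
  have "mp_eval l 0 = 0" using mp_eval_linear(2)[OF l, of 0 0] by simp
  then show ?thesis
    by (induction K rule: infinite_finite_induct) (simp_all add: mp_eval_linear[OF l])
qed

section \<open>The points of \<open>B\<close>, the coefficients of \<open>P\<close> and uniqueness
  of the scheme\<close>

locale minimal_decomposition =
  fixes m d :: nat
    and B :: "(nat \<Rightarrow> 'k::field_char_0) set set"
    and P :: "((nat \<Rightarrow>\<^sub>0 nat) \<Rightarrow> 'k) set"
  assumes d_ge: "d \<ge> 5"
    and finite_B: "finite B" and B_points: "B \<subseteq> proj_space {..m}" and card_B: "card B \<le> d"
    and not_collinear: "\<And>A. A \<subseteq> B \<Longrightarrow> card A = (d + 1) div 2 \<Longrightarrow> \<not> collinear_pts {..m} A"
    and P_span: "P \<in> span_pts (ver_coords m d) (veronese m d ` B)"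
    and P_minimal: "\<And>E. E \<subset> veronese m d ` B \<Longrightarrow> P \<notin> span_pts (ver_coords m d) E"
begin

abbreviation "J \<equiv> ver_coords m d"
abbreviation "\<nu> \<equiv> ver_vec m d :: (nat \<Rightarrow> 'k) \<Rightarrow> _"

definition s :: nat where "s = (d + 1) div 2"
definition t :: nat where "t = d div 2"

lemma st: "t + s = d" "t \<le> s" "s \<le> t + 1" "3 \<le> s"
  using d_ge by (auto simp: s_def t_def)

definition rep :: "(nat \<Rightarrow> 'k) set \<Rightarrow> nat \<Rightarrow> 'k" where "rep b = (SOME x. x \<in> b)"

definition R :: "(nat \<Rightarrow> 'k) set" where "R = rep ` B"

lemma finite_J: "finite J"
  by (simp add: finite_monoms)

lemma rep: "b \<in> B \<Longrightarrow> rep b \<in> b"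
  unfolding rep_def using B_points proj_space_nonempty[of b "{..m}"] by (metis someI subsetD)

lemma rep_class: "b \<in> B \<Longrightarrow> b = proj_rel {..m} `` {rep b}"
  using proj_space_class[OF _ rep] B_points by blast

lemma inj_rep: "inj_on rep B"
  by (rule inj_onI) (metis rep_class)

lemma rep_vecs: "b \<in> B \<Longrightarrow> rep b \<in> vecs {..m} - {0}"
  using proj_spaceE(1,2)[OF _ rep] B_points by blast

lemma card_R_eq: "card R = card B"
  unfolding R_def by (rule card_image[OF inj_rep])

lemma rep_not_in_span:
  assumes "b \<in> B" "c \<in> B" "b \<noteq> c"
  shows "rep b \<notin> fvec.span {rep c}"
proof
  assume "rep b \<in> fvec.span {rep c}"
  then obtain k where k: "rep b = fscale k (rep c)" by (auto simp: fvec.span_singleton)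
  have "k \<noteq> 0" using k rep_vecs[OF assms(1)] by auto
  then have "rep b \<in> c"
    using proj_spaceE(3)[OF _ rep[OF assms(2)]] assms(2) B_points k by blast
  then have "c = proj_rel {..m} `` {rep b}" using proj_space_class assms(2) B_points by blast
  then show False using rep_class[OF assms(1)] assms(3) by simp
qed

sublocale points: scattered_points m s R
proof
  show "finite R" using finite_B by (simp add: R_def)
  show "R \<subseteq> vecs {..m}" "0 \<notin> R" using rep_vecs by (auto simp: R_def)
  show distinct: "x \<notin> fvec.span {y}" if "x \<in> R" "y \<in> R" "x \<noteq> y" for x y
    using that rep_not_in_span by (auto simp: R_def)
  show "card R \<le> 2 * s" using card_R_eq card_B by (simp add: s_def)
  show "card {c \<in> R - {b}. fvec.span {b, c} = V} + 2 \<le> s" if b: "b \<in> R" for b V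
  proof (rule ccontr)
    define N where "N = {c \<in> R - {b}. fvec.span {b, c} = V}"
    assume "\<not> card {c \<in> R - {b}. fvec.span {b, c} = V} + 2 \<le> s"
    then have N: "s \<le> card N + 1" by (simp add: N_def)
    have fin: "finite N" using \<open>finite R\<close> by (simp add: N_def)
    have "N \<noteq> {}" using N st(4) by auto
    then obtain c where c: "c \<in> R" "c \<noteq> b" "V = fvec.span {b, c}" by (auto simp: N_def)
    have "card (insert b N) = card N + 1" using fin by (simp add: N_def)
    \<comment> \<open>The collinearity hypothesis speaks of exactly \<open>s\<close> points, so the
      points found on the line are trimmed to that number.\<close>
    then obtain A where A: "A \<subseteq> insert b N" "card A = s" using N by (metis obtain_subset_with_card_n)
    have "V \<subseteq> vecs {..m}"
      unfolding c(3) by (rule fvec.span_minimal[OF _ subspace_vecs])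
        (use b c(1) \<open>R \<subseteq> vecs {..m}\<close> in auto)
    then have V: "fvec.subspace V" "V \<subseteq> vecs {..m}" using c(3) by simp_all
    have "b \<notin> fvec.span {c}" "c \<noteq> 0" using distinct b c \<open>0 \<notin> R\<close> by auto
    then have "fvec.independent {b, c}" using c(2) by (simp add: fvec.independent_insert)
    then have dim: "fvec.dim V = 2" using c(2,3) fvec.dim_span_eq_card_independent[of "{b, c}"] by simp
    have AR: "A \<subseteq> R" using A(1) b by (auto simp: N_def)
    have AV: "A \<subseteq> V"
    proof
      fix x assume "x \<in> A"
      then consider "x = b" | "x \<in> N" using A(1) by blast
      then show "x \<in> V"
      proof cases
        case 1
        then show ?thesis using c(3) by (simp add: fvec.span_base)
      next
        case 2
        then have "V = fvec.span {b, x}" by (simp add: N_def)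
        then show ?thesis by (simp add: fvec.span_base)
      qed
    qed
    define A' where "A' = {q \<in> B. rep q \<in> A}"
    have "rep ` A' = A" using AR by (auto simp: A'_def R_def)
    moreover have "inj_on rep A'" using inj_rep by (rule inj_on_subset) (auto simp: A'_def)
    ultimately have "card A' = s" using A(2) card_image by metis
    moreover have "A' \<subseteq> proj_of {..m} V"
    proof
      fix q assume q: "q \<in> A'"
      then have q': "q \<in> proj_space {..m}" "rep q \<in> q" "rep q \<in> V"
        using B_points rep AV by (auto simp: A'_def)
      then show "q \<in> proj_of {..m} V"
        using point_subset_iff[OF q'(1,2) V(1)] by (simp add: proj_of_def)
    qed
    ultimately show False
      using not_collinear[of A'] V dim unfolding collinear_pts_def s_def by (auto simp: A'_def)
  qed
qed

lemma separators:
  assumes "t \<le> k"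
  obtains e where "\<forall>b\<in>R. e b \<in> forms {..m} k" "\<forall>b\<in>R. \<forall>c\<in>R. mp_eval (e b) c = (if b = c then 1 else 0)"
proof -
  have "\<forall>b\<in>R. \<exists>e\<in>forms {..m} k. \<forall>c\<in>R. mp_eval e c = (if b = c then 1 else 0)"
  proof
    fix b assume b: "b \<in> R"
    have "card R \<le> 2 * k + 1" "s \<le> k + 2"
      using card_R_eq card_B st assms by auto
    then obtain e where "e \<in> forms {..m} k" "\<forall>c\<in>R. mp_eval e c = (if c = b then 1 else 0)"
      by (rule points.separating_form[OF b])
    then show "\<exists>e\<in>forms {..m} k. \<forall>c\<in>R. mp_eval e c = (if b = c then 1 else 0)"
      by (intro bexI[of _ e]) auto
  qed
  then show ?thesis using that by metis
qed

lemma ver_separators: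
  assumes "k \<ge> 1"
  obtains e where "\<forall>b\<in>R. e b \<in> forms J k" "\<forall>b\<in>R. \<forall>c\<in>R. mp_eval (e b) (\<nu> c) = (if b = c then 1 else 0)"
proof -
  have "t \<le> k * d" using assms st by (metis le_add1 mult_le_mono1 mult_1 le_trans)
  then obtain e where e: "\<forall>b\<in>R. e b \<in> forms {..m} (k * d)"
    "\<forall>b\<in>R. \<forall>c\<in>R. mp_eval (e b) c = (if b = c then 1 else 0)" by (rule separators)
  have "\<forall>b\<in>R. \<exists>f\<in>forms J k. \<forall>c\<in>R. mp_eval f (\<nu> c) = (if b = c then 1 else 0)"
  proof
    fix b assume b: "b \<in> R"
    then have "e b \<in> forms {..m} (k * d)" using e by blast
    then obtain f where f: "f \<in> forms J k" "ver_pull f = e b" by (rule ver_pull_surj)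
    have "mp_eval f (\<nu> c) = mp_eval (e b) c" for c
      using mp_eval_ver_pull[OF subsetD[OF forms_subset_polys f(1)], of c] f(2) by simp
    then show "\<exists>f\<in>forms J k. \<forall>c\<in>R. mp_eval f (\<nu> c) = (if b = c then 1 else 0)"
      using f(1) e(2) b by (intro bexI[of _ f]) auto
  qed
  then show ?thesis using that by metis
qed

lemma ver_rep: "b \<in> B \<Longrightarrow> veronese m d b \<in> proj_space J" "b \<in> B \<Longrightarrow> \<nu> (rep b) \<in> veronese m d b"
  using veronese_point[OF _ rep] B_points by blast+

lemma inj_veronese: "inj_on (veronese m d) B"
proof (rule inj_onI, rule ccontr)
  fix b c assume bc: "b \<in> B" "c \<in> B" "veronese m d b = veronese m d c" "b \<noteq> c"
  obtain e where e: "\<forall>b\<in>R. e b \<in> forms J 1"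
    "\<forall>b\<in>R. \<forall>c\<in>R. mp_eval (e b) (\<nu> c) = (if b = c then 1 else 0)"
    by (rule ver_separators[of 1]) simp_all
  have R: "rep b \<in> R" "rep c \<in> R" using bc by (auto simp: R_def)
  have "rep b \<noteq> rep c" using bc inj_rep by (auto simp: inj_on_def)
  then have "mp_eval (e (rep b)) (\<nu> (rep c)) = 0" "mp_eval (e (rep b)) (\<nu> (rep b)) = 1"
    using e(2) R by simp_all
  moreover have "e (rep b) \<in> forms J 1" using e(1) R by blast
  ultimately show False
    using vanishes_at_form_iff[OF ver_rep(1) ver_rep(2)] bc by (metis zero_neq_one)
qed

lemma veronese_B_subset: "veronese m d ` B \<subseteq> veronese_variety m d"
  using B_points by (auto simp: veronese_variety_def)

lemma P_point: "P \<in> proj_space J"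
  using span_pts_subset[OF order_trans[OF veronese_B_subset veronese_variety_subset]] P_span by blast

text \<open>Representatives of the image points compatible with \<open>rep\<close>, so that spans of
  image points become spans of vectors \<open>\<nu> c\<close> with \<open>c\<close> in
  \<open>R\<close>.\<close>

definition vrep :: "((nat \<Rightarrow>\<^sub>0 nat) \<Rightarrow> 'k) set \<Rightarrow> (nat \<Rightarrow>\<^sub>0 nat) \<Rightarrow> 'k" where
  "vrep q = \<nu> (rep (inv_into B (veronese m d) q))"

lemma vrep_veronese: "b \<in> B \<Longrightarrow> vrep (veronese m d b) = \<nu> (rep b)"
  by (simp add: vrep_def inv_into_f_f[OF inj_veronese])

lemma vrep: "q \<in> veronese m d ` B \<Longrightarrow> vrep q \<in> q"
  using vrep_veronese ver_rep(2) by auto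

text \<open>A zero coefficient would put \<open>P\<close> into the span of the images of the
  remaining points, against minimality.\<close>

lemma P_coefficients:
  obtains p a where "p \<in> P" "p = (\<Sum>c\<in>R. fscale (a c) (\<nu> c))" "\<forall>c\<in>R. a c \<noteq> 0"
proof -
  obtain p where p: "p \<in> P" using proj_space_nonempty[OF P_point] .
  have sub: "veronese m d ` B \<subseteq> proj_space J"
    using veronese_B_subset veronese_variety_subset by (rule order_trans)
  have im: "vrep ` veronese m d ` E = \<nu> ` rep ` E" if "E \<subseteq> B" for E
    using that vrep_veronese by (force simp: image_image)
  have "p \<in> fvec.span (\<nu> ` R)"
    using in_span_ptsD[OF sub vrep P_span p] im[of B] by (simp add: R_def)
  then obtain a where a: "p = (\<Sum>c\<in>R. fscale (a c) (\<nu> c))"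
    by (rule span_image_finite[OF points.finite_R])
  have "a c \<noteq> 0" if c: "c \<in> R" for c
  proof
    assume "a c = 0"
    obtain b where b: "b \<in> B" "c = rep b" using c by (auto simp: R_def)
    let ?E = "B - {b}"
    have "R - {c} = rep ` ?E" using b inj_rep by (auto simp: R_def inj_on_def)
    have "p = (\<Sum>c\<in>R - {c}. fscale (a c) (\<nu> c))"
      using a \<open>a c = 0\<close> c points.finite_R by (simp add: sum.remove[of R c])
    also have "\<dots> \<in> fvec.span (\<nu> ` (R - {c}))"
      by (intro fvec.span_sum fvec.span_scale) (rule fvec.span_base, rule imageI)
    finally have "p \<in> fvec.span (vrep ` veronese m d ` ?E)"
      unfolding im[OF Diff_subset] \<open>R - {c} = rep ` ?E\<close> .
    then have "P \<in> span_pts J (veronese m d ` ?E)"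
      using sub by (intro in_span_ptsI[OF finite_J _ _ P_point p, where r = vrep] vrep) auto
    moreover have "veronese m d ` ?E \<subset> veronese m d ` B"
      using inj_on_image_eq_iff[OF inj_veronese, of ?E B] b(1) by blast
    ultimately show False using P_minimal[of "veronese m d ` ?E"] by simp
  qed
  then show ?thesis using that p a by blast
qed

lemma R_nonempty: "R \<noteq> {}"
proof
  assume "R = {}"
  obtain p a where "p \<in> P" "p = (\<Sum>c\<in>R. fscale (a c) (\<nu> c))" "\<forall>c\<in>R. a c \<noteq> 0"
    by (rule P_coefficients)
  then have "0 \<in> P" using \<open>R = {}\<close> by simp
  then show False using proj_spaceE(2)[OF P_point] by blast
qed

text \<open>Exhibits \<open>p\<close> as the functional on forms of degree \<open>d\<close> that
  combines the evaluations at \<open>R\<close> with weights \<open>a c\<close>.\<close>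

lemma mp_eval_at_P:
  assumes "l \<in> forms J 1" "p = (\<Sum>c\<in>R. fscale (a c) (\<nu> c))"
  shows "mp_eval l p = (\<Sum>c\<in>R. a c * mp_eval (ver_pull l) c)"
  using mp_eval_linear_sum[OF assms(1)] assms(2)
    mp_eval_ver_pull[OF subsetD[OF forms_subset_polys assms(1)]] by simp

lemma vanishing_ideal_B_iff:
  assumes f: "f \<in> forms J k"
  shows "f \<in> vanishing_ideal J (veronese m d ` B) \<longleftrightarrow> (\<forall>c\<in>R. mp_eval f (\<nu> c) = 0)"
proof -
  have "vanishes_at f (veronese m d b) \<longleftrightarrow> mp_eval f (\<nu> (rep b)) = 0" if "b \<in> B" for b
    by (rule vanishes_at_form_iff[OF ver_rep[OF that] f])
  then show ?thesis
    using subsetD[OF forms_subset_polys f] by (auto simp: vanishing_ideal_def R_def)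
qed

lemma hilbert_fun_B:
  assumes "k \<ge> 1"
  shows "hilbert_fun J (vanishing_ideal J (veronese m d ` B)) k = card B"
proof -
  obtain e where e: "\<forall>b\<in>R. e b \<in> forms J k"
    "\<forall>b\<in>R. \<forall>c\<in>R. mp_eval (e b) (\<nu> c) = (if b = c then 1 else 0)"
    by (rule ver_separators[OF assms])
  have V: "forms J k \<inter> vanishing_ideal J (veronese m d ` B) =
      {f \<in> forms J k. \<forall>c\<in>R. mp_eval f (\<nu> c) = 0}"
    using vanishing_ideal_B_iff by blast
  show ?thesis
    unfolding hilbert_fun_def card_R_eq[symmetric]
    by (rule codim_vanishing[OF finite_J points.finite_R V]) (use e in auto)
qed

lemma scheme_B:
  defines "I \<equiv> vanishing_ideal J (veronese m d ` B)"
  shows "closed_subscheme J I" "zero_dimensional J I"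
    "vanishing_ideal J (veronese_variety m d) \<subseteq> I" "scheme_degree J I \<le> card B"
proof -
  show "closed_subscheme J I"
    unfolding I_def
    by (rule closed_subscheme_vanishing_ideal[OF order_trans[OF veronese_B_subset veronese_variety_subset]])
  have ev: "\<forall>\<^sub>F k in sequentially. hilbert_fun J I k = card B"
    using eventually_ge_at_top[of 1] by eventually_elim (simp add: hilbert_fun_B I_def)
  moreover have "card B > 0"
    using R_nonempty finite_B by (auto simp: R_def card_gt_0_iff)
  ultimately show "zero_dimensional J I" by (auto simp: zero_dimensional_def)
  show "scheme_degree J I \<le> card B" using scheme_degree_eq[OF ev] by simp
  show "vanishing_ideal J (veronese_variety m d) \<subseteq> I"
    using veronese_B_subset by (auto simp: vanishing_ideal_def I_def)
qed

lemma scheme_unique: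
  assumes Z: "closed_subscheme J Z" "zero_dimensional J Z"
    "vanishing_ideal J (veronese_variety m d) \<subseteq> Z" "scheme_degree J Z \<le> card B"
    and P_Z: "P \<in> scheme_span J Z"
  shows "Z = vanishing_ideal J (veronese m d ` B)"
proof -
  interpret Z: veronese_subscheme m d Z
    by unfold_locales (use finite_J Z d_ge in auto)
  obtain p a where p: "p \<in> P" "p = (\<Sum>c\<in>R. fscale (a c) (\<nu> c))" "\<forall>c\<in>R. a c \<noteq> 0"
    by (rule P_coefficients)
  obtain e where e: "\<forall>b\<in>R. e b \<in> forms {..m} t"
    "\<forall>b\<in>R. \<forall>c\<in>R. mp_eval (e b) c = (if b = c then 1 else 0)" by (rule separators[OF le_refl])
  obtain e' where e': "\<forall>b\<in>R. e' b \<in> forms {..m} s"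
    "\<forall>b\<in>R. \<forall>c\<in>R. mp_eval (e' b) c = (if b = c then 1 else 0)" by (rule separators[OF st(2)])
  obtain h where h: "bij_betw h {..<card B} R"
    using ex_bij_betw_nat_finite[OF points.finite_R] card_R_eq by (metis atLeast0LessThan)
  have hR: "h i \<in> R" if "i < card B" for i using h that by (auto simp: bij_betw_def)
  have h_eq: "h i = h j \<longleftrightarrow> i = j" if "i < card B" "j < card B" for i j
    using h that by (auto simp: bij_betw_def inj_on_def)
  have eval_comb: "mp_eval (\<Sum>i<card B. pscale (x i) (e' (h i))) (h j) = x j" if j: "j < card B" for x j
  proof -
    have "mp_eval (\<Sum>i<card B. pscale (x i) (e' (h i))) (h j) = (\<Sum>i<card B. if i = j then x i else 0)"
      unfolding mp_eval_sum by (rule sum.cong) (use e'(2) hR h_eq j in auto)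
    then show ?thesis using j by simp
  qed
  have W_sub: "Z.W s \<subseteq> points.ideal_part s"
  proof
    fix f assume f: "f \<in> Z.W s"
    have "mp_eval f c = 0" if c: "c \<in> R" for c
    proof -
      \<comment> \<open>The product \<open>e c * f\<close> has degree \<open>d\<close> and comes
        from a linear form in \<open>Z\<close>, which vanishes at \<open>p\<close>. The separator
        \<open>e c\<close> leaves only the term of \<open>c\<close>, and \<open>a c\<close> is
        nonzero.\<close>
      have eq: "1 * d - s = t" using st(1) by simp
      have "e c \<in> forms {..m} (1 * d - s)" unfolding eq using e(1) c by blast
      then have "e c * f \<in> Z.V 1" by (rule Z.W_D[OF f, rotated]) (use st(1) in simp)
      then obtain l where l: "l \<in> forms J 1" "l \<in> Z" "ver_pull l = e c * f"
        by (auto simp: Z.V_def)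
      have "0 = mp_eval l p" using Z.linear_form_vanishes_on_span[OF P_Z p(1) l(1,2)] by simp
      also have "\<dots> = (\<Sum>b\<in>R. a b * mp_eval (e c * f) b)"
        using mp_eval_at_P[OF l(1) p(2)] l(3) by simp
      also have "\<dots> = (\<Sum>b\<in>R. if b = c then a b * mp_eval f b else 0)"
        by (rule sum.cong) (use e(2) c in auto)
      also have "\<dots> = a c * mp_eval f c" using c points.finite_R by simp
      finally show ?thesis using p(3) c by auto
    qed
    then show "f \<in> points.ideal_part s"
      using f Z.subset_forms by (auto simp: points.ideal_part_def)
  qed
  have codim: "Z.has_codim_ge (card B) s"
    unfolding Z.has_codim_ge_def indep_mod_def
  proof (intro exI[of _ "\<lambda>i. e' (h i)"] conjI allI impI ballI)
    show "e' (h i) \<in> forms {..m} s" if "i < card B" for i using e'(1) hR[OF that] by blast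
    fix x j assume x: "(\<Sum>i<card B. pscale (x i) (e' (h i))) \<in> Z.W s" and j: "j \<in> {..<card B}"
    then have "mp_eval (\<Sum>i<card B. pscale (x i) (e' (h i))) (h j) = 0"
      using W_sub hR by (auto simp: points.ideal_part_def)
    then show "x j = 0" using eval_comb j by simp
  qed
  have sub_W: "points.ideal_part s \<subseteq> Z.W s"
  proof (rule subsetI, rule ccontr)
    fix f assume f: "f \<in> points.ideal_part s" "f \<notin> Z.W s"
    \<comment> \<open>The separators together with \<open>f\<close> are independent modulo
      \<open>Z.W s\<close>: evaluation at \<open>R\<close> removes the coefficients of the
      separators, and \<open>f\<close> itself is outside. That is one dimension more than the degree
      of \<open>Z\<close> allows.\<close>
    let ?g = "\<lambda>i. if i < card B then e' (h i) else f"
    have "Z.has_codim_ge (Suc (card B)) s"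
      unfolding Z.has_codim_ge_def indep_mod_def
    proof (intro exI[of _ ?g] conjI allI impI)
      show "?g i \<in> forms {..m} s" for i
        using e'(1) hR[of i] f(1) by (auto simp: points.ideal_part_def)
      fix x assume x: "(\<Sum>i<Suc (card B). pscale (x i) (?g i)) \<in> Z.W s"
      have "(\<Sum>i<card B. pscale (x i) (?g i)) = (\<Sum>i<card B. pscale (x i) (e' (h i)))"
        by (rule sum.cong) auto
      then have sum: "(\<Sum>i<Suc (card B). pscale (x i) (?g i)) =
          (\<Sum>i<card B. pscale (x i) (e' (h i))) + pscale (x (card B)) f" by simp
      have x0: "x j = 0" if j: "j < card B" for j
      proof -
        have "(\<Sum>i<Suc (card B). pscale (x i) (?g i)) \<in> points.ideal_part s"
          using x W_sub by blast
        then have "mp_eval (\<Sum>i<Suc (card B). pscale (x i) (?g i)) (h j) = 0"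
          using hR[OF j] by (simp only: points.ideal_part_def mem_Collect_eq)
        moreover have "mp_eval f (h j) = 0" using f(1) hR[OF j] by (simp add: points.ideal_part_def)
        ultimately show ?thesis using eval_comb[OF j] unfolding sum by simp
      qed
      then have "pscale (x (card B)) f \<in> Z.W s" using x unfolding sum by simp
      then have "pscale (inverse (x (card B))) (pscale (x (card B)) f) \<in> Z.W s"
        by (rule pvec.subspace_scale[OF Z.subspace])
      then have "x (card B) = 0" using f(2) by (cases "x (card B) = 0") auto
      with x0 show "\<forall>i\<in>{..<Suc (card B)}. x i = 0" by (auto simp: less_Suc_eq)
    qed
    then have "Suc (card B) \<le> scheme_degree J Z" by (rule Z.has_codim_ge_le_degree[OF Z(2)])
    then show False using Z(4) by simp
  qed
  have sub_W': "points.ideal_part k \<subseteq> Z.W k" if "s \<le> k" for k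
    using that
  proof (induction k rule: dec_induct)
    case (step k)
    show ?case
    proof (rule points.ideal_part_Suc_subset[OF Z.subspace step.hyps(1)])
      fix l f :: "(nat, 'k) mpol"
      assume l: "l \<in> forms {..m} 1" and "f \<in> points.ideal_part k"
      then have "f \<in> Z.W k" using step.IH by blast
      then show "l * f \<in> Z.W (Suc k)"
        by (intro forms_mult_subset[OF Z.subspace _ l] Z.var_mult) auto
    qed
  qed (rule sub_W)
  have W_sub': "Z.W k \<subseteq> points.ideal_part k" if k: "s \<le> k" for k
  proof (rule subsetI, rule ccontr)
    fix f assume f: "f \<in> Z.W k" "f \<notin> points.ideal_part k"
    then obtain b where b: "b \<in> R" "mp_eval f b \<noteq> 0"
      using Z.subset_forms by (auto simp: points.ideal_part_def)
    obtain g where g: "\<And>i. i < card B \<Longrightarrow> g i \<in> forms {..m} k" "indep_mod (Z.W k) {..<card B} g"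
      using Z.has_codim_ge_mono[OF k codim] by (auto simp: Z.has_codim_ge_def)
    \<comment> \<open>The equations express that a combination \<open>G\<close> of the
      \<open>g i\<close> is proportional to \<open>f\<close> on \<open>R\<close>. The one at
      \<open>b\<close> holds trivially, which leaves one equation fewer than unknowns. A multiple of
      \<open>f\<close> then differs from \<open>G\<close> by an element of the ideal of
      \<open>R\<close>, and \<open>G\<close> lies in \<open>Z.W k\<close> against
      independence.\<close>
    have "card (R - {b}) < card {..<card B}"
      using b(1) points.finite_R card_R_eq by (metis card_Diff1_less card_lessThan)
    from homogeneous_system_nontrivial[OF _ _ this,
        of "\<lambda>i c. mp_eval (g i) c * mp_eval f b - mp_eval (g i) b * mp_eval f c"]
    obtain x where x: "\<exists>i\<in>{..<card B}. x i \<noteq> 0"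
      "\<forall>c\<in>R - {b}. (\<Sum>i<card B. x i *
        (mp_eval (g i) c * mp_eval f b - mp_eval (g i) b * mp_eval f c)) = 0"
      using points.finite_R by auto
    define G where "G = (\<Sum>i<card B. pscale (x i) (g i))"
    have eq: "mp_eval G c * mp_eval f b - mp_eval G b * mp_eval f c = (\<Sum>i<card B. x i *
        (mp_eval (g i) c * mp_eval f b - mp_eval (g i) b * mp_eval f c))" for c
      by (simp add: G_def mp_eval_sum sum_distrib_right right_diff_distrib sum_subtractf mult.assoc)
    have ratio: "mp_eval G c * mp_eval f b = mp_eval G b * mp_eval f c" if "c \<in> R" for c
      using x(2) eq[of c] that by (cases "c = b") auto
    define \<gamma> where "\<gamma> = mp_eval G b / mp_eval f b"
    have "G \<in> forms {..m} k" unfolding G_def using g(1) by (intro forms_sum forms_pscale) auto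
    moreover have "f \<in> forms {..m} k" using f(1) Z.subset_forms by blast
    ultimately have "G - pscale \<gamma> f \<in> points.ideal_part k"
      using ratio b(2) by (auto simp: points.ideal_part_def \<gamma>_def forms_diff forms_pscale field_simps)
    then have "G - pscale \<gamma> f \<in> Z.W k" using sub_W'[OF k] by blast
    then have "(G - pscale \<gamma> f) + pscale \<gamma> f \<in> Z.W k"
      by (rule pvec.subspace_add[OF Z.subspace]) (rule pvec.subspace_scale[OF Z.subspace f(1)])
    then have "G \<in> Z.W k" by simp
    then show False using g(2) x(1) by (auto simp: indep_mod_def G_def)
  qed
  interpret I: subscheme J "vanishing_ideal J (veronese m d ` B)"
    by unfold_locales (use finite_J scheme_B(1) in auto)
  have pos: "f \<in> Z \<longleftrightarrow> f \<in> vanishing_ideal J (veronese m d ` B)"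
    if f: "f \<in> forms J k" and k: "k \<ge> 1" for f k
  proof -
    have "s \<le> k * d" using k st by (metis le_add2 le_trans mult_1 mult_le_mono1)
    then have "Z.W (k * d) = points.ideal_part (k * d)" using sub_W' W_sub' by blast
    then have "f \<in> Z \<longleftrightarrow> ver_pull f \<in> points.ideal_part (k * d)"
      using Z.ver_pull_in_V_iff[OF f] Z.W_mult_d[of k] by simp
    also have "\<dots> \<longleftrightarrow> (\<forall>c\<in>R. mp_eval f (\<nu> c) = 0)"
      using ver_pull_forms[OF f] mp_eval_ver_pull[OF subsetD[OF forms_subset_polys f]]
      by (simp add: points.ideal_part_def)
    finally show ?thesis using vanishing_ideal_B_iff[OF f] by simp
  qed
  show ?thesis
  proof (rule Z.Z_eqI[OF I.subscheme_axioms])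
    fix k and f :: "(nat \<Rightarrow>\<^sub>0 nat, 'k) mpol" assume f: "f \<in> forms J k"
    then have fJ: "f \<in> polys J" using forms_subset_polys by blast
    \<comment> \<open>Degree 0 is not covered by \<open>pos\<close>. Multiplication by coordinates
      raises the degree to a positive one, and saturation of both ideals leads back.\<close>
    have mult: "Poly_Mapping.single y 1 * f \<in> Z \<longleftrightarrow>
        Poly_Mapping.single y 1 * f \<in> vanishing_ideal J (veronese m d ` B)" if "y \<in> monoms J 1" for y
      using forms_mult[OF single_in_forms[OF that] f] by (rule pos) simp
    have yJ: "Poly_Mapping.single y 1 \<in> polys J" if "y \<in> monoms J 1" for y
      using single_in_forms[OF that] forms_subset_polys by blast
    show "f \<in> Z \<longleftrightarrow> f \<in> vanishing_ideal J (veronese m d ` B)"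
    proof
      assume "f \<in> Z"
      then show "f \<in> vanishing_ideal J (veronese m d ` B)"
        using mult yJ Z.Z_mult by (intro I.Z_saturated[OF fJ, where k = 1]) blast
    next
      assume "f \<in> vanishing_ideal J (veronese m d ` B)"
      then show "f \<in> Z"
        using mult yJ I.Z_mult by (intro Z.Z_saturated[OF fJ, where k = 1]) blast
    qed
  qed
qed

end

section \<open>Rank and border rank\<close>

text \<open>Both factors are made square by padding the first with zero columns. Every product in
  the Leibniz formula for the first factor then meets its zero column \<open>r\<close>.\<close>

lemma det_low_rank:
  fixes a b :: "nat \<Rightarrow> nat \<Rightarrow> 'a::comm_ring_1"
  assumes r: "r < n"
  shows "det (mat n n (\<lambda>(i, j). \<Sum>k<r. a i k * b k j)) = 0"
proof -
  define A where "A = mat n n (\<lambda>(i, k). if k < r then a i k else 0)"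
  define C where "C = mat n n (\<lambda>(k, j). b k j)"
  have carrier: "A \<in> carrier_mat n n" "C \<in> carrier_mat n n" by (simp_all add: A_def C_def)
  have "mat n n (\<lambda>(i, j). \<Sum>k<r. a i k * b k j) = A * C"
  proof (rule eq_matI)
    fix i j assume "i < dim_row (A * C)" "j < dim_col (A * C)"
    then have ij: "i < n" "j < n" by (simp_all add: A_def C_def)
    have "(A * C) $$ (i, j) = (\<Sum>k\<in>{0..<n}. (if k < r then a i k else 0) * b k j)"
      using ij by (simp add: A_def C_def scalar_prod_def)
    also have "\<dots> = (\<Sum>k<r. a i k * b k j)"
      by (rule sum.mono_neutral_cong_right) (use r in auto)
    finally show "mat n n (\<lambda>(i, j). \<Sum>k<r. a i k * b k j) $$ (i, j) = (A * C) $$ (i, j)"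
      using ij by simp
  qed (simp_all add: A_def C_def)
  moreover have "det A = 0"
    unfolding det_def'[OF carrier(1)]
  proof (rule sum.neutral, rule ballI)
    fix p assume "p \<in> {p. p permutes {0..<n}}"
    then have p: "p permutes {0..<n}" by simp
    then obtain i where i: "i \<in> {0..<n}" "p i = r"
      using r permutes_image[OF p] by (metis atLeastLessThan_iff imageE zero_le)
    then have "A $$ (i, p i) = 0" using r by (simp add: A_def)
    then have "(\<Prod>i = 0..<n. A $$ (i, p i)) = 0" using i(1) by (meson finite_atLeastLessThan prod_zero)
    then show "signof p * (\<Prod>i = 0..<n. A $$ (i, p i)) = 0" by simp
  qed
  ultimately show ?thesis using det_mult[OF carrier] by simp
qed

lemma mp_eval_det: "mp_eval (det (mat n n L)) x = det (mat n n (\<lambda>u. mp_eval (L u) x))"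
proof -
  interpret hom: comm_ring_hom "\<lambda>f. mp_eval f x"
    by unfold_locales simp_all
  have "map_mat (\<lambda>f. mp_eval f x) (mat n n L) = mat n n (\<lambda>u. mp_eval (L u) x)"
    by (rule eq_matI) auto
  then show ?thesis using hom.hom_det[of "mat n n L"] by simp
qed

lemma forms_prod:
  assumes "finite I" "\<And>i. i \<in> I \<Longrightarrow> F i \<in> forms J 1"
  shows "(\<Prod>i\<in>I. F i) \<in> forms J (card I)"
  using assms
proof (induction I rule: finite_induct)
  case (insert i I)
  then show ?case using forms_mult[of "F i" J 1 "\<Prod>i\<in>I. F i" "card I"] by simp
qed (simp add: one_in_forms)

lemma det_in_forms:
  assumes L: "\<And>i j. i < n \<Longrightarrow> j < n \<Longrightarrow> L (i, j) \<in> forms J 1"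
  shows "det (mat n n L) \<in> forms J n"
proof -
  have "mat n n L \<in> carrier_mat n n" by simp
  then have "det (mat n n L) =
      (\<Sum>p\<in>{p. p permutes {0..<n}}. signof p * (\<Prod>i = 0..<n. mat n n L $$ (i, p i)))"
    by (rule det_def')
  also have "\<dots> \<in> forms J n"
  proof (rule forms_sum)
    fix p assume "p \<in> {p. p permutes {0..<n}}"
    then have p: "p i < n" if "i < n" for i
      using that permutes_in_image[of p "{0..<n}" i] by simp
    have "(\<Prod>i = 0..<n. mat n n L $$ (i, p i)) \<in> forms J (card {0..<n})"
      by (rule forms_prod) (use p L in auto)
    then show "signof p * (\<Prod>i = 0..<n. mat n n L $$ (i, p i)) \<in> forms J n"
      using pvec.subspace_neg[OF subspace_forms, of _ J n] by (cases "evenperm p") (auto simp: sign_def)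
  qed
  finally show ?thesis .
qed

section \<open>Border rank bounded below by a catalecticant minor\<close>

context minimal_decomposition
begin

text \<open>
  The determinant \<open>D\<close> below is a minor of the catalecticant matrix of forms of degree \<open>t\<close> and
  \<open>s\<close>, in bases for which the matrix at \<open>P\<close> is diagonal.
\<close>

lemma border_rank_lower_bound:
  assumes r: "r < card B"
  shows "P \<notin> secant_variety m d r"
proof -
  let ?n = "card B"
  obtain p a where p: "p \<in> P" "p = (\<Sum>c\<in>R. fscale (a c) (\<nu> c))" "\<forall>c\<in>R. a c \<noteq> 0"
    by (rule P_coefficients)
  obtain f where f: "\<forall>b\<in>R. f b \<in> forms {..m} t"
    "\<forall>b\<in>R. \<forall>c\<in>R. mp_eval (f b) c = (if b = c then 1 else 0)" by (rule separators[OF le_refl])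
  obtain g where g: "\<forall>b\<in>R. g b \<in> forms {..m} s"
    "\<forall>b\<in>R. \<forall>c\<in>R. mp_eval (g b) c = (if b = c then 1 else 0)" by (rule separators[OF st(2)])
  obtain h where h: "bij_betw h {..<?n} R"
    using ex_bij_betw_nat_finite[OF points.finite_R] card_R_eq by (metis atLeast0LessThan)
  have hR: "h i \<in> R" if "i < ?n" for i using h that by (auto simp: bij_betw_def)
  have h_eq: "h i = h j \<longleftrightarrow> i = j" if "i < ?n" "j < ?n" for i j
    using h that by (auto simp: bij_betw_def inj_on_def)
  have "\<exists>l\<in>forms J 1. ver_pull l = f (h i) * g (h j)" if "i < ?n" "j < ?n" for i j
  proof -
    have "f (h i) * g (h j) \<in> forms {..m} (t + s)"
      using f(1) g(1) hR that by (intro forms_mult) auto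
    then have "f (h i) * g (h j) \<in> forms {..m} (1 * d)" using st(1) by simp
    then show ?thesis by (rule ver_pull_surj) blast
  qed
  then obtain L where L: "\<And>i j. i < ?n \<Longrightarrow> j < ?n \<Longrightarrow> L i j \<in> forms J 1"
    "\<And>i j. i < ?n \<Longrightarrow> j < ?n \<Longrightarrow> ver_pull (L i j) = f (h i) * g (h j)"
    by metis
  define D where "D = det (mat ?n ?n (\<lambda>(i, j). L i j))"
  have D: "D \<in> forms J ?n" unfolding D_def by (rule det_in_forms) (use L(1) in auto)
  have D_eval: "mp_eval D y = det (mat ?n ?n (\<lambda>(i, j). mp_eval (L i j) y))" for y
    unfolding D_def mp_eval_det by (simp add: case_prod_unfold)
  have D_p: "mp_eval D p \<noteq> 0"
  proof -
    have entry: "mp_eval (L i j) p = (if i = j then a (h i) else 0)" if ij: "i < ?n" "j < ?n" for i j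
    proof -
      have "mp_eval (L i j) p = (\<Sum>c\<in>R. a c * mp_eval (f (h i) * g (h j)) c)"
        using mp_eval_at_P[OF L(1)[OF ij] p(2)] L(2)[OF ij] by simp
      also have "\<dots> = (\<Sum>c\<in>R. if c = h i then (if i = j then a c else 0) else 0)"
        by (rule sum.cong) (use f(2) g(2) hR h_eq ij in auto)
      also have "\<dots> = (if i = j then a (h i) else 0)" using points.finite_R hR ij by simp
      finally show ?thesis .
    qed
    let ?M = "mat ?n ?n (\<lambda>(i, j). mp_eval (L i j) p)"
    have "upper_triangular ?M" using entry by (auto simp: upper_triangular_def)
    then have "det ?M = prod_list (diag_mat ?M)" by (rule det_upper_triangular[where n = ?n]) simp
    moreover have "0 \<notin> set (diag_mat ?M)" using entry p(3) hR by (auto simp: diag_mat_def)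
    ultimately show ?thesis using D_eval by (simp add: prod_list_zero_iff)
  qed
  have D_span: "vanishes_at D q"
    if Q: "Q ` {..<r} \<subseteq> veronese_variety m d" and q: "q \<in> span_pts J (Q ` {..<r})" for Q q
  proof -
    have "\<exists>x. \<nu> x \<in> q" if "q \<in> veronese_variety m d" for q
    proof -
      obtain b where b: "b \<in> proj_space {..m}" "q = veronese m d b"
        using \<open>q \<in> _\<close> by (auto simp: veronese_variety_def)
      obtain x where "x \<in> b" using proj_space_nonempty[OF b(1)] .
      then show ?thesis using veronese_point(2)[OF b(1)] b(2) by blast
    qed
    then obtain X where X: "\<And>q. q \<in> veronese_variety m d \<Longrightarrow> \<nu> (X q) \<in> q" by metis
    have Q': "Q ` {..<r} \<subseteq> proj_space J" using Q veronese_variety_subset by (rule order_trans)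
    have "mp_eval D y = 0" if y: "y \<in> q" for y
    proof -
      have "y \<in> fvec.span ((\<lambda>q. \<nu> (X q)) ` Q ` {..<r})"
        by (rule in_span_ptsD[OF Q' _ q y]) (use X Q in blast)
      then have "y \<in> fvec.span ((\<lambda>k. \<nu> (X (Q k))) ` {..<r})" by (simp add: image_image)
      then obtain e where e: "y = (\<Sum>k<r. fscale (e k) (\<nu> (X (Q k))))"
        by (rule span_image_finite[OF finite_lessThan])
      \<comment> \<open>Each of the \<open>r\<close> points contributes a matrix of rank one,
        because the pullback of \<open>L i j\<close> is a product of a factor depending on
        \<open>i\<close> and one depending on \<open>j\<close>.\<close>
      have "mp_eval (L i j) y = (\<Sum>k<r. (e k * mp_eval (f (h i)) (X (Q k))) * mp_eval (g (h j)) (X (Q k)))"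
        if ij: "i < ?n" "j < ?n" for i j
        unfolding e mp_eval_linear_sum[OF L(1)[OF ij]]
        using mp_eval_ver_pull[OF subsetD[OF forms_subset_polys L(1)[OF ij]]] L(2)[OF ij]
        by (simp add: mult.assoc flip: mp_eval_mult)
      then have "mat ?n ?n (\<lambda>(i, j). mp_eval (L i j) y) =
          mat ?n ?n (\<lambda>(i, j). \<Sum>k<r. (e k * mp_eval (f (h i)) (X (Q k))) * mp_eval (g (h j)) (X (Q k)))"
        by (intro eq_matI) auto
      then show ?thesis
        unfolding D_eval using det_low_rank[OF r] by simp
    qed
    then show ?thesis by (simp add: vanishes_at_def)
  qed
  let ?C = "{q \<in> proj_space J. \<forall>f\<in>{D}. vanishes_at f q}"
  have "zariski_closed J ?C" unfolding zariski_closed_def using D by blast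
  moreover have "(\<Union>Q \<in> {Q :: nat \<Rightarrow> _. Q ` {..<r} \<subseteq> veronese_variety m d}.
      span_pts J (Q ` {..<r})) \<subseteq> ?C"
  proof (rule UN_least, rule subsetI)
    fix Q :: "nat \<Rightarrow> ((nat \<Rightarrow>\<^sub>0 nat) \<Rightarrow> 'k) set" and q
    assume "Q \<in> {Q. Q ` {..<r} \<subseteq> veronese_variety m d}" and q: "q \<in> span_pts J (Q ` {..<r})"
    then have Q: "Q ` {..<r} \<subseteq> veronese_variety m d" by simp
    have "q \<in> proj_space J"
      using span_pts_subset[OF order_trans[OF Q veronese_variety_subset]] q by blast
    then show "q \<in> ?C" using D_span[OF Q q] by simp
  qed
  moreover have "P \<notin> ?C" using D_p p(1) by (auto simp: vanishes_at_def)
  ultimately show ?thesis unfolding secant_variety_def zariski_closure_def by blast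
qed

lemma span_pts_in_secant:
  assumes S: "S \<subseteq> veronese_variety m d" "finite S" "card S = r"
    and q: "q \<in> span_pts J S"
  shows "q \<in> secant_variety m d r"
proof -
  obtain Q where "bij_betw Q {..<r} S"
    using ex_bij_betw_nat_finite[OF S(2)] S(3) by (metis atLeast0LessThan)
  then have Q: "Q ` {..<r} = S" by (simp add: bij_betw_def)
  have "q \<in> (\<Union>Q \<in> {Q :: nat \<Rightarrow> _. Q ` {..<r} \<subseteq> veronese_variety m d}. span_pts J (Q ` {..<r}))"
    using S(1) q Q by (intro UN_I[of Q]) auto
  then show ?thesis unfolding secant_variety_def zariski_closure_def by blast
qed

lemma card_veronese_B: "card (veronese m d ` B) = card B"
  by (rule card_image[OF inj_veronese])

lemma sym_border_rank_eq: "sym_border_rank m d P = card B"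
  unfolding sym_border_rank_def
proof (rule Least_equality)
  show "P \<in> secant_variety m d (card B)"
    by (rule span_pts_in_secant[OF veronese_B_subset finite_imageI[OF finite_B] card_veronese_B P_span])
  show "card B \<le> r" if "P \<in> secant_variety m d r" for r
    using border_rank_lower_bound[of r] that by (meson not_le)
qed

text \<open>A decomposition into \<open>r\<close> points puts \<open>P\<close> into the
  corresponding secant variety, so the bound for the border rank also bounds the rank.\<close>

lemma sym_rank_eq: "sym_rank m d P = card B"
  unfolding sym_rank_def
proof (rule Least_equality)
  show "\<exists>S\<subseteq>veronese_variety m d. finite S \<and> card S = card B \<and> P \<in> span_pts J S"
    using veronese_B_subset finite_B card_veronese_B P_span by blast
  show "card B \<le> r" if "\<exists>S\<subseteq>veronese_variety m d. finite S \<and> card S = r \<and> P \<in> span_pts J S" for r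
    using that span_pts_in_secant border_rank_lower_bound[of r] by (meson not_le)
qed

end

theorem theorem2:
  fixes m d :: nat
    and B :: "(nat \<Rightarrow> 'k::{alg_closed_field, field_char_0}) set set"
    and P :: "((nat \<Rightarrow>\<^sub>0 nat) \<Rightarrow> 'k) set"
  assumes "m \<ge> 1" and "d \<ge> 5"
    and "finite B" and "B \<subseteq> proj_space {..m}" and "card B \<le> d"
    and "\<And>A. A \<subseteq> B \<Longrightarrow> card A = (d + 1) div 2 \<Longrightarrow> \<not> collinear_pts {..m} A"
    and "P \<in> span_pts (ver_coords m d) (veronese m d ` B)"
    and "\<And>E. E \<subset> veronese m d ` B \<Longrightarrow> P \<notin> span_pts (ver_coords m d) E"
  shows "sym_rank m d P = card B \<and> sym_border_rank m d P = card B \<and>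
    (\<forall>Z :: (nat \<Rightarrow>\<^sub>0 nat, 'k) mpol set.
       (closed_subscheme (ver_coords m d) Z \<and>
        zero_dimensional (ver_coords m d) Z \<and>
        vanishing_ideal (ver_coords m d) (veronese_variety m d) \<subseteq> Z \<and>
        scheme_degree (ver_coords m d) Z \<le> card B \<and>
        P \<in> scheme_span (ver_coords m d) Z)
       \<longleftrightarrow> Z = vanishing_ideal (ver_coords m d) (veronese m d ` B))"
proof -
  interpret minimal_decomposition m d B P
    by unfold_locales (use assms in auto)
  show ?thesis
    using sym_rank_eq sym_border_rank_eq scheme_B P_span scheme_unique by blast
qed

end
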